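(* Let $f:\mathbb{R}^N\to\mathbb{R}^N$ be a $C^2$ function and let $\Gamma\subseteq O(N)$ be a compact group such that $f(\gamma x)=\gamma f(x)$ for all $x\in\mathbb{R}^N$ and $\gamma\in\Gamma$. Suppose the ODE $\dot x(t)=f(x(t))$ has a periodic solution $x_\ast$ with minimal period $p>0$ which is a discrete wave, i.e. $H/K\cong\mathbb{Z}_n$ for some $n\in\mathbb{N}$, where $K$ and $H$ are defined in the context. Let $Y(t)\in\mathbb{R}^{N\times N}$ be the fundamental solution of $\dot y(t)=f'(x_\ast(t))y(t)$ with $Y(0)=I$. Assume that $x_\ast$ has a spatio-temporal symmetry $h\in H$, with associated time shift $\theta_h$, such that the twisted monodromy operator $Y_h:=h^{-1}Y(\theta_h)$ has the following properties: (1) the eigenvalue $1\in\sigma(Y_h)$ is algebraically simple and $Y_h$ has no other eigenvalues on the unit circle; (2) if $\mu\in\sigma(Y_h)$ and $|\mu|>1$, then $\mu$ is real with $-e^2<\mu<-1$. Then there exists an open interval $I\subseteq(-\infty,0)$ such that for every $b\in I$, $x_\ast$ is a stable solution of the delay differential equation $$\dot x(t)=f(x(t))+b\,[x(t)-h\,x(t-\theta_h)].$$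
   Context: $K:=\{\gamma\in\Gamma\mid \gamma x_\ast(0)=x_\ast(0)\}$ (spatial symmetries) and $H:=\{\gamma\in\Gamma\mid \gamma\mathcal{O}=\mathcal{O}\}$ with $\mathcal{O}=\{x_\ast(t)\mid t\in\mathbb{R}\}$ (spatio-temporal symmetries). For $h\in H$ there is a unique $\theta_h\in[0,p)$ with $h x_\ast(0)=x_\ast(\theta_h)$, and then $h x_\ast(t)=x_\ast(t+\theta_h)$ for all $t$; $K$ is the kernel of the homomorphism $h\mapsto\theta_h\in\mathbb{R}/p\mathbb{Z}$, so $K$ is normal in $H$. $Y_h$ always has the eigenvalue $1$ (eigenvector $\dot x_\ast(0)$). The delay equation is considered with state space $C([-\theta_h,0],\mathbb{R}^N)$; $x_\ast$ is a periodic solution of it, and "stable" refers to stability of this periodic solution of the delay equation in the usual sense of stability theory for DDEs. *)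

theory Defs
  imports "HOL-Analysis.Analysis" "HOL-Algebra.Elementary_Groups" "HOL-Computational_Algebra.Polynomial"
begin

definition char_poly_c :: "real^'n^'n \<Rightarrow> complex poly" where
  "char_poly_c A = det (\<chi> i j. (if i = j then [:0, 1:] else 0) - [: complex_of_real (A $ i $ j) :])"

definition spectrum_c :: "real^'n^'n \<Rightarrow> complex set" where
  "spectrum_c A = {\<mu>. poly (char_poly_c A) \<mu> = 0}"

definition alg_mult :: "real^'n^'n \<Rightarrow> complex \<Rightarrow> nat" where
  "alg_mult A \<mu> = Polynomial.order \<mu> (char_poly_c A)"

definition spatial_sym :: "(real^'n^'n) set \<Rightarrow> (real \<Rightarrow> real^'n) \<Rightarrow> (real^'n^'n) set" where
  "spatial_sym \<Gamma> xs = {\<gamma> \<in> \<Gamma>. \<gamma> *v xs 0 = xs 0}"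

definition spatiotemporal_sym :: "(real^'n^'n) set \<Rightarrow> (real \<Rightarrow> real^'n) \<Rightarrow> (real^'n^'n) set" where
  "spatiotemporal_sym \<Gamma> xs = {\<gamma> \<in> \<Gamma>. (\<lambda>v. \<gamma> *v v) ` range xs = range xs}"

definition matrix_group :: "(real^'n^'n) set \<Rightarrow> (real^'n^'n) monoid" where
  "matrix_group S = \<lparr>carrier = S, monoid.mult = (\<lambda>A B. A ** B), one = mat 1\<rparr>"

definition discrete_wave :: "(real^'n^'n) set \<Rightarrow> (real \<Rightarrow> real^'n) \<Rightarrow> bool" where
  "discrete_wave \<Gamma> xs \<longleftrightarrow>
     (\<exists>n::nat. n \<ge> 1 \<and>
        (matrix_group (spatiotemporal_sym \<Gamma> xs) Mod spatial_sym \<Gamma> xs) \<cong> integer_mod_group n)"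

definition dde_solution_on :: "(real^'n \<Rightarrow> real^'n \<Rightarrow> real^'n) \<Rightarrow> real \<Rightarrow> real \<Rightarrow> (real \<Rightarrow> real^'n) \<Rightarrow> bool" where
  "dde_solution_on F \<tau> T x \<longleftrightarrow> continuous_on {-\<tau>..T} x \<and>
     (\<forall>t\<in>{0..T}. (x has_vector_derivative F (x t) (x (t - \<tau>))) (at t within {0..T}))"

definition dde_global_solution :: "(real^'n \<Rightarrow> real^'n \<Rightarrow> real^'n) \<Rightarrow> real \<Rightarrow> (real \<Rightarrow> real^'n) \<Rightarrow> bool" where
  "dde_global_solution F \<tau> x \<longleftrightarrow> continuous_on {-\<tau>..} x \<and>
     (\<forall>t\<in>{0..}. (x has_vector_derivative F (x t) (x (t - \<tau>))) (at t within {0..}))"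

definition dde_stable :: "(real^'n \<Rightarrow> real^'n \<Rightarrow> real^'n) \<Rightarrow> real \<Rightarrow> (real \<Rightarrow> real^'n) \<Rightarrow> bool" where
  "dde_stable F \<tau> xs \<longleftrightarrow>
     (\<forall>\<epsilon>>0. \<exists>\<delta>>0.
        (\<forall>\<phi>. continuous_on {-\<tau>..0} \<phi> \<longrightarrow> (\<forall>s\<in>{-\<tau>..0}. norm (\<phi> s - xs s) < \<delta>) \<longrightarrow>
              (\<exists>x. dde_global_solution F \<tau> x \<and> (\<forall>s\<in>{-\<tau>..0}. x s = \<phi> s))) \<and>
        (\<forall>T x. T \<ge> 0 \<longrightarrow> dde_solution_on F \<tau> T x \<longrightarrow> (\<forall>s\<in>{-\<tau>..0}. norm (x s - xs s) < \<delta>) \<longrightarrow>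
              (\<forall>t\<in>{0..T}. norm (x t - xs t) < \<epsilon>)))"

end

theory Submission
  imports Defs "HOL-Complex_Analysis.Complex_Analysis" "HOL-Computational_Algebra.Fundamental_Theorem_Algebra"
begin

unbundle no fps_syntax

text \<open>
  Cut time into blocks of length \<open>\<theta>\<close> and turn the \<open>n\<close>-th block back by a power of \<open>h\<close>. By equivariance the
  delay equation becomes \<open>w\<^sub>n' = f(w\<^sub>n) + b (w\<^sub>n - w\<^sub>n\<^sub>-\<^sub>1)\<close> on \<open>[0, \<theta>]\<close> with \<open>w\<^sub>n(0) = h\<inverse> w\<^sub>n\<^sub>-\<^sub>1(\<theta>)\<close>, and all
  time shifts of the periodic orbit are fixed points. In the frame \<open>w = x(\<cdot> + \<phi>) + Y(\<cdot> + \<phi>) z\<close> the linearization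
  is, for every phase \<open>\<phi>\<close>, the same map \<open>W\<close>: the block \<open>z\<close> is sent to the solution of \<open>w' = b (w - z)\<close>,
  \<open>w(0) = Y\<^sub>h z(\<theta>)\<close>.

  Along the simple eigenvalue 1 of \<open>Y\<^sub>h\<close>, \<open>W\<close> is an averaging operator and contracts oscillations. On the
  complement, the endpoint values of the iterates satisfy a renewal equation with symbol
  \<open>E(\<zeta>) = \<zeta> exp(- \<beta> (1 - \<zeta>))\<close>, where \<open>\<beta> = - b \<theta>\<close>. If \<open>max (ln \<bar>\<mu>\<bar>) / 2 < \<beta> < 1\<close>, the maximum being over the
  unstable eigenvalues, then \<open>\<mu> E(\<zeta>) \<noteq> 1\<close> on the closed unit disc for all remaining eigenvalues \<open>\<mu>\<close>; hence the
  resolvent \<open>(I - E(\<zeta>) Y\<^sub>h)\<inverse>\<close>, restricted to the complement, is holomorphic on a larger disc and its Taylor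
  coefficients are summable. So the iterates of \<open>W\<close> converge uniformly to multiples of the velocity \<open>f(x(0))\<close>.

  For the nonlinear equation, after a fixed number of blocks the deviation from the orbit halves, provided
  the phase is readjusted by the neutral component. The phase corrections are dominated by a geometric
  series, which gives Lyapunov stability.
\<close>

subsection \<open>Linear algebra\<close>


text \<open>The bound \<open>e^2\<close> on the unstable multipliers comes from the boundary point
  \<zeta> = -1: as \<open>\<bar>\<mu>\<bar>\<close> grows, a negative \<mu> first meets
  \<open>\<mu> E(\<zeta>) = 1\<close> there, at \<open>\<bar>\<mu>\<bar> = exp (2 \<beta>)\<close>,
  while \<beta> < 1 keeps \<open>E\<close> off the negative axis at nonreal points of the closed
  disc. The obstacle is that the fixed point is never isolated: all time shifts are fixed, so the
  linearization keeps the eigenvalue 1 and cannot contract. The frame built from \<open>Y\<close>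
  makes this harmless: the delayed term stays the scalar coupling \<open>k (y - z)\<close>, because
  consecutive blocks are read in the same frame, and moving along the velocity is, up to second
  order, a change of phase. The state space is infinite dimensional, but a block enters the next
  initial value only through its endpoint. The renewal equation for the endpoints is finite
  dimensional, so the Taylor coefficients of a matrix inverse replace any spectral theory of
  \<open>W\<close>. The case \<theta> = 0 must be ruled out separately, since the interval for
  \<open>b\<close> has endpoints divided by \<theta>.\<close>

lemma continuous_on_det:
  fixes A :: "'a::topological_space \<Rightarrow> 'b::real_normed_field^'n^'n"
  assumes "\<And>i j. continuous_on S (\<lambda>x. A x $ i $ j)"
  shows "continuous_on S (\<lambda>x. det (A x))"
  unfolding det_def
  by (intro continuous_on_sum continuous_on_mult continuous_on_const continuous_on_prod assms)

lemma holomorphic_on_det: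
  fixes A :: "complex \<Rightarrow> complex^'n^'n"
  assumes "\<And>i j. (\<lambda>x. A x $ i $ j) holomorphic_on S"
  shows "(\<lambda>x. det (A x)) holomorphic_on S"
  unfolding det_def
  by (intro holomorphic_on_sum holomorphic_on_mult holomorphic_on_const holomorphic_on_prod assms)

lemma matrix_inv_mult:
  fixes A :: "'a::field^'n^'n"
  assumes "det A \<noteq> 0"
  shows "A ** matrix_inv A = mat 1" "matrix_inv A ** A = mat 1"
proof -
  have "\<exists>A'. A ** A' = mat 1 \<and> A' ** A = mat 1"
    using assms by (simp add: invertible_det_nz flip: invertible_def)
  then have "A ** matrix_inv A = mat 1 \<and> matrix_inv A ** A = mat 1"
    unfolding matrix_inv_def by (rule someI_ex)
  then show "A ** matrix_inv A = mat 1" "matrix_inv A ** A = mat 1"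
    by auto
qed

text \<open>Cramer's rule applied to the columns of the inverse. As a quotient of determinants, each
  entry inherits holomorphy or continuity from the entries of \<open>A\<close>; the resolvent and
  the inverse frame are both treated this way.\<close>

lemma matrix_inv_nth:
  fixes A :: "'a::field^'n^'n"
  assumes "det A \<noteq> 0"
  shows "matrix_inv A $ i $ j = det (\<chi> r s. if s = i then (if r = j then 1 else 0) else A $ r $ s) / det A"
proof -
  have "A *v (column j (matrix_inv A)) = (\<chi> r. if r = j then 1 else 0)"
    using matrix_inv_mult(1)[OF assms]
    by (simp add: vec_eq_iff matrix_matrix_mult_def matrix_vector_mult_def column_def mat_def)
  then have "column j (matrix_inv A) = (\<chi> s. det (\<chi> r t. if t = s then (\<chi> r. if r = j then 1 else 0) $ r else A $ r $ t) / det A)"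
    using cramer[OF assms] by blast
  then have "column j (matrix_inv A) $ i = det (\<chi> r t. if t = i then (\<chi> r. if r = j then 1 else 0) $ r else A $ r $ t) / det A"
    by simp
  also have "(\<chi> r t. if t = i then (\<chi> r. if r = j then 1 else 0) $ r else A $ r $ t) =
      (\<chi> r s. if s = i then (if r = j then 1 else 0) else A $ r $ s)"
    by (simp add: vec_eq_iff)
  finally show ?thesis
    by (simp add: column_def)
qed

section \<open>Complex eigenvalues of real matrices, and the left eigenvector of a simple
  eigenvalue\<close>

definition cmat :: "real^'n^'n \<Rightarrow> complex^'n^'n" where
  "cmat A = (\<chi> i j. complex_of_real (A $ i $ j))"

lemma poly_det:
  fixes M :: "complex poly^'n^'n"
  shows "poly (det M) x = det (\<chi> i j. poly (M $ i $ j) x)"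
  by (simp add: det_def poly_sum poly_prod)

lemma poly_char_poly_c: "poly (char_poly_c A) \<mu> = det (mat \<mu> - cmat A)"
  unfolding char_poly_c_def poly_det
  by (rule arg_cong[where f = det]) (simp add: vec_eq_iff mat_def cmat_def)

lemma mat_mult_vector: "mat c *v v = c *s v"
proof -
  have "(\<Sum>j\<in>UNIV. (if i = j then c else 0) * v $ j) = c * v $ i" for i
    by (simp add: if_distrib[of "\<lambda>x. x * _"] cong: if_cong)
  then show ?thesis
    by (simp add: vec_eq_iff matrix_vector_mult_def mat_def)
qed

lemma det_zero_iff_kernel:
  fixes A :: "'a::field^'n^'n"
  shows "det A = 0 \<longleftrightarrow> (\<exists>v. v \<noteq> 0 \<and> A *v v = 0)"
  using matrix_left_invertible_ker[of A] invertible_det_nz[of A] invertible_left_inverse[of A] by blast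

lemma spectrum_c_iff: "\<mu> \<in> spectrum_c A \<longleftrightarrow> (\<exists>v. v \<noteq> 0 \<and> cmat A *v v = \<mu> *s v)"
  unfolding spectrum_c_def mem_Collect_eq poly_char_poly_c det_zero_iff_kernel
  by (auto simp: matrix_vector_mult_diff_rdistrib mat_mult_vector)

lemma poly_char_poly_c_of_real:
  "poly (char_poly_c A) (complex_of_real x) = complex_of_real (det (mat x - A))"
proof -
  have "det (mat (complex_of_real x) - cmat A) = complex_of_real (det (mat x - A))"
    by (simp add: det_def mat_def cmat_def if_distrib[of complex_of_real] cong: if_cong)
  then show ?thesis
    by (simp add: poly_char_poly_c)
qed

lemma simple_eigenvalue_factor:
  assumes mult: "alg_mult B 1 = 1" and nz: "char_poly_c B \<noteq> 0"
  obtains g where "char_poly_c B = [:- 1, 1:] * g" "poly g 1 \<noteq> 0"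
proof -
  have "[:- 1, 1:] ^ 1 dvd char_poly_c B" and ndvd: "\<not> [:- 1, 1:] ^ Suc 1 dvd char_poly_c B"
    using order[OF nz, of 1] mult by (auto simp: alg_mult_def)
  then obtain g where g: "char_poly_c B = [:- 1, 1:] * g"
    by (metis dvdE power_one_right)
  have "\<not> [:- 1, 1:] dvd g"
    using ndvd unfolding g by (metis mult_dvd_mono dvd_refl power_Suc power_one_right)
  then show thesis
    using that[OF g] poly_eq_0_iff_dvd by blast
qed

text \<open>Simplicity of the eigenvalue is equivalent to \<open>e\<close> lying outside the range
  of \<open>I - B\<close>. It is exploited through one determinant: \<open>e\<close> and all columns
  of \<open>I - B\<close> but the \<open>k\<close>-th form a basis, and \<open>l\<close> is the
  coordinate functional of \<open>e\<close> in it. Hence \<open>l\<close> vanishes on the range of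
  \<open>I - B\<close>, which yields the spectral projection onto the eigenvector without a Jordan
  form.\<close>

lemma simple_eigenvalue_left_eigenvector:
  fixes B :: "real^'n^'n"
  assumes mult: "alg_mult B 1 = 1" and nz: "char_poly_c B \<noteq> 0"
    and e: "B *v e = e" "e \<noteq> 0"
  obtains l where "l \<bullet> e = 1" "\<And>x. l \<bullet> (B *v x) = l \<bullet> x"
    "\<And>v. B *v v = v \<Longrightarrow> l \<bullet> v = 0 \<Longrightarrow> v = 0"
proof -
  obtain k where k: "e $ k \<noteq> 0"
    using e(2) by (auto simp: vec_eq_iff)
  \<comment> \<open>\<open>x I - B\<close> with column \<open>k\<close> replaced by
    \<open>e\<close>. Since \<open>(x I - B) e = (x - 1) e\<close>, Cramer's rule divides the factor
    \<open>x - 1\<close> out of the characteristic polynomial: the determinant of \<open>Q x\<close>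
    is \<open>e $ k\<close> times the cofactor \<open>g\<close>.\<close>
  define Q where "Q x = (\<chi> i j. if j = k then e $ i else (mat x - B) $ i $ j)" for x :: real
  obtain g where g: "char_poly_c B = [:- 1, 1:] * g" and g1: "poly g 1 \<noteq> 0"
    using simple_eigenvalue_factor[OF mult nz] by blast
  have off: "complex_of_real (det (Q x)) = complex_of_real (e $ k) * poly g (complex_of_real x)"
    if "x \<noteq> 1" for x
  proof -
    have "(mat x - B) *v ((1 / (x - 1)) *s e) = (1 / (x - 1)) *s (x *s e - e)"
      by (simp add: matrix_vector_mult_diff_rdistrib mat_mult_vector vector_scalar_commute e(1))
    also have "\<dots> = e"
    proof -
      have "x *s e - e = (x - 1) *s e"
        by (simp add: vec_eq_iff algebra_simps)
      moreover have "(1 / (x - 1)) *s ((x - 1) *s e) = ((1 / (x - 1)) * (x - 1)) *s e"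
        by (rule vector_smult_assoc)
      moreover have "(1 / (x - 1)) * (x - 1) = 1"
        using that by simp
      ultimately show ?thesis
        by (metis vector_smult_lid)
    qed
    finally have *: "(mat x - B) *v ((1 / (x - 1)) *s e) = e" .
    have "det (Q x) = (1 / (x - 1)) * e $ k * det (mat x - B)"
      using cramer_lemma[of k "mat x - B" "(1 / (x - 1)) *s e"]
      unfolding * by (simp add: Q_def)
    then have "complex_of_real (det (Q x)) =
        complex_of_real (1 / (x - 1) * e $ k) * poly (char_poly_c B) (complex_of_real x)"
      by (simp add: poly_char_poly_c_of_real)
    also have "\<dots> = complex_of_real (e $ k) * poly g (complex_of_real x)"
      using that unfolding g by (simp add: field_simps)
    finally show ?thesis .
  qed
  have cont: "continuous_on UNIV (\<lambda>x. complex_of_real (det (Q x)))"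
  proof -
    have "continuous_on UNIV (\<lambda>x. Q x $ i $ j)" for i j
    proof (cases "j = k")
      case False
      then show ?thesis
        by (cases "i = j") (auto simp: Q_def mat_def intro!: continuous_intros)
    qed (simp add: Q_def)
    then show ?thesis
      by (intro continuous_on_of_real continuous_on_det)
  qed
  have cont': "continuous_on UNIV (\<lambda>x. complex_of_real (e $ k) * poly g (complex_of_real x))"
    by (intro continuous_intros)
  \<comment> \<open>The division by \<open>x - 1\<close> is legitimate only off 1; the value at 1
    follows by continuity of both sides, and there simplicity gives
    \<open>poly g 1 \<noteq> 0\<close>.\<close>
  have "complex_of_real (det (Q 1)) = complex_of_real (e $ k) * poly g (complex_of_real 1)"
  proof (rule tendsto_unique[of "at (1::real)"])
    show "((\<lambda>x. complex_of_real (det (Q x))) \<longlongrightarrow> complex_of_real (det (Q 1))) (at 1)"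
      using cont unfolding continuous_on_def by blast
    have "((\<lambda>x. complex_of_real (e $ k) * poly g (complex_of_real x)) \<longlongrightarrow> complex_of_real (e $ k) * poly g (complex_of_real 1)) (at 1)"
      using cont' unfolding continuous_on_def by blast
    then show "((\<lambda>x. complex_of_real (det (Q x))) \<longlongrightarrow> complex_of_real (e $ k) * poly g (complex_of_real 1)) (at 1)"
      by (rule Lim_transform_eventually) (auto simp: eventually_at_filter off)
  qed simp
  then have detQ: "det (Q 1) \<noteq> 0"
    using g1 k by auto
  define R where "R = matrix_inv (Q 1)"
  have RQ: "R ** Q 1 = mat 1"
    unfolding R_def by (rule matrix_inv_mult(2)[OF detQ])
  define l where "l = row k R"
  have Qv: "Q 1 *v v = v $ k *s e + (\<chi> i. \<Sum>j\<in>UNIV - {k}. (mat 1 - B) $ i $ j * v $ j)" for v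
    by (simp add: vec_eq_iff matrix_vector_mult_def Q_def sum.remove[of UNIV k] mult.commute)
  \<comment> \<open>Subtracting a multiple of \<open>e\<close> does not change
    \<open>(I - B) v\<close>, and the multiple is chosen to make the \<open>k\<close>-th coordinate
    vanish; on such vectors the replaced column is invisible.\<close>
  have IB: "(mat 1 - B) *v v = Q 1 *v (v - (v $ k / e $ k) *s e)" for v
  proof -
    define w where "w = v - (v $ k / e $ k) *s e"
    have wk: "w $ k = 0"
      using k by (simp add: w_def)
    have "(mat 1 - B) *v w = Q 1 *v w"
      unfolding Qv by (simp add: vec_eq_iff wk) (simp add: matrix_vector_mult_def wk sum.remove[of UNIV k])
    moreover have "(mat 1 - B) *v w = (mat 1 - B) *v v"
      by (simp add: w_def matrix_vector_mult_diff_distrib vector_scalar_commute matrix_vector_mult_diff_rdistrib e mat_mult_vector)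
    ultimately show ?thesis
      by (simp add: w_def)
  qed
  have lQ: "l \<bullet> (Q 1 *v v) = v $ k" for v
  proof -
    have "l \<bullet> (Q 1 *v v) = (R *v (Q 1 *v v)) $ k"
      by (simp add: l_def row_def matrix_vector_mult_def inner_vec_def)
    then show ?thesis
      by (simp add: matrix_vector_mul_assoc RQ)
  qed
  have "Q 1 *v (axis k 1) = e"
    by (simp add: Qv vec_eq_iff axis_def)
  then have le: "l \<bullet> e = 1"
    using lQ[of "axis k 1"] by (simp add: axis_def)
  show ?thesis
  proof
    show "l \<bullet> e = 1"
      by (rule le)
    fix x
    have "l \<bullet> ((mat 1 - B) *v x) = 0"
      unfolding IB lQ using k by simp
    then show "l \<bullet> (B *v x) = l \<bullet> x"
      by (simp add: matrix_vector_mult_diff_rdistrib inner_diff_right)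
  next
    fix v
    assume v: "B *v v = v" "l \<bullet> v = 0"
    have "Q 1 *v (v - (v $ k / e $ k) *s e) = 0"
      using IB[of v] v(1) by (simp add: matrix_vector_mult_diff_rdistrib)
    then have "v - (v $ k / e $ k) *s e = 0"
      using RQ by (metis matrix_vector_mul_assoc matrix_vector_mul_lid matrix_vector_mult_0_right)
    then show "v = 0"
      using v(2) le by (metis eq_iff_diff_eq_0 inner_scaleR_right mult_cancel_left1 scalar_mult_eq_scaleR scaleR_zero_left mult.right_neutral)
  qed
qed

text \<open>The imaginary part of the equation forces \<zeta> to be real: for
  \<open>y \<noteq> 0\<close> it gives \<open>\<bar>\<zeta>\<bar>\<^sup>2 sin\<^sup>2(\<beta> y) =
  y\<^sup>2\<close>, impossible because \<open>\<bar>sin (\<beta> y)\<bar> \<le> \<beta>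
  \<bar>y\<bar> < \<bar>y\<bar>\<close>. For real \<zeta> = -t with 0 < t \<le> 1, the chain
  \<open>t \<le> exp (t - 1) \<le> exp (\<beta> (t - 1))\<close> bounds the modulus by
  \<open>m exp (- 2 \<beta>) < 1\<close>. Both cases use \<beta> < 1.\<close>

lemma characteristic_factor_nonzero:
  fixes \<zeta> :: complex
  assumes \<beta>: "0 < \<beta>" "\<beta> < 1" and m: "0 < m" "m < exp (2 * \<beta>)" and \<zeta>: "cmod \<zeta> \<le> 1"
  shows "of_real (- m) * (\<zeta> * exp (of_real (- \<beta>) + of_real \<beta> * \<zeta>)) \<noteq> 1"
proof
  define x y where "x = Re \<zeta>" and "y = Im \<zeta>"
  define q where "q = m * exp (- \<beta> + \<beta> * x)"
  have q: "q > 0"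
    using m by (simp add: q_def)
  assume eq: "of_real (- m) * (\<zeta> * exp (of_real (- \<beta>) + of_real \<beta> * \<zeta>)) = 1"
  have re: "q * (x * cos (\<beta> * y) - y * sin (\<beta> * y)) = - 1"
    using arg_cong[OF eq, of Re] by (simp add: Re_exp Im_exp x_def y_def q_def algebra_simps)
  have "q * (x * sin (\<beta> * y) + y * cos (\<beta> * y)) = 0"
    using arg_cong[OF eq, of Im] by (simp add: Re_exp Im_exp x_def y_def q_def algebra_simps)
  then have im: "x * sin (\<beta> * y) + y * cos (\<beta> * y) = 0"
    using q by simp
  have xy: "\<bar>x\<bar> \<le> 1" "\<bar>y\<bar> \<le> 1" "x\<^sup>2 + y\<^sup>2 \<le> 1"
    using \<zeta> abs_Re_le_cmod[of \<zeta>] abs_Im_le_cmod[of \<zeta>] cmod_power2[of \<zeta>]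
    by (auto simp: x_def y_def power_le_one simp flip: cmod_power2)
  show False
  proof (cases "y = 0")
    case True
    then have qx: "q * x = - 1"
      using re by simp
    define t where "t = - x"
    have t: "t > 0" "t \<le> 1"
      using qx q xy by (auto simp: t_def) (smt (verit) mult_nonneg_nonneg)
    have "m * (t * exp (- \<beta> - \<beta> * t)) = 1"
      using qx by (simp add: q_def t_def algebra_simps)
    moreover have "t * exp (- \<beta> - \<beta> * t) \<le> exp (- 2 * \<beta>)"
    proof -
      have "t \<le> exp (t - 1)"
        using exp_ge_add_one_self[of "t - 1"] by simp
      also have "t - 1 \<le> \<beta> * (t - 1)"
        using t \<beta> by (simp add: mult_le_cancel_right1 mult_right_mono_neg)
      finally have "t * exp (- \<beta> - \<beta> * t) \<le> exp (\<beta> * (t - 1)) * exp (- \<beta> - \<beta> * t)"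
        by simp
      also have "\<dots> = exp (- 2 * \<beta>)"
        by (simp add: algebra_simps flip: exp_add)
      finally show ?thesis .
    qed
    ultimately have "1 \<le> m * exp (- 2 * \<beta>)"
      using m by (metis less_le mult_le_cancel_left_pos)
    then have "exp (2 * \<beta>) \<le> m"
      by (simp add: exp_minus field_simps)
    with m show False
      by simp
  next
    case False
    have "x\<^sup>2 * (sin (\<beta> * y))\<^sup>2 = y\<^sup>2 * (cos (\<beta> * y))\<^sup>2"
      using im by (metis add_eq_0_iff power2_minus power_mult_distrib)
    then have "(x\<^sup>2 + y\<^sup>2) * (sin (\<beta> * y))\<^sup>2 = y\<^sup>2"
      by (simp add: algebra_simps cos_squared_eq)
    moreover have "(x\<^sup>2 + y\<^sup>2) * (sin (\<beta> * y))\<^sup>2 \<le> 1 * (\<beta> * y)\<^sup>2"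
      using xy(3) abs_sin_le_one abs_sin_x_le_abs_x[of "\<beta> * y"]
      by (intro mult_mono) (auto simp: abs_le_square_iff)
    ultimately have "y\<^sup>2 \<le> \<beta>\<^sup>2 * y\<^sup>2"
      by (simp add: power_mult_distrib)
    then have "1 \<le> \<beta>\<^sup>2"
      using False by simp
    moreover have "\<beta>\<^sup>2 < 1"
      using \<beta> abs_square_less_1[of \<beta>] by simp
    ultimately show False
      by simp
  qed
qed


subsection \<open>Renewal equations\<close>

text \<open>Generating function of the Poisson weights \<open>exp (- \<beta>) \<beta>\<^sup>j / j!\<close>, shifted by one index.\<close>

definition renewal_symbol :: "real \<Rightarrow> complex \<Rightarrow> complex" where
  "renewal_symbol \<beta> \<zeta> = \<zeta> * (exp (of_real (- \<beta>)) * exp (of_real \<beta> * \<zeta>))"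

definition renewal_fps :: "real \<Rightarrow> complex fps" where
  "renewal_fps \<beta> = fps_X * (fps_const (exp (of_real (- \<beta>))) * fps_exp (of_real \<beta>))"

lemma renewal_symbol_expansion: "renewal_symbol \<beta> has_fps_expansion renewal_fps \<beta>"
  unfolding renewal_symbol_def[abs_def] renewal_fps_def
  by (intro fps_expansion_intros)

text \<open>A margin beyond the unit circle, obtained from compactness, is what later turns absence
  of zeros on the closed disc into absolutely summable Taylor coefficients.\<close>

lemma ball_subset_open_of_cball:
  fixes U :: "complex set"
  assumes "open U" "cball 0 1 \<subseteq> U"
  obtains r where "r > 1" "ball 0 r \<subseteq> U"
proof -
  obtain \<epsilon> where \<epsilon>: "\<epsilon> > 0" "(\<Union>x\<in>cball 0 1. ball x \<epsilon>) \<subseteq> U"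
    using compact_subset_open_imp_ball_epsilon_subset[OF compact_cball assms] by blast
  have "\<zeta> \<in> U" if "cmod \<zeta> < 1 + \<epsilon>" for \<zeta>
  proof (cases "cmod \<zeta> \<le> 1")
    case True
    then show ?thesis
      using assms by auto
  next
    case False
    \<comment> \<open>\<open>sgn \<zeta>\<close> is the radial projection of \<zeta> to the unit
      circle, hence a point of the disc closer to \<zeta> than the margin.\<close>
    then have "dist (sgn \<zeta>) \<zeta> = cmod \<zeta> - 1"
    proof -
      have "\<zeta> = of_real (cmod \<zeta>) * sgn \<zeta>"
        using False by (auto simp: sgn_eq)
      then have "sgn \<zeta> - \<zeta> = of_real (1 - cmod \<zeta>) * sgn \<zeta>"
        by (simp add: algebra_simps)
      then have "cmod (sgn \<zeta> - \<zeta>) = \<bar>1 - cmod \<zeta>\<bar> * cmod (sgn \<zeta>)"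
        by (simp only: norm_mult norm_of_real)
      also have "cmod (sgn \<zeta>) = 1"
        using False by (auto simp: norm_sgn)
      finally show ?thesis
        using False by (simp add: dist_norm)
    qed
    moreover have "sgn \<zeta> \<in> cball 0 1"
      by (simp add: norm_sgn)
    ultimately show ?thesis
      using \<epsilon>(2) that by (force simp: subset_iff)
  qed
  then show thesis
    using \<epsilon>(1) by (intro that[of "1 + \<epsilon>"]) (auto simp: subset_iff)
qed

text \<open>The inverse of \<open>I - E(\<zeta>) M\<close> is holomorphic on a disc of radius above
  1, so its entries have convergent expansions there. The left-inverse identity passes from
  functions to formal series because an expansion at 0 is unique; afterwards all manipulation is
  formal and no convergence has to be checked.\<close>

lemma resolvent_fps:
  fixes M :: "complex^'n^'n"
  assumes nz: "\<And>\<zeta>. cmod \<zeta> \<le> 1 \<Longrightarrow> det (\<chi> i j. (if i = j then 1 else 0) - M $ i $ j * renewal_symbol \<beta> \<zeta>) \<noteq> 0"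
  obtains R :: "'n \<Rightarrow> 'n \<Rightarrow> complex fps" where
    "\<And>i j. summable (\<lambda>n. cmod (fps_nth (R i j) n))"
    "\<And>i k. (\<Sum>j\<in>UNIV. R i j * ((if j = k then 1 else 0) - fps_const (M $ j $ k) * renewal_fps \<beta>)) = (if i = k then 1 else 0)"
proof -
  define D where "D \<zeta> = (\<chi> i j. (if i = j then 1 else 0) - M $ i $ j * renewal_symbol \<beta> \<zeta>)" for \<zeta>
  have holD: "(\<lambda>\<zeta>. D \<zeta> $ i $ j) holomorphic_on S" for i j S
    unfolding D_def renewal_symbol_def by (cases "i = j") (auto intro!: holomorphic_intros)
  have hol: "(\<lambda>\<zeta>. det (D \<zeta>)) holomorphic_on S" for S
    by (intro holomorphic_on_det holD)
  have "open ((\<lambda>\<zeta>. det (D \<zeta>)) -` (- {0}))"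
    by (rule open_vimage) (auto intro: holomorphic_on_imp_continuous_on hol)
  moreover have "cball 0 1 \<subseteq> (\<lambda>\<zeta>. det (D \<zeta>)) -` (- {0})"
    using nz by (auto simp: D_def)
  ultimately obtain r where r: "r > 1" "ball 0 r \<subseteq> (\<lambda>\<zeta>. det (D \<zeta>)) -` (- {0})"
    by (rule ball_subset_open_of_cball)
  then have nzD: "det (D \<zeta>) \<noteq> 0" if "\<zeta> \<in> ball 0 r" for \<zeta>
    using that by blast
  define R where "R i j = fps_expansion (\<lambda>\<zeta>. matrix_inv (D \<zeta>) $ i $ j) 0" for i j
  have holR: "(\<lambda>\<zeta>. matrix_inv (D \<zeta>) $ i $ j) holomorphic_on ball 0 r" for i j
  proof -
    have "(\<lambda>\<zeta>. det (\<chi> a s. if s = i then (if a = j then 1 else 0) else D \<zeta> $ a $ s) / det (D \<zeta>)) holomorphic_on ball 0 r"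
    proof (rule holomorphic_on_divide[OF holomorphic_on_det hol nzD])
      fix a b
      show "(\<lambda>\<zeta>. (\<chi> a s. if s = i then (if a = j then 1 else 0) else D \<zeta> $ a $ s) $ a $ b) holomorphic_on ball 0 r"
        by (cases "b = i") (auto intro: holD)
    qed
    then show ?thesis
      by (rule holomorphic_transform) (simp add: matrix_inv_nth nzD)
  qed
  have expR: "(\<lambda>\<zeta>. matrix_inv (D \<zeta>) $ i $ j) has_fps_expansion R i j" for i j
    unfolding R_def using r(1) by (intro has_fps_expansion_fps_expansion[OF _ _ holR]) auto
  show thesis
  proof
    fix i j
    have "ereal r \<le> fps_conv_radius (R i j)"
      unfolding R_def using holR by (intro conv_radius_fps_expansion) simp
    then have "ereal (norm (1::complex)) < fps_conv_radius (R i j)"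
      using r(1) by (simp add: one_ereal_def less_le_trans[of _ "ereal r"])
    then show "summable (\<lambda>n. cmod (fps_nth (R i j) n))"
      using norm_summable_fps[of 1 "R i j"] by simp
  next
    fix i k
    let ?G = "\<lambda>\<zeta>. \<Sum>j\<in>UNIV. matrix_inv (D \<zeta>) $ i $ j * ((if j = k then 1 else 0) - M $ j $ k * renewal_symbol \<beta> \<zeta>)"
    let ?F = "\<Sum>j\<in>UNIV. R i j * ((if j = k then 1 else 0) - fps_const (M $ j $ k) * renewal_fps \<beta>)"
    have "?G
        has_fps_expansion ?F"
    proof (intro has_fps_expansion_sum has_fps_expansion_mult expR has_fps_expansion_diff
        has_fps_expansion_const renewal_symbol_expansion)
      fix j
      show "(\<lambda>\<zeta>. if j = k then 1 else 0) has_fps_expansion (if j = k then 1 else 0)"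
        by simp
    qed
    moreover have "?G
        has_fps_expansion (if i = k then 1 else 0)"
    proof -
      have "?G \<zeta> = (if i = k then 1 else 0)"
        if "\<zeta> \<in> ball 0 r" for \<zeta>
      proof -
        have "(matrix_inv (D \<zeta>) ** D \<zeta>) $ i $ k = (if i = k then 1 else 0)"
          unfolding matrix_inv_mult(2)[OF nzD[OF that]] by (simp add: mat_def)
        then show ?thesis
          by (simp add: matrix_matrix_mult_def D_def)
      qed
      moreover have "eventually (\<lambda>\<zeta>. \<zeta> \<in> ball (0::complex) r) (nhds 0)"
        using r(1) by (intro eventually_nhds_in_open) auto
      ultimately have "eventually (\<lambda>\<zeta>. ?G \<zeta> = (if i = k then 1 else 0)) (nhds 0)"
        by (auto elim: eventually_mono)
      moreover have "(\<lambda>\<zeta>::complex. if i = k then 1 else 0 :: complex) has_fps_expansion (if i = k then 1 else 0)"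
        by simp
      ultimately show ?thesis
        by (subst has_fps_expansion_cong) auto
    qed
    ultimately show "?F = (if i = k then 1 else 0)"
      by (rule fps_expansion_unique_complex)
  qed
qed

lemma fps_nth_renewal_mult:
  "fps_nth (renewal_fps \<beta> * F) n = (\<Sum>j<n. of_real (exp (- \<beta>) * \<beta> ^ j / fact j) * fps_nth F (n - Suc j))"
proof -
  have "fps_nth (renewal_fps \<beta> * F) n = (\<Sum>i=0..n. fps_nth (renewal_fps \<beta>) i * fps_nth F (n - i))"
    by (simp add: fps_mult_nth)
  also have "\<dots> = (\<Sum>i<Suc n. fps_nth (renewal_fps \<beta>) i * fps_nth F (n - i))"
    by (intro sum.cong) auto
  also have "\<dots> = (\<Sum>j<n. fps_nth (renewal_fps \<beta>) (Suc j) * fps_nth F (n - Suc j))"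
    unfolding sum.lessThan_Suc_shift by (simp add: renewal_fps_def)
  also have "\<dots> = (\<Sum>j<n. of_real (exp (- \<beta>) * \<beta> ^ j / fact j) * fps_nth F (n - Suc j))"
    by (simp add: renewal_fps_def flip: exp_of_real)
  finally show ?thesis .
qed

text \<open>For the generating series the renewal equation reads \<open>A = G + E M A\<close>, hence
  \<open>A = R G\<close>. So \<open>a\<close> is a convolution of absolutely summable coefficients
  with a geometrically bounded forcing. The majorant \<open>w\<close> is fixed before
  \<open>a\<close>, \<open>g\<close> and \<open>\<eta>\<close>, which makes the decay uniform over
  all initial blocks.\<close>

lemma renewal_sequence_summable:
  fixes M :: "real^'n^'n"
  assumes \<beta>: "0 < \<beta>" "\<beta> < 1"
    and nz: "\<And>\<zeta>. cmod \<zeta> \<le> 1 \<Longrightarrow> det (\<chi> i j. (if i = j then 1 else 0) - cmat M $ i $ j * renewal_symbol \<beta> \<zeta>) \<noteq> 0"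
  obtains w :: "nat \<Rightarrow> real" where "summable w" "\<And>n. 0 \<le> w n"
    "\<forall>a g \<eta>. (\<forall>n. a n = g n + (\<Sum>j<n. (exp (- \<beta>) * \<beta> ^ j / fact j) *\<^sub>R (M *v a (n - Suc j)))) \<longrightarrow>
       (\<forall>n. norm (g n) \<le> \<eta> * \<beta> ^ n) \<longrightarrow> (\<forall>n. norm (a n) \<le> \<eta> * w n)"
proof -
  let ?P = "\<lambda>j k. fps_const (cmat M $ j $ k) * renewal_fps \<beta>"
  obtain R :: "'n \<Rightarrow> 'n \<Rightarrow> complex fps" where
    R: "\<And>i j. summable (\<lambda>n. cmod (fps_nth (R i j) n))"
    "\<And>i k. (\<Sum>j\<in>UNIV. R i j * ((if j = k then 1 else 0) - ?P j k)) = (if i = k then 1 else 0)"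
    using resolvent_fps[OF nz] by blast
  \<comment> \<open>The Cauchy product of the moduli of the resolvent coefficients with the powers
    of \<beta>, summed over all matrix entries.\<close>
  define w where "w n = (\<Sum>i\<in>UNIV. \<Sum>j\<in>UNIV. \<Sum>p\<le>n. cmod (fps_nth (R i j) p) * \<beta> ^ (n - p))" for n
  show thesis
  proof
    show "summable w"
      unfolding w_def[abs_def]
      using R(1) \<beta> by (intro summable_sum summable_Cauchy_product) auto
    show "0 \<le> w n" for n
      unfolding w_def using \<beta> by (intro sum_nonneg mult_nonneg_nonneg) auto
  next
    show "\<forall>a g \<eta>. (\<forall>n. a n = g n + (\<Sum>j<n. (exp (- \<beta>) * \<beta> ^ j / fact j) *\<^sub>R (M *v a (n - Suc j)))) \<longrightarrow>
       (\<forall>n. norm (g n) \<le> \<eta> * \<beta> ^ n) \<longrightarrow> (\<forall>n. norm (a n) \<le> \<eta> * w n)"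
    proof (intro allI impI)
      fix a g :: "nat \<Rightarrow> real^'n" and \<eta> :: real and n :: nat
      assume "\<forall>n. a n = g n + (\<Sum>j<n. (exp (- \<beta>) * \<beta> ^ j / fact j) *\<^sub>R (M *v a (n - Suc j)))"
        and "\<forall>n. norm (g n) \<le> \<eta> * \<beta> ^ n"
      then have a: "a n = g n + (\<Sum>j<n. (exp (- \<beta>) * \<beta> ^ j / fact j) *\<^sub>R (M *v a (n - Suc j)))"
        and g: "norm (g n) \<le> \<eta> * \<beta> ^ n" for n
        by blast+
      define A where "A i = Abs_fps (\<lambda>n. complex_of_real (a n $ i))" for i
      define G where "G i = Abs_fps (\<lambda>n. complex_of_real (g n $ i))" for i
      have A: "A j = G j + (\<Sum>k\<in>UNIV. ?P j k * A k)" for j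
      proof (rule fps_ext)
        fix n
        have "fps_nth (\<Sum>k\<in>UNIV. ?P j k * A k) n
            = (\<Sum>k\<in>UNIV. \<Sum>i<n. of_real (exp (- \<beta>) * \<beta> ^ i / fact i * (M $ j $ k * a (n - Suc i) $ k)))"
          by (simp add: fps_sum_nth mult.assoc fps_nth_renewal_mult cmat_def A_def sum_distrib_left mult_ac)
        also have "\<dots> = (\<Sum>i<n. of_real (exp (- \<beta>) * \<beta> ^ i / fact i * (\<Sum>k\<in>UNIV. M $ j $ k * a (n - Suc i) $ k)))"
          by (subst sum.swap) (simp add: sum_distrib_left)
        also have "\<dots> = of_real ((a n - g n) $ j)"
          by (subst a) (simp add: matrix_vector_mult_def)
        finally show "fps_nth (A j) n = fps_nth (G j + (\<Sum>k\<in>UNIV. ?P j k * A k)) n"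
          by (simp add: A_def G_def)
      qed
      have RG: "A i = (\<Sum>j\<in>UNIV. R i j * G j)" for i
      proof -
        have "(\<Sum>j\<in>UNIV. R i j * G j) = (\<Sum>j\<in>UNIV. R i j * (\<Sum>k\<in>UNIV. ((if j = k then 1 else 0) - ?P j k) * A k))"
        proof (rule sum.cong[OF refl])
          fix j
          have "(\<Sum>k\<in>UNIV. ((if j = k then 1 else 0) - ?P j k) * A k)
              = (\<Sum>k\<in>UNIV. (if j = k then A k else 0)) - (\<Sum>k\<in>UNIV. ?P j k * A k)"
            unfolding sum_subtractf[symmetric] by (intro sum.cong) (auto simp: algebra_simps)
          also have "(\<Sum>k\<in>UNIV. (if j = k then A k else 0)) = A j"
            by simp
          also have "A j - (\<Sum>k\<in>UNIV. ?P j k * A k) = G j"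
            by (subst A) simp
          finally show "R i j * G j = R i j * (\<Sum>k\<in>UNIV. ((if j = k then 1 else 0) - ?P j k) * A k)"
            by simp
        qed
        also have "\<dots> = (\<Sum>k\<in>UNIV. (\<Sum>j\<in>UNIV. R i j * ((if j = k then 1 else 0) - ?P j k)) * A k)"
          unfolding sum_distrib_left sum_distrib_right by (subst sum.swap) (simp add: mult.assoc)
        also have "\<dots> = (\<Sum>k\<in>UNIV. if i = k then A k else 0)"
          unfolding R(2) by (intro sum.cong) auto
        also have "\<dots> = A i"
          by simp
        finally show ?thesis ..
      qed
      have ai: "\<bar>a n $ i\<bar> \<le> (\<Sum>j\<in>UNIV. \<Sum>p\<le>n. cmod (fps_nth (R i j) p) * (\<eta> * \<beta> ^ (n - p)))" for i
      proof -
        have "\<bar>a n $ i\<bar> = cmod (fps_nth (A i) n)"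
          by (simp add: A_def)
        also have "fps_nth (A i) n = (\<Sum>j\<in>UNIV. \<Sum>p\<le>n. fps_nth (R i j) p * of_real (g (n - p) $ j))"
          unfolding RG by (simp add: fps_sum_nth fps_mult_nth G_def atMost_atLeast0)
        also have "cmod \<dots> \<le> (\<Sum>j\<in>UNIV. \<Sum>p\<le>n. cmod (fps_nth (R i j) p) * (\<eta> * \<beta> ^ (n - p)))"
        proof (intro sum_norm_le)
          fix j p
          have "\<bar>g (n - p) $ j\<bar> \<le> \<eta> * \<beta> ^ (n - p)"
            using component_le_norm_cart[of "g (n - p)" j] g[of "n - p"] by linarith
          then show "cmod (fps_nth (R i j) p * complex_of_real (g (n - p) $ j)) \<le> cmod (fps_nth (R i j) p) * (\<eta> * \<beta> ^ (n - p))"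
            by (simp add: norm_mult mult_left_mono)
        qed
        finally show ?thesis .
      qed
      have "norm (a n) \<le> (\<Sum>i\<in>UNIV. \<bar>a n $ i\<bar>)"
        by (rule norm_le_l1_cart)
      also have "\<dots> \<le> (\<Sum>i\<in>UNIV. \<Sum>j\<in>UNIV. \<Sum>p\<le>n. cmod (fps_nth (R i j) p) * (\<eta> * \<beta> ^ (n - p)))"
        by (intro sum_mono ai)
      also have "\<dots> = \<eta> * w n"
        by (simp add: w_def sum_distrib_left mult_ac)
      finally show "norm (a n) \<le> \<eta> * w n" .
    qed
  qed
qed


subsection \<open>The linearized block map\<close>

text \<open>Variation of constants for \<open>w' = k (z - w)\<close>, \<open>w 0 = 0\<close>. The
  exponential in \<open>t\<close> stands outside the integral so that the integrand is free of
  \<open>t\<close> and the theorems on indefinite integrals apply.\<close>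

definition smoothing :: "real \<Rightarrow> (real \<Rightarrow> 'a::banach) \<Rightarrow> real \<Rightarrow> 'a" where
  "smoothing k z t = exp (- (k * t)) *\<^sub>R integral {0..t} (\<lambda>u. (k * exp (k * u)) *\<^sub>R z u)"

text \<open>On \<open>[0, \<theta>]\<close> this is the solution of \<open>w' = k (z - w)\<close>, \<open>w(0) = L (z(\<theta>))\<close>.\<close>

definition block_map :: "real \<Rightarrow> real \<Rightarrow> ('a \<Rightarrow> 'a) \<Rightarrow> (real \<Rightarrow> 'a::banach) \<Rightarrow> real \<Rightarrow> 'a" where
  "block_map k \<theta> L z t = exp (- (k * t)) *\<^sub>R L (z \<theta>) + smoothing k z t"

lemma smoothing_integrable:
  fixes z :: "real \<Rightarrow> 'a::banach"
  assumes "continuous_on {0..\<theta>} z" "t \<in> {0..\<theta>}"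
  shows "(\<lambda>u. (k * exp (k * u)) *\<^sub>R z u) integrable_on {0..t}"
proof (rule integrable_continuous_real)
  have "continuous_on {0..t} z"
    using assms by (auto intro: continuous_on_subset)
  then show "continuous_on {0..t} (\<lambda>u. (k * exp (k * u)) *\<^sub>R z u)"
    by (intro continuous_intros)
qed

lemma continuous_on_smoothing:
  fixes z :: "real \<Rightarrow> 'a::banach"
  assumes "continuous_on {0..\<theta>} z"
  shows "continuous_on {0..\<theta>} (smoothing k z)"
proof -
  have "continuous_on {0..\<theta>} (\<lambda>t. integral {0..t} (\<lambda>u. (k * exp (k * u)) *\<^sub>R z u))"
  proof (cases "\<theta> \<ge> 0")
    case True
    then show ?thesis
      by (intro indefinite_integral_continuous_1 smoothing_integrable[OF assms]) simp
  qed simp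
  then show ?thesis
    unfolding smoothing_def[abs_def] by (intro continuous_intros)
qed

lemma continuous_on_block_map:
  fixes z :: "real \<Rightarrow> 'a::banach"
  assumes "continuous_on {0..\<theta>} z"
  shows "continuous_on {0..\<theta>} (block_map k \<theta> L z)"
  unfolding block_map_def[abs_def] by (intro continuous_intros continuous_on_smoothing assms)

lemma continuous_on_block_map_iter:
  fixes z :: "real \<Rightarrow> 'a::banach"
  assumes "continuous_on {0..\<theta>} z"
  shows "continuous_on {0..\<theta>} ((block_map k \<theta> L ^^ n) z)"
  by (induction n) (simp_all add: assms continuous_on_block_map)

lemma has_integral_exp_weight:
  fixes k t :: real
  assumes "0 \<le> t"
  shows "((\<lambda>u. k * exp (k * u)) has_integral exp (k * t) - 1) {0..t}"
proof -
  have "((\<lambda>u. k * exp (k * u)) has_integral exp (k * t) - exp (k * 0)) {0..t}"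
    by (rule fundamental_theorem_of_calculus[where f = "\<lambda>u. exp (k * u)", OF assms])
       (auto intro!: derivative_eq_intros simp: has_real_derivative_iff_has_vector_derivative[symmetric])
  then show ?thesis
    by simp
qed

text \<open>The kernel is nonnegative with total mass \<open>1 - exp (- (k * t))\<close>; keeping
  this mass instead of 1 is what gives a geometric rate under iteration.\<close>

lemma smoothing_bound:
  fixes z :: "real \<Rightarrow> 'a::banach"
  assumes z: "continuous_on {0..\<theta>} z" and t: "t \<in> {0..\<theta>}" and k: "0 \<le> k"
    and c: "\<And>u. u \<in> {0..\<theta>} \<Longrightarrow> norm (z u) \<le> c"
  shows "norm (smoothing k z t) \<le> c * (1 - exp (- (k * t)))"
proof -
  have "norm (integral {0..t} (\<lambda>u. (k * exp (k * u)) *\<^sub>R z u)) \<le> integral {0..t} (\<lambda>u. c * (k * exp (k * u)))"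
  proof (rule integral_norm_bound_integral[OF smoothing_integrable[OF z t]])
    show "(\<lambda>u. c * (k * exp (k * u))) integrable_on {0..t}"
      using has_integral_mult_right[OF has_integral_exp_weight, of t c k] t by (auto simp: integrable_on_def)
    fix u assume "u \<in> {0..t}"
    then show "norm ((k * exp (k * u)) *\<^sub>R z u) \<le> c * (k * exp (k * u))"
      using c[of u] t k by (simp add: mult_left_mono mult.commute[of c])
  qed
  also have "\<dots> = c * (exp (k * t) - 1)"
    using t by (intro integral_unique has_integral_mult_right has_integral_exp_weight) auto
  finally have "norm (smoothing k z t) \<le> exp (- (k * t)) * (c * (exp (k * t) - 1))"
    by (simp add: smoothing_def)
  also have "\<dots> = c * (1 - exp (- (k * t)))"
    by (simp add: algebra_simps flip: exp_add)
  finally show ?thesis .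
qed

lemma block_map_bound:
  fixes z :: "real \<Rightarrow> 'a::banach"
  assumes z: "continuous_on {0..\<theta>} z" and t: "t \<in> {0..\<theta>}" and k: "0 \<le> k"
    and c: "\<And>u. u \<in> {0..\<theta>} \<Longrightarrow> norm (z u) \<le> c"
    and L: "\<And>x. norm (L x) \<le> K * norm x" and K: "0 \<le> K"
  shows "norm (block_map k \<theta> L z t) \<le> (K + 1) * c"
proof -
  have c0: "0 \<le> c"
    using c[OF t] norm_ge_zero order_trans by blast
  have "norm (L (z \<theta>)) \<le> K * c"
    using L[of "z \<theta>"] c[of \<theta>] t K by (auto intro: order_trans mult_left_mono)
  then have "exp (- (k * t)) * norm (L (z \<theta>)) \<le> 1 * (K * c)"
    using t k by (intro mult_mono) auto
  moreover have "c * (1 - exp (- (k * t))) \<le> c * 1"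
    using c0 by (intro mult_left_mono) auto
  ultimately show ?thesis
    using smoothing_bound[OF z t k c] norm_triangle_ineq[of "exp (- (k * t)) *\<^sub>R L (z \<theta>)" "smoothing k z t"]
    by (simp add: block_map_def algebra_simps)
qed

lemma smoothing_cong:
  assumes "\<And>u. u \<in> {0..\<theta>} \<Longrightarrow> x u = y u" "t \<in> {0..\<theta>}"
  shows "smoothing k x t = smoothing k y t"
proof -
  have "integral {0..t} (\<lambda>u. (k * exp (k * u)) *\<^sub>R x u) = integral {0..t} (\<lambda>u. (k * exp (k * u)) *\<^sub>R y u)"
    using assms by (intro integral_cong) auto
  then show ?thesis
    by (simp add: smoothing_def)
qed

lemma smoothing_linear:
  fixes z :: "real \<Rightarrow> 'a::banach" and \<Lambda> :: "'a \<Rightarrow> 'b::banach"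
  assumes "continuous_on {0..\<theta>} z" "t \<in> {0..\<theta>}" "bounded_linear \<Lambda>"
  shows "smoothing k (\<lambda>u. \<Lambda> (z u)) t = \<Lambda> (smoothing k z t)"
proof -
  have "integral {0..t} (\<Lambda> \<circ> (\<lambda>u. (k * exp (k * u)) *\<^sub>R z u)) = \<Lambda> (integral {0..t} (\<lambda>u. (k * exp (k * u)) *\<^sub>R z u))"
    by (rule integral_linear[OF smoothing_integrable[OF assms(1,2)] assms(3)])
  then show ?thesis
    using assms(3) by (simp add: smoothing_def o_def linear_scale bounded_linear.linear)
qed

lemma smoothing_add:
  fixes x y :: "real \<Rightarrow> 'a::banach"
  assumes "continuous_on {0..\<theta>} x" "continuous_on {0..\<theta>} y" "t \<in> {0..\<theta>}"
  shows "smoothing k (\<lambda>u. x u + y u) t = smoothing k x t + smoothing k y t"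
  using integral_add[OF smoothing_integrable[OF assms(1,3)] smoothing_integrable[OF assms(2,3)]]
  by (simp add: smoothing_def scaleR_add_right)

lemma smoothing_diff:
  fixes x y :: "real \<Rightarrow> 'a::banach"
  assumes "continuous_on {0..\<theta>} x" "continuous_on {0..\<theta>} y" "t \<in> {0..\<theta>}"
  shows "smoothing k (\<lambda>u. x u - y u) t = smoothing k x t - smoothing k y t"
  using integral_diff[OF smoothing_integrable[OF assms(1,3)] smoothing_integrable[OF assms(2,3)]]
  by (simp add: smoothing_def scaleR_diff_right)

lemma smoothing_sum:
  fixes x :: "nat \<Rightarrow> real \<Rightarrow> 'a::banach"
  assumes "\<And>j. continuous_on {0..\<theta>} (x j)" "t \<in> {0..\<theta>}"
  shows "smoothing k (\<lambda>u. \<Sum>j<n. x j u) t = (\<Sum>j<n. smoothing k (x j) t)"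
proof (induction n)
  case 0
  then show ?case
    by (simp add: smoothing_def)
next
  case (Suc n)
  then show ?case
    using assms by (simp add: smoothing_add[of \<theta>] continuous_on_sum)
qed

lemma block_map_diff:
  fixes x y :: "real \<Rightarrow> 'a::banach"
  assumes "continuous_on {0..\<theta>} x" "continuous_on {0..\<theta>} y" "t \<in> {0..\<theta>}" "linear L"
  shows "block_map k \<theta> L (\<lambda>u. x u - y u) t = block_map k \<theta> L x t - block_map k \<theta> L y t"
  using smoothing_diff[OF assms(1-3)] assms(4)
  by (simp add: block_map_def linear_diff scaleR_diff_right)

text \<open>Smoothing commutes with every bounded linear map, so only the endpoint rule has to be
  intertwined. This splits the iteration into its hyperbolic part, with \<Lambda> the projection
  along \<open>e\<close>, and its neutral part, with \<Lambda> the functional \<open>l\<close> and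
  endpoint rule \<open>id\<close>.\<close>

lemma block_map_iter_intertwine:
  fixes z :: "real \<Rightarrow> 'a::banach" and \<Lambda> :: "'a \<Rightarrow> 'b::banach"
  assumes z: "continuous_on {0..\<theta>} z" and \<Lambda>: "bounded_linear \<Lambda>"
    and L: "\<And>x. \<Lambda> (L x) = L' (\<Lambda> x)" and t: "t \<in> {0..\<theta>}"
  shows "\<Lambda> ((block_map k \<theta> L ^^ n) z t) = (block_map k \<theta> L' ^^ n) (\<lambda>u. \<Lambda> (z u)) t"
  using t
proof (induction n arbitrary: t)
  case (Suc n)
  let ?z = "(block_map k \<theta> L ^^ n) z" and ?y = "(block_map k \<theta> L' ^^ n) (\<lambda>u. \<Lambda> (z u))"
  have "\<Lambda> (smoothing k ?z t) = smoothing k ?y t"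
    using smoothing_linear[OF continuous_on_block_map_iter[OF z] Suc.prems \<Lambda>, of k]
      smoothing_cong[of \<theta> "\<lambda>u. \<Lambda> (?z u)" ?y t k] Suc by simp
  moreover have "\<Lambda> (?z \<theta>) = ?y \<theta>"
    using Suc by auto
  ultimately show ?case
    using \<Lambda> by (simp add: block_map_def[of _ _ _ ?z] block_map_def[of _ _ _ ?y] linear_add linear_scale bounded_linear.linear L)
qed simp

text \<open>After cancellation of the exponentials only a monomial is integrated, so smoothing
  raises the index of a Poisson weight by one. This is the source of the renewal weights.\<close>

lemma smoothing_erlang:
  fixes x :: "'a::banach"
  assumes "0 \<le> t"
  shows "smoothing k (\<lambda>u. (exp (- (k * u)) * (k * u) ^ j / fact j) *\<^sub>R x) t
    = (exp (- (k * t)) * (k * t) ^ Suc j / fact (Suc j)) *\<^sub>R x"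
proof -
  have "((\<lambda>u. k * (k * u) ^ j / fact j) has_integral (k * t) ^ Suc j / fact (Suc j) - (k * 0) ^ Suc j / fact (Suc j)) {0..t}"
  proof (rule fundamental_theorem_of_calculus[OF assms])
    fix u assume "u \<in> {0..t}"
    have "((\<lambda>u. (k * u) ^ Suc j / fact (Suc j)) has_real_derivative real (Suc j) * (k * u) ^ j * k / fact (Suc j)) (at u within {0..t})"
      by (auto intro!: derivative_eq_intros simp del: power_Suc fact_Suc)
    also have "real (Suc j) * (k * u) ^ j * k / fact (Suc j) = k * (k * u) ^ j / fact j"
      by (simp add: divide_simps)
    finally show "((\<lambda>u. (k * u) ^ Suc j / fact (Suc j)) has_vector_derivative k * (k * u) ^ j / fact j) (at u within {0..t})"
      by (simp only: has_real_derivative_iff_has_vector_derivative)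
  qed
  then have "((\<lambda>u. k * (k * u) ^ j / fact j) has_integral (k * t) ^ Suc j / fact (Suc j)) {0..t}"
    by simp
  then have "((\<lambda>u. (k * (k * u) ^ j / fact j) *\<^sub>R x) has_integral ((k * t) ^ Suc j / fact (Suc j)) *\<^sub>R x) {0..t}"
    by (rule has_integral_scaleR_left)
  moreover have "(k * exp (k * u)) *\<^sub>R ((exp (- (k * u)) * (k * u) ^ j / fact j) *\<^sub>R x) = (k * (k * u) ^ j / fact j) *\<^sub>R x" for u
    by (simp add: exp_minus)
  ultimately have "integral {0..t} (\<lambda>u. (k * exp (k * u)) *\<^sub>R ((exp (- (k * u)) * (k * u) ^ j / fact j) *\<^sub>R x))
      = ((k * t) ^ Suc j / fact (Suc j)) *\<^sub>R x"
    by (simp only: integral_unique)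
  then show ?thesis
    unfolding smoothing_def by (simp only: scaleR_scaleR times_divide_eq_right)
qed

text \<open>Every step injects the image under \<open>L\<close> of the previous endpoint with weight
  \<open>exp (- (k * t))\<close>; an injection made \<open>j\<close> steps before the last one has
  since been smoothed \<open>j\<close> times. At \<open>t = \<theta>\<close> the formula closes up
  to a renewal equation for the endpoint values alone.\<close>

lemma block_map_iter_expansion:
  fixes z :: "real \<Rightarrow> 'a::banach"
  assumes z: "continuous_on {0..\<theta>} z" and t: "t \<in> {0..\<theta>}"
  shows "(block_map k \<theta> L ^^ n) z t = (smoothing k ^^ n) z t +
    (\<Sum>j<n. (exp (- (k * t)) * (k * t) ^ j / fact j) *\<^sub>R L ((block_map k \<theta> L ^^ (n - Suc j)) z \<theta>))"
  using t
proof (induction n arbitrary: t)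
  case (Suc n)
  let ?c = "\<lambda>j u. exp (- (k * u)) * (k * u) ^ j / fact j"
  let ?a = "\<lambda>m. L ((block_map k \<theta> L ^^ m) z \<theta>)"
  have cJ: "continuous_on {0..\<theta>} ((smoothing k ^^ m) z)" for m
    by (induction m) (simp_all add: z continuous_on_smoothing)
  have cs: "continuous_on {0..\<theta>} (\<lambda>u. ?c j u *\<^sub>R ?a m)" for j m
    by (intro continuous_intros) auto
  have "smoothing k ((block_map k \<theta> L ^^ n) z) t = smoothing k (\<lambda>u. (smoothing k ^^ n) z u + (\<Sum>j<n. ?c j u *\<^sub>R ?a (n - Suc j))) t"
    by (rule smoothing_cong[OF Suc.IH Suc.prems])
  also have "\<dots> = smoothing k ((smoothing k ^^ n) z) t + (\<Sum>j<n. smoothing k (\<lambda>u. ?c j u *\<^sub>R ?a (n - Suc j)) t)"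
    using smoothing_add[OF cJ continuous_on_sum[OF cs] Suc.prems, of k n "\<lambda>j. j" "\<lambda>j. n - Suc j" "{..<n}"]
      smoothing_sum[OF cs Suc.prems, of k "\<lambda>j. j" "\<lambda>j. n - Suc j" n] by simp
  also have "\<dots> = (smoothing k ^^ Suc n) z t + (\<Sum>j<n. ?c (Suc j) t *\<^sub>R ?a (n - Suc j))"
    using Suc.prems by (simp only: smoothing_erlang atLeastAtMost_iff funpow.simps comp_def)
  finally have "smoothing k ((block_map k \<theta> L ^^ n) z) t = (smoothing k ^^ Suc n) z t + (\<Sum>j<n. ?c (Suc j) t *\<^sub>R ?a (n - Suc j))" .
  then show ?case
    unfolding sum.lessThan_Suc_shift by (simp add: block_map_def[of _ _ _ "(block_map k \<theta> L ^^ n) z"])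
qed simp

text \<open>Each smoothing gains the factor \<open>1 - exp (- (k * t)) \<le> k * \<theta>\<close>,
  so the forcing term of the renewal equation decays geometrically once
  \<open>k * \<theta> < 1\<close>.\<close>

lemma smoothing_iter_bound:
  fixes z :: "real \<Rightarrow> 'a::banach"
  assumes z: "continuous_on {0..\<theta>} z" and t: "t \<in> {0..\<theta>}" and k: "0 \<le> k"
    and c: "\<And>u. u \<in> {0..\<theta>} \<Longrightarrow> norm (z u) \<le> \<eta>"
  shows "norm ((smoothing k ^^ n) z t) \<le> \<eta> * (k * \<theta>) ^ n"
  using t
proof (induction n arbitrary: t)
  case (Suc n)
  have cJ: "continuous_on {0..\<theta>} ((smoothing k ^^ m) z)" for m
    by (induction m) (simp_all add: z continuous_on_smoothing)
  have "norm ((smoothing k ^^ Suc n) z t) \<le> \<eta> * (k * \<theta>) ^ n * (1 - exp (- (k * t)))"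
    using smoothing_bound[OF cJ Suc.prems k Suc.IH] by simp
  also have "\<dots> \<le> \<eta> * (k * \<theta>) ^ n * (k * \<theta>)"
  proof (rule mult_left_mono)
    have "k * t \<le> k * \<theta>"
      using Suc.prems k by (simp add: mult_left_mono)
    then show "1 - exp (- (k * t)) \<le> k * \<theta>"
      using exp_ge_add_one_self[of "- (k * t)"] by linarith
    have "0 \<le> \<eta>"
      using c[OF Suc.prems] norm_ge_zero order_trans by blast
    then show "0 \<le> \<eta> * (k * \<theta>) ^ n"
      using k Suc.prems by simp
  qed
  finally show ?case
    by (simp add: mult_ac)
qed (use c in simp)

text \<open>The renewal estimate controls the endpoints; the expansion of the iterates then carries
  the decay from the endpoints to the whole block.\<close>

lemma block_map_hyperbolic_decay:
  fixes M :: "real^'n^'n"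
  assumes \<theta>: "0 < \<theta>" and k: "0 < k" "k * \<theta> < 1"
    and nz: "\<And>\<zeta>. cmod \<zeta> \<le> 1 \<Longrightarrow> det (\<chi> i j. (if i = j then 1 else 0) - cmat M $ i $ j * renewal_symbol (k * \<theta>) \<zeta>) \<noteq> 0"
  obtains v :: "nat \<Rightarrow> real" where "v \<longlonglongrightarrow> 0"
    "\<forall>z \<eta> n t. continuous_on {0..\<theta>} z \<longrightarrow> (\<forall>u\<in>{0..\<theta>}. norm (z u) \<le> \<eta>) \<longrightarrow> t \<in> {0..\<theta>} \<longrightarrow>
       norm ((block_map k \<theta> ((*v) M) ^^ n) z t) \<le> \<eta> * v n"
proof -
  define \<beta> where "\<beta> = k * \<theta>"
  have \<beta>: "0 < \<beta>" "\<beta> < 1"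
    using \<theta> k by (auto simp: \<beta>_def)
  obtain w :: "nat \<Rightarrow> real" where w: "summable w" "\<And>n. 0 \<le> w n"
    and dec: "\<forall>a g \<eta>. (\<forall>n. a n = g n + (\<Sum>j<n. (exp (- \<beta>) * \<beta> ^ j / fact j) *\<^sub>R (M *v a (n - Suc j)))) \<longrightarrow>
       (\<forall>n. norm (g n) \<le> \<eta> * \<beta> ^ n) \<longrightarrow> (\<forall>n. norm (a n) \<le> \<eta> * w n)"
    by (rule renewal_sequence_summable[OF \<beta> nz[folded \<beta>_def]], assumption) (rule that)
  obtain K where K: "K > 0" "\<And>x. norm (M *v x) \<le> K * norm x"
    using bounded_linear.pos_bounded[OF matrix_vector_mul_bounded_linear[of M]] by (metis mult.commute)
  \<comment> \<open>The first term bounds the smoothed initial block, the second the injected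
    endpoints. The sum is a term of a Cauchy product of two summable series and therefore tends to
    0; this is where summability of \<open>w\<close> is used.\<close>
  define v where "v n = \<beta> ^ n + K * (\<Sum>j<n. \<beta> ^ j * w (n - Suc j))" for n
  show thesis
  proof
    have "(\<lambda>n. \<Sum>j\<le>n. \<beta> ^ j * w (n - j)) \<longlonglongrightarrow> 0"
      using \<beta> w by (intro summable_LIMSEQ_zero summable_Cauchy_product) auto
    then have "(\<lambda>n. \<Sum>j<Suc n. \<beta> ^ j * w (Suc n - Suc j)) \<longlonglongrightarrow> 0"
      by (simp add: lessThan_Suc_atMost)
    then have "(\<lambda>n. \<Sum>j<n. \<beta> ^ j * w (n - Suc j)) \<longlonglongrightarrow> 0"
      using filterlim_sequentially_Suc[of "\<lambda>n. \<Sum>j<n. \<beta> ^ j * w (n - Suc j)"] by blast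
    moreover have "(\<lambda>n. \<beta> ^ n) \<longlonglongrightarrow> 0"
      using \<beta> by (intro LIMSEQ_power_zero) auto
    ultimately have "(\<lambda>n. \<beta> ^ n + K * (\<Sum>j<n. \<beta> ^ j * w (n - Suc j))) \<longlonglongrightarrow> 0 + K * 0"
      by (intro tendsto_add tendsto_mult tendsto_const)
    then show "v \<longlonglongrightarrow> 0"
      by (simp add: v_def[abs_def])
  next
    show "\<forall>z \<eta> n t. continuous_on {0..\<theta>} z \<longrightarrow> (\<forall>u\<in>{0..\<theta>}. norm (z u) \<le> \<eta>) \<longrightarrow> t \<in> {0..\<theta>} \<longrightarrow>
       norm ((block_map k \<theta> ((*v) M) ^^ n) z t) \<le> \<eta> * v n"
    proof (intro allI impI)
      fix z :: "real \<Rightarrow> real^'n" and \<eta> :: real and n :: nat and t :: real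
      assume z: "continuous_on {0..\<theta>} z" and "\<forall>u\<in>{0..\<theta>}. norm (z u) \<le> \<eta>" and t: "t \<in> {0..\<theta>}"
      then have c: "norm (z u) \<le> \<eta>" if "u \<in> {0..\<theta>}" for u
        using that by blast
      let ?a = "\<lambda>m. (block_map k \<theta> ((*v) M) ^^ m) z \<theta>"
      have \<eta>: "0 \<le> \<eta>"
        using c[OF t] norm_ge_zero order_trans by blast
      have am: "norm (?a m) \<le> \<eta> * w m" for m
      proof (rule dec[rule_format, where g = "\<lambda>n. (smoothing k ^^ n) z \<theta>"])
        fix n
        show "?a n = (smoothing k ^^ n) z \<theta> + (\<Sum>j<n. (exp (- \<beta>) * \<beta> ^ j / fact j) *\<^sub>R (M *v ?a (n - Suc j)))"
          using block_map_iter_expansion[where t = \<theta> and k = k and L = "(*v) M" and n = n, OF z] \<theta> by (simp add: \<beta>_def)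
        show "norm ((smoothing k ^^ n) z \<theta>) \<le> \<eta> * \<beta> ^ n"
          using smoothing_iter_bound[where t = \<theta> and k = k and n = n, OF z _ _ c] \<theta> k by (simp add: \<beta>_def)
      qed
      have "norm ((exp (- (k * t)) * (k * t) ^ j / fact j) *\<^sub>R (M *v ?a m)) \<le> \<beta> ^ j * (K * (\<eta> * w m))" for j m
      proof -
        have "norm (M *v ?a m) \<le> K * (\<eta> * w m)"
          using K am[of m] by (meson mult_left_mono order.trans less_imp_le)
        moreover have "\<bar>exp (- (k * t)) * (k * t) ^ j / fact j\<bar> \<le> \<beta> ^ j"
        proof -
          have "exp (- (k * t)) * (k * t) ^ j \<le> 1 * \<beta> ^ j"
            using t k by (intro mult_mono power_mono) (auto simp: \<beta>_def)
          moreover have "0 \<le> exp (- (k * t)) * (k * t) ^ j"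
            using t k by auto
          moreover have "exp (- (k * t)) * (k * t) ^ j / fact j \<le> exp (- (k * t)) * (k * t) ^ j"
            using calculation(2) by (simp add: divide_le_eq mult_left_le mult_le_cancel_left1 fact_ge_1)
          ultimately show ?thesis
            by simp
        qed
        ultimately show ?thesis
          unfolding norm_scaleR using \<beta> by (intro mult_mono) auto
      qed
      then have "norm (\<Sum>j<n. (exp (- (k * t)) * (k * t) ^ j / fact j) *\<^sub>R (M *v ?a (n - Suc j))) \<le> (\<Sum>j<n. \<beta> ^ j * (K * (\<eta> * w (n - Suc j))))"
        by (intro sum_norm_le)
      moreover have "norm ((smoothing k ^^ n) z t) \<le> \<eta> * \<beta> ^ n"
        using smoothing_iter_bound[where k = k and n = n, OF z t _ c] k by (simp add: \<beta>_def)
      moreover have "(\<Sum>j<n. \<beta> ^ j * (K * (\<eta> * w (n - Suc j)))) = \<eta> * (K * (\<Sum>j<n. \<beta> ^ j * w (n - Suc j)))"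
        by (simp add: sum_distrib_left mult_ac)
      moreover have "norm ((block_map k \<theta> ((*v) M) ^^ n) z t) \<le> norm ((smoothing k ^^ n) z t) +
          norm (\<Sum>j<n. (exp (- (k * t)) * (k * t) ^ j / fact j) *\<^sub>R (M *v ?a (n - Suc j)))"
        unfolding block_map_iter_expansion[OF z t] by (rule norm_triangle_ineq)
      ultimately have "norm ((block_map k \<theta> ((*v) M) ^^ n) z t) \<le> \<eta> * \<beta> ^ n + \<eta> * (K * (\<Sum>j<n. \<beta> ^ j * w (n - Suc j)))"
        by linarith
      then show "norm ((block_map k \<theta> ((*v) M) ^^ n) z t) \<le> \<eta> * v n"
        by (simp add: v_def distrib_left)
    qed
  qed
qed

section \<open>The neutral direction: averaging with multiplier 1\<close>

lemma smoothing_mono: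
  fixes x y :: "real \<Rightarrow> real"
  assumes "continuous_on {0..\<theta>} x" "continuous_on {0..\<theta>} y" "t \<in> {0..\<theta>}" "0 \<le> k"
    "\<And>u. u \<in> {0..\<theta>} \<Longrightarrow> x u \<le> y u"
  shows "smoothing k x t \<le> smoothing k y t"
proof -
  have "integral {0..t} (\<lambda>u. (k * exp (k * u)) *\<^sub>R x u) \<le> integral {0..t} (\<lambda>u. (k * exp (k * u)) *\<^sub>R y u)"
    using assms(3-5)
    by (intro integral_le smoothing_integrable[OF assms(1,3)] smoothing_integrable[OF assms(2,3)]) (auto intro!: mult_left_mono)
  then show ?thesis
    by (simp add: smoothing_def)
qed

lemma smoothing_const:
  fixes c :: real
  assumes "0 \<le> t"
  shows "smoothing k (\<lambda>u. c) t = c * (1 - exp (- (k * t)))"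
proof -
  have "integral {0..t} (\<lambda>u. (k * exp (k * u)) *\<^sub>R c) = (exp (k * t) - 1) * c"
    unfolding real_scaleR_def by (intro integral_unique has_integral_mult_left has_integral_exp_weight assms)
  then have "smoothing k (\<lambda>u. c) t = exp (- (k * t)) * ((exp (k * t) - 1) * c)"
    unfolding smoothing_def by simp
  then show ?thesis
    by (simp add: algebra_simps flip: exp_add)
qed

text \<open>With multiplier 1 each value of the new block is a convex combination of values of the old one
  in which the endpoint value has weight at least \<open>exp (- (k * \<theta>))\<close>; hence the oscillation contracts.\<close>

lemma block_map_neutral_step:
  fixes x :: "real \<Rightarrow> real"
  assumes x: "continuous_on {0..\<theta>} x" and k: "0 \<le> k"
    and b: "\<And>u. u \<in> {0..\<theta>} \<Longrightarrow> lo \<le> x u \<and> x u \<le> hi" and t: "t \<in> {0..\<theta>}"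
  defines "q \<equiv> exp (- (k * \<theta>))"
  shows "lo + q * (x \<theta> - lo) \<le> block_map k \<theta> id x t" "block_map k \<theta> id x t \<le> hi - q * (hi - x \<theta>)"
proof -
  have q: "q \<le> exp (- (k * t))"
    using t k by (auto simp: q_def mult_left_mono)
  have end\<theta>: "lo \<le> x \<theta>" "x \<theta> \<le> hi"
    using b[of \<theta>] t by auto
  have "smoothing k x t \<le> hi * (1 - exp (- (k * t)))"
    using smoothing_mono[OF x continuous_on_const t k, of hi] b smoothing_const[of t k hi] t by auto
  moreover have "lo * (1 - exp (- (k * t))) \<le> smoothing k x t"
    using smoothing_mono[OF continuous_on_const x t k, of lo] b smoothing_const[of t k lo] t by auto
  moreover have "q * (x \<theta> - lo) \<le> exp (- (k * t)) * (x \<theta> - lo)" "q * (hi - x \<theta>) \<le> exp (- (k * t)) * (hi - x \<theta>)"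
    using q end\<theta> by (auto intro!: mult_right_mono)
  ultimately show "lo + q * (x \<theta> - lo) \<le> block_map k \<theta> id x t" "block_map k \<theta> id x t \<le> hi - q * (hi - x \<theta>)"
    by (simp_all add: block_map_def algebra_simps)
qed

lemma block_map_neutral_oscillation:
  fixes x :: "real \<Rightarrow> real"
  assumes x: "continuous_on {0..\<theta>} x" and k: "0 \<le> k"
    and b: "\<And>u. u \<in> {0..\<theta>} \<Longrightarrow> \<bar>x u\<bar> \<le> \<eta>" and t: "t \<in> {0..\<theta>}"
  shows "\<bar>(block_map k \<theta> id ^^ n) x t - (block_map k \<theta> id ^^ n) x \<theta>\<bar> \<le> 2 * \<eta> * (1 - exp (- (k * \<theta>))) ^ n"
proof -
  have "\<exists>lo hi. hi - lo = 2 * \<eta> * (1 - exp (- (k * \<theta>))) ^ n \<and>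
      (\<forall>u\<in>{0..\<theta>}. lo \<le> (block_map k \<theta> id ^^ n) x u \<and> (block_map k \<theta> id ^^ n) x u \<le> hi)"
  proof (induction n)
    case 0
    show ?case
      using b by (intro exI[of _ "- \<eta>"] exI[of _ \<eta>]) (auto simp: abs_le_iff minus_le_iff)
  next
    case (Suc n)
    let ?y = "(block_map k \<theta> id ^^ n) x" and ?q = "exp (- (k * \<theta>))"
    obtain lo hi where lh: "hi - lo = 2 * \<eta> * (1 - ?q) ^ n"
      "\<And>u. u \<in> {0..\<theta>} \<Longrightarrow> lo \<le> ?y u \<and> ?y u \<le> hi"
      using Suc by blast
    \<comment> \<open>The endpoint value cancels: wherever it lies between the bounds, the width of
      the enclosing interval shrinks by the same factor.\<close>
    have "hi - ?q * (hi - ?y \<theta>) - (lo + ?q * (?y \<theta> - lo)) = (hi - lo) * (1 - ?q)"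
      by (simp add: algebra_simps)
    also have "\<dots> = 2 * \<eta> * (1 - ?q) ^ Suc n"
      unfolding lh(1) by simp
    finally show ?case
      using block_map_neutral_step[OF continuous_on_block_map_iter[OF x] k lh(2)]
      by (intro exI[of _ "hi - ?q * (hi - ?y \<theta>)"] exI[of _ "lo + ?q * (?y \<theta> - lo)"]) (simp only: funpow.simps comp_def, blast)
  qed
  then obtain lo hi where lh: "hi - lo = 2 * \<eta> * (1 - exp (- (k * \<theta>))) ^ n"
    "\<And>u. u \<in> {0..\<theta>} \<Longrightarrow> lo \<le> (block_map k \<theta> id ^^ n) x u \<and> (block_map k \<theta> id ^^ n) x u \<le> hi"
    by blast
  show ?thesis
    using lh(2)[OF t] lh(2)[of \<theta>] t unfolding lh(1)[symmetric] by auto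
qed

text \<open>Subtracting the rank-one matrix of \<open>e\<close> and \<open>l\<close> replaces the
  eigenvalue 1 by 0. A kernel vector \<open>v\<close> is annihilated by \<open>l\<close>, because
  \<open>l\<close> kills the range of the deflated matrix, so \<open>v\<close> is an eigenvector of
  \<open>B\<close> itself for \<mu> = 1 / E(\<zeta>). As
  \<open>\<bar>E(\<zeta>)\<bar> \<le> 1\<close>, only eigenvalues with
  \<open>\<bar>\<mu>\<bar> \<ge> 1\<close> can occur: 1 is excluded by \<open>l v = 0\<close>, the
  unstable ones by the characteristic factor.\<close>

lemma deflated_determinant_nonzero:
  fixes B :: "real^'n^'n"
  assumes \<beta>: "0 < \<beta>" "\<beta> < 1"
    and l: "l \<bullet> e = 1" "\<And>x. l \<bullet> (B *v x) = l \<bullet> x" "\<And>v. B *v v = v \<Longrightarrow> l \<bullet> v = 0 \<Longrightarrow> v = 0"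
    and unit: "\<And>\<mu>. \<mu> \<in> spectrum_c B \<Longrightarrow> cmod \<mu> = 1 \<Longrightarrow> \<mu> = 1"
    and outer: "\<And>\<mu>. \<mu> \<in> spectrum_c B \<Longrightarrow> cmod \<mu> > 1 \<Longrightarrow> \<mu> \<in> \<real> \<and> - exp (2 * \<beta>) < Re \<mu> \<and> Re \<mu> < 0"
    and \<zeta>: "cmod \<zeta> \<le> 1"
  shows "det (\<chi> i j. (if i = j then 1 else 0) - cmat (\<chi> i j. B $ i $ j - e $ i * l $ j) $ i $ j * renewal_symbol \<beta> \<zeta>) \<noteq> 0"
proof
  let ?B1 = "\<chi> i j. B $ i $ j - e $ i * l $ j" and ?E = "renewal_symbol \<beta> \<zeta>"
  assume "det (\<chi> i j. (if i = j then 1 else 0) - cmat ?B1 $ i $ j * ?E) = 0"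
  then obtain v where v: "v \<noteq> 0" and "(\<chi> i j. (if i = j then 1 else 0) - cmat ?B1 $ i $ j * ?E) *v v = 0"
    unfolding det_zero_iff_kernel by blast
  then have fixpt: "v $ i - (\<Sum>j\<in>UNIV. cmat ?B1 $ i $ j * ?E * v $ j) = 0" for i
  proof -
    have "(\<Sum>j\<in>UNIV. ((if i = j then 1 else 0) - cmat ?B1 $ i $ j * ?E) * v $ j)
       = (\<Sum>j\<in>UNIV. if i = j then v $ j else 0) - (\<Sum>j\<in>UNIV. cmat ?B1 $ i $ j * ?E * v $ j)"
      unfolding sum_subtractf[symmetric] by (intro sum.cong) (auto simp: algebra_simps)
    moreover have "((\<chi> i j. (if i = j then 1 else 0) - cmat ?B1 $ i $ j * ?E) *v v) $ i = 0"
      using \<open>_ *v v = 0\<close> by simp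
    ultimately show ?thesis
      by (simp add: matrix_vector_mult_def)
  qed
  have vi: "v $ i = ?E * (cmat ?B1 *v v) $ i" for i
  proof -
    have "(\<Sum>j\<in>UNIV. cmat ?B1 $ i $ j * ?E * v $ j) = ?E * (\<Sum>j\<in>UNIV. cmat ?B1 $ i $ j * v $ j)"
      unfolding sum_distrib_left by (intro sum.cong refl) (simp only: mult_ac)
    with fixpt[of i] show ?thesis
      by (simp only: matrix_vector_mult_def vec_lambda_beta right_minus_eq)
  qed
  have E0: "?E \<noteq> 0"
    using vi v by (auto simp: vec_eq_iff)
  define lv where "lv = (\<Sum>j\<in>UNIV. of_real (l $ j) * v $ j)"
  have B1: "(cmat ?B1 *v v) $ i = (cmat B *v v) $ i - of_real (e $ i) * lv" for i
    by (simp add: matrix_vector_mult_def cmat_def lv_def sum_distrib_left algebra_simps sum_subtractf)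
  have lB: "(\<Sum>i\<in>UNIV. l $ i * B $ i $ j) = l $ j" for j
  proof -
    have "l \<bullet> (B *v axis j 1) = l \<bullet> axis j 1"
      by (rule l(2))
    then show ?thesis
      by (simp add: inner_vec_def matrix_vector_mult_def axis_def if_distrib cong: if_cong)
  qed
  have "(\<Sum>i\<in>UNIV. of_real (l $ i) * (cmat B *v v) $ i) = (\<Sum>i\<in>UNIV. \<Sum>j\<in>UNIV. of_real (l $ i * B $ i $ j) * v $ j)"
    by (simp add: matrix_vector_mult_def cmat_def sum_distrib_left mult_ac)
  also have "\<dots> = (\<Sum>j\<in>UNIV. of_real (\<Sum>i\<in>UNIV. l $ i * B $ i $ j) * v $ j)"
    by (subst sum.swap) (simp add: sum_distrib_right)
  also have "\<dots> = lv"
    by (simp only: lB lv_def)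
  finally have "(\<Sum>i\<in>UNIV. of_real (l $ i) * (cmat B *v v) $ i) = lv" .
  moreover have "(\<Sum>i\<in>UNIV. of_real (l $ i) * (of_real (e $ i) * lv)) = of_real (l \<bullet> e) * lv"
    by (simp add: inner_vec_def sum_distrib_right mult.assoc)
  ultimately have "(\<Sum>i\<in>UNIV. of_real (l $ i) * (cmat ?B1 *v v) $ i) = 0"
    unfolding B1 by (simp add: right_diff_distrib sum_subtractf l(1))
  moreover have "lv = ?E * (\<Sum>i\<in>UNIV. of_real (l $ i) * (cmat ?B1 *v v) $ i)"
    unfolding lv_def sum_distrib_left by (rule sum.cong[OF refl]) (subst vi, simp add: mult_ac)
  ultimately have lv0: "lv = 0"
    by simp
  define \<mu> where "\<mu> = 1 / ?E"
  have Bv: "cmat B *v v = \<mu> *s v"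
  proof -
    have "(cmat B *v v) $ i = \<mu> * v $ i" for i
      using vi[of i] B1[of i] E0 lv0 by (simp add: \<mu>_def field_simps)
    then show ?thesis
      by (simp add: vec_eq_iff)
  qed
  then have spec: "\<mu> \<in> spectrum_c B"
    using v spectrum_c_iff by blast
  \<comment> \<open>On the closed disc the exponent of the symbol has nonpositive real part, so the
    symbol never exceeds 1 in modulus and eigenvalues inside the unit circle cannot
    interfere.\<close>
  have "Re \<zeta> \<le> 1"
    using \<zeta> complex_Re_le_cmod[of \<zeta>] by linarith
  then have "- \<beta> + \<beta> * Re \<zeta> \<le> 0"
    using \<beta> by simp
  then have "cmod ?E \<le> 1"
    using \<zeta> \<beta> by (simp add: renewal_symbol_def norm_mult mult_le_one flip: exp_add)
  then have "cmod \<mu> \<ge> 1"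
    using E0 by (simp add: \<mu>_def norm_divide)
  then consider "cmod \<mu> = 1" | "cmod \<mu> > 1"
    by linarith
  then show False
  proof cases
    case 1
    then have "\<mu> = 1"
      using unit spec by blast
    then have Bv1: "cmat B *v v = v"
      using Bv by simp
    \<comment> \<open>The uniqueness property of \<open>l\<close> speaks of real vectors, and
      \<open>B\<close> and \<open>l\<close> are real; it is applied to the real and the imaginary
      part in turn.\<close>
    have "(\<chi> i. Re (v $ i)) = 0"
    proof (rule l(3))
      show "B *v (\<chi> i. Re (v $ i)) = (\<chi> i. Re (v $ i))"
      proof -
        have "(B *v (\<chi> i. Re (v $ i))) $ i = Re ((cmat B *v v) $ i)" for i
          by (simp add: matrix_vector_mult_def cmat_def)
        then show ?thesis
          unfolding Bv1 by (simp add: vec_eq_iff)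
      qed
      show "l \<bullet> (\<chi> i. Re (v $ i)) = 0"
        using arg_cong[OF lv0, of Re] by (simp add: lv_def inner_vec_def)
    qed
    moreover have "(\<chi> i. Im (v $ i)) = 0"
    proof (rule l(3))
      show "B *v (\<chi> i. Im (v $ i)) = (\<chi> i. Im (v $ i))"
      proof -
        have "(B *v (\<chi> i. Im (v $ i))) $ i = Im ((cmat B *v v) $ i)" for i
          by (simp add: matrix_vector_mult_def cmat_def)
        then show ?thesis
          unfolding Bv1 by (simp add: vec_eq_iff)
      qed
      show "l \<bullet> (\<chi> i. Im (v $ i)) = 0"
        using arg_cong[OF lv0, of Im] by (simp add: lv_def inner_vec_def)
    qed
    ultimately have "v = 0"
      by (simp add: vec_eq_iff complex_eq_iff)
    with v show False
      by simp
  next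
    case 2
    then have \<mu>: "\<mu> \<in> \<real>" "- exp (2 * \<beta>) < Re \<mu>" "Re \<mu> < 0"
      using outer spec by auto
    have "of_real (- (- Re \<mu>)) * (\<zeta> * exp (of_real (- \<beta>) + of_real \<beta> * \<zeta>)) = \<mu> * ?E"
      using \<mu>(1) by (simp only: renewal_symbol_def exp_add minus_minus of_real_Re)
    also have "\<dots> = 1"
      using E0 by (simp add: \<mu>_def)
    finally show False
      using characteristic_factor_nonzero[OF \<beta> _ _ \<zeta>, of "- Re \<mu>"] \<mu> by auto
  qed
qed

text \<open>Closeness to the line spanned by \<open>e\<close>, at a rate \<open>v\<close> uniform
  over initial blocks. The coefficient is read off the endpoint of the same iterate and may vary
  with \<open>n\<close>; no limit of it is asked for, since it only serves as a phase correction
  after one fixed \<open>n\<close>.\<close>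

definition block_map_limit :: "real \<Rightarrow> real \<Rightarrow> real^'n^'n \<Rightarrow> real^'n \<Rightarrow> real^'n \<Rightarrow> (nat \<Rightarrow> real) \<Rightarrow> bool" where
  "block_map_limit k \<theta> B l e v \<longleftrightarrow> v \<longlonglongrightarrow> 0 \<and>
    (\<forall>z \<eta> n t. continuous_on {0..\<theta>} z \<longrightarrow> (\<forall>u\<in>{0..\<theta>}. norm (z u) \<le> \<eta>) \<longrightarrow> t \<in> {0..\<theta>} \<longrightarrow>
      norm ((block_map k \<theta> ((*v) B) ^^ n) z t - (l \<bullet> ((block_map k \<theta> ((*v) B) ^^ n) z \<theta>)) *\<^sub>R e) \<le> \<eta> * v n)"

text \<open>With \<open>Q x = x - (l \<bullet> x) e\<close> one has \<open>Q B = M Q\<close> and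
  \<open>l B = l\<close>, so the iterates decouple. The hyperbolic component decays, and the scalar
  neutral component becomes nearly constant in \<open>t\<close>; the two rates add up to the
  required null sequence.\<close>

lemma block_map_convergence:
  fixes B :: "real^'n^'n"
  assumes \<theta>: "0 < \<theta>" and k: "0 < k" "k * \<theta> < 1"
    and l: "l \<bullet> e = 1" "\<And>x. l \<bullet> (B *v x) = l \<bullet> x" "\<And>v. B *v v = v \<Longrightarrow> l \<bullet> v = 0 \<Longrightarrow> v = 0"
    and e: "B *v e = e"
    and unit: "\<And>\<mu>. \<mu> \<in> spectrum_c B \<Longrightarrow> cmod \<mu> = 1 \<Longrightarrow> \<mu> = 1"
    and outer: "\<And>\<mu>. \<mu> \<in> spectrum_c B \<Longrightarrow> cmod \<mu> > 1 \<Longrightarrow> \<mu> \<in> \<real> \<and> - exp (2 * (k * \<theta>)) < Re \<mu> \<and> Re \<mu> < 0"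
  shows "\<exists>v. block_map_limit k \<theta> B l e v"
proof -
  define M where "M = (\<chi> i j. B $ i $ j - e $ i * l $ j)"
  have Mx: "M *v x = B *v x - (l \<bullet> x) *\<^sub>R e" for x
    by (simp add: M_def vec_eq_iff matrix_vector_mult_def inner_vec_def sum_subtractf algebra_simps sum_distrib_left)
  define Q where "Q x = x - (l \<bullet> x) *\<^sub>R e" for x
  have Q: "bounded_linear Q"
    unfolding Q_def[abs_def]
    by (intro bounded_linear_sub bounded_linear_ident bounded_linear_scaleR_const bounded_linear_inner_right)
  have \<beta>: "0 < k * \<theta>" "k * \<theta> < 1"
    using \<theta> k by auto
  have nz: "det (\<chi> i j. (if i = j then 1 else 0) - cmat M $ i $ j * renewal_symbol (k * \<theta>) \<zeta>) \<noteq> 0" if "cmod \<zeta> \<le> 1" for \<zeta>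
    unfolding M_def by (rule deflated_determinant_nonzero[OF \<beta> l unit outer that])
  obtain v :: "nat \<Rightarrow> real" where v: "v \<longlonglongrightarrow> 0"
    "\<forall>z \<eta> n t. continuous_on {0..\<theta>} z \<longrightarrow> (\<forall>u\<in>{0..\<theta>}. norm (z u) \<le> \<eta>) \<longrightarrow> t \<in> {0..\<theta>} \<longrightarrow>
       norm ((block_map k \<theta> ((*v) M) ^^ n) z t) \<le> \<eta> * v n"
    by (rule block_map_hyperbolic_decay[OF \<theta> k nz], assumption) (rule that)
  obtain K where K: "K > 0" "\<And>x. norm (Q x) \<le> K * norm x"
    using bounded_linear.pos_bounded[OF Q] by (metis mult.commute)
  show ?thesis
    unfolding block_map_limit_def
  proof (rule exI, rule conjI)
    show "(\<lambda>n. K * v n + 2 * norm l * (1 - exp (- (k * \<theta>))) ^ n * norm e) \<longlonglongrightarrow> 0"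
    proof -
      have "(\<lambda>n. (1 - exp (- (k * \<theta>))) ^ n) \<longlonglongrightarrow> 0"
        using \<beta> by (intro LIMSEQ_power_zero) auto
      then have "(\<lambda>n. K * v n + 2 * norm l * (1 - exp (- (k * \<theta>))) ^ n * norm e) \<longlonglongrightarrow> K * 0 + 2 * norm l * 0 * norm e"
        by (intro tendsto_add tendsto_mult tendsto_const v(1))
      then show ?thesis
        by simp
    qed
  next
    show "\<forall>z \<eta> n t. continuous_on {0..\<theta>} z \<longrightarrow> (\<forall>u\<in>{0..\<theta>}. norm (z u) \<le> \<eta>) \<longrightarrow> t \<in> {0..\<theta>} \<longrightarrow>
       norm ((block_map k \<theta> ((*v) B) ^^ n) z t - (l \<bullet> ((block_map k \<theta> ((*v) B) ^^ n) z \<theta>)) *\<^sub>R e) \<le> \<eta> * (K * v n + 2 * norm l * (1 - exp (- (k * \<theta>))) ^ n * norm e)"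
    proof (intro allI impI)
      fix z :: "real \<Rightarrow> real^'n" and \<eta> :: real and n :: nat and t :: real
      assume z: "continuous_on {0..\<theta>} z" and "\<forall>u\<in>{0..\<theta>}. norm (z u) \<le> \<eta>" and t: "t \<in> {0..\<theta>}"
      then have c: "norm (z u) \<le> \<eta>" if "u \<in> {0..\<theta>}" for u
        using that by blast
      let ?W = "(block_map k \<theta> ((*v) B) ^^ n) z"
      have "Q (?W t) = (block_map k \<theta> ((*v) M) ^^ n) (\<lambda>u. Q (z u)) t"
        by (rule block_map_iter_intertwine[OF z Q _ t]) (simp add: Q_def Mx l e inner_diff_right matrix_vector_mult_diff_distrib matrix_vector_mult_scaleR)
      also have "norm \<dots> \<le> (K * \<eta>) * v n"
      proof (rule v(2)[rule_format, OF _ _ t])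
        show "continuous_on {0..\<theta>} (\<lambda>u. Q (z u))"
          by (rule bounded_linear.continuous_on[OF Q z])
        show "norm (Q (z u)) \<le> K * \<eta>" if "u \<in> {0..\<theta>}" for u
          using K(2)[of "z u"] c[OF that] K(1) by (meson mult_left_mono order.trans less_imp_le)
      qed
      finally have hyp: "norm (Q (?W t)) \<le> K * \<eta> * v n" .
      have lW: "l \<bullet> ?W s = (block_map k \<theta> id ^^ n) (\<lambda>u. l \<bullet> z u) s" if "s \<in> {0..\<theta>}" for s
        by (rule block_map_iter_intertwine[OF z bounded_linear_inner_right _ that]) (simp add: l)
      have "\<bar>l \<bullet> ?W t - l \<bullet> ?W \<theta>\<bar> \<le> 2 * (norm l * \<eta>) * (1 - exp (- (k * \<theta>))) ^ n"
      proof -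
        have "\<bar>l \<bullet> z u\<bar> \<le> norm l * \<eta>" if "u \<in> {0..\<theta>}" for u
          using Cauchy_Schwarz_ineq2[of l "z u"] c[OF that] by (meson mult_left_mono norm_ge_zero order.trans)
        then show ?thesis
          using block_map_neutral_oscillation[of \<theta> "\<lambda>u. l \<bullet> z u" k "norm l * \<eta>" t n] z t k \<theta>
          by (simp add: lW continuous_on_inner)
      qed
      then have "norm ((l \<bullet> ?W t - l \<bullet> ?W \<theta>) *\<^sub>R e) \<le> 2 * (norm l * \<eta>) * (1 - exp (- (k * \<theta>))) ^ n * norm e"
        by (simp add: mult_right_mono)
      moreover have "norm (?W t - (l \<bullet> ?W \<theta>) *\<^sub>R e) \<le> norm (Q (?W t)) + norm ((l \<bullet> ?W t - l \<bullet> ?W \<theta>) *\<^sub>R e)"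
      proof -
        have "?W t - (l \<bullet> ?W \<theta>) *\<^sub>R e = Q (?W t) + (l \<bullet> ?W t - l \<bullet> ?W \<theta>) *\<^sub>R e"
          by (simp add: Q_def algebra_simps)
        then show ?thesis
          by (metis norm_triangle_ineq)
      qed
      ultimately have "norm (?W t - (l \<bullet> ?W \<theta>) *\<^sub>R e) \<le> K * \<eta> * v n + 2 * (norm l * \<eta>) * (1 - exp (- (k * \<theta>))) ^ n * norm e"
        using hyp by linarith
      then show "norm (?W t - (l \<bullet> ?W \<theta>) *\<^sub>R e) \<le> \<eta> * (K * v n + 2 * norm l * (1 - exp (- (k * \<theta>))) ^ n * norm e)"
        by (simp add: algebra_simps)
    qed
  qed
qed


subsection \<open>Uniqueness for ordinary and delay equations\<close>

lemma bounded_bilinear_matrix_vector_mult: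
  "bounded_bilinear ((*v) :: real^'n^'m \<Rightarrow> real^'n \<Rightarrow> real^'m)"
  unfolding bilinear_conv_bounded_bilinear[symmetric] bilinear_def
  by (auto intro!: linearI simp: matrix_vector_mult_add_rdistrib matrix_vector_right_distrib
      matrix_vector_mult_scaleR scaleR_matrix_vector_assoc)

lemma vector_derivative_bound:
  fixes d :: "real \<Rightarrow> 'a::real_normed_vector"
  assumes "\<And>t. t \<in> {a..b} \<Longrightarrow> (d has_vector_derivative d' t) (at t within {a..b})"
    and C: "\<And>t. t \<in> {a..b} \<Longrightarrow> norm (d' t) \<le> C"
    and "x \<in> {a..b}" "y \<in> {a..b}"
  shows "norm (d x - d y) \<le> C * \<bar>x - y\<bar>"
proof -
  have "norm (d x - d y) \<le> C * norm (x - y)"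
  proof (rule differentiable_bound[of "{a..b}" d "\<lambda>t h. h *\<^sub>R d' t"])
    show "(d has_derivative (\<lambda>h. h *\<^sub>R d' t)) (at t within {a..b})" if "t \<in> {a..b}" for t
      using assms(1)[OF that] by (simp add: has_vector_derivative_def)
    show "onorm (\<lambda>h. h *\<^sub>R d' t) \<le> C" if "t \<in> {a..b}" for t
      using C[OF that] by (intro onorm_le) (simp add: mult.commute[of C] mult_left_mono)
  qed (use assms in auto)
  then show ?thesis
    by simp
qed

text \<open>On a short window after a time up to which \<open>d\<close> vanishes, the mean value
  inequality bounds the maximum of \<open>norm (d t)\<close> by half of itself. The argument works
  for any \<tau> \<ge> 0, so the case \<tau> = 0 covers ordinary differential equations as
  well.\<close>

lemma delay_gronwall_zero:
  fixes d :: "real \<Rightarrow> 'a::real_normed_vector"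
  assumes \<tau>: "0 \<le> \<tau>" and L: "0 \<le> L"
    and cont: "continuous_on {-\<tau>..T} d"
    and zero: "\<And>s. s \<in> {-\<tau>..0} \<Longrightarrow> d s = 0"
    and deriv: "\<And>t. t \<in> {0..T} \<Longrightarrow> (d has_vector_derivative d' t) (at t within {0..T})"
    and bound: "\<And>t. t \<in> {0..T} \<Longrightarrow> norm (d' t) \<le> L * (norm (d t) + norm (d (t - \<tau>)))"
    and t: "t \<in> {-\<tau>..T}"
  shows "d t = 0"
proof -
  \<comment> \<open>The window length makes \<open>2 * L * \<sigma>\<close> at most one half; the
    summand 4 keeps the denominator positive when \<open>L = 0\<close>.\<close>
  define \<sigma> where "\<sigma> = 1 / (4 * L + 4)"
  have \<sigma>: "\<sigma> > 0" "2 * L * \<sigma> \<le> 1 / 2"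
    using L by (auto simp: \<sigma>_def field_simps)
  have "\<forall>t. -\<tau> \<le> t \<and> t \<le> T \<and> t \<le> real n * \<sigma> \<longrightarrow> d t = 0" for n
  proof (induction n)
    case 0
    then show ?case
      using zero by auto
  next
    case (Suc n)
    define a where "a = real n * \<sigma>"
    define b where "b = min T (a + \<sigma>)"
    have a: "0 \<le> a"
      using \<sigma> by (simp add: a_def)
    have IH: "d t = 0" if "-\<tau> \<le> t" "t \<le> T" "t \<le> a" for t
      using Suc that by (auto simp: a_def)
    show ?case
    proof (cases "a \<le> T")
      case False
      then show ?thesis
        using IH by auto
    next
      case True
      then have ab: "a \<le> b" "b \<le> T" "b \<le> a + \<sigma>"
        using \<sigma> by (auto simp: b_def)
      have "continuous_on {a..b} (\<lambda>t. norm (d t))"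
        using cont ab a \<tau> by (intro continuous_on_norm) (auto intro: continuous_on_subset)
      then obtain c where c: "c \<in> {a..b}" "\<And>t. t \<in> {a..b} \<Longrightarrow> norm (d t) \<le> norm (d c)"
        using continuous_attains_sup[of "{a..b}" "\<lambda>t. norm (d t)"] ab by auto
      have "norm (d c - d a) \<le> L * (norm (d c) + norm (d c)) * \<bar>c - a\<bar>"
      proof (rule vector_derivative_bound[of a b d d'])
        fix t assume t: "t \<in> {a..b}"
        then have tT: "t \<in> {0..T}"
          using a ab by auto
        show "(d has_vector_derivative d' t) (at t within {a..b})"
          using deriv[OF tT] by (rule has_vector_derivative_within_subset) (use a ab in auto)
        have "norm (d (t - \<tau>)) \<le> norm (d c)"
        proof (cases "t - \<tau> \<le> a")
          case True
          then show ?thesis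
            using IH[of "t - \<tau>"] tT \<tau> by auto
        next
          case False
          then show ?thesis
            using t \<tau> by (intro c) auto
        qed
        then show "norm (d' t) \<le> L * (norm (d c) + norm (d c))"
          using bound[OF tT] c(2)[OF t] L by (meson add_mono mult_left_mono order.trans)
      qed (use c ab in auto)
      also have "\<dots> \<le> L * (norm (d c) + norm (d c)) * \<sigma>"
        using c(1) ab L by (intro mult_left_mono) auto
      also have "\<dots> = (2 * L * \<sigma>) * norm (d c)"
        by simp
      also have "\<dots> \<le> 1 / 2 * norm (d c)"
        using \<sigma>(2) by (intro mult_right_mono) auto
      finally have "norm (d c - d a) \<le> 1 / 2 * norm (d c)" .
      moreover have "d a = 0"
        using IH[of a] a ab \<tau> by auto
      ultimately have "norm (d c) = 0"
        by simp
      then have "d t = 0" if "t \<in> {a..b}" for t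
        using c(2)[OF that] by simp
      moreover have "t \<in> {a..b}" if "t \<le> T" "t \<le> real (Suc n) * \<sigma>" "\<not> t \<le> a" for t
        using that by (auto simp: b_def a_def algebra_simps)
      ultimately show ?thesis
        using IH by blast
    qed
  qed
  moreover obtain n where "T \<le> real n * \<sigma>"
    using reals_Archimedean3[OF \<sigma>(1)] less_imp_le by blast
  ultimately show ?thesis
    using t by (meson atLeastAtMost_iff order_trans)
qed

text \<open>The forward statement is applied with zero delay to \<open>y\<close> run forwards
  (\<open>c = 1\<close>) and backwards (\<open>c = - 1\<close>) from \<open>t0\<close>.\<close>

lemma ode_zero_unique:
  fixes y :: "real \<Rightarrow> 'a::real_normed_vector"
  assumes deriv: "\<And>t. (y has_vector_derivative y' t) (at t)"
    and bound: "\<And>R. \<exists>L\<ge>0. \<forall>t. \<bar>t\<bar> \<le> R \<longrightarrow> norm (y' t) \<le> L * norm (y t)"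
    and zero: "y t0 = 0"
  shows "y t = 0"
proof -
  have *: "y (t0 + c * \<bar>t - t0\<bar>) = 0" if c: "c = 1 \<or> c = - 1" for c :: real
  proof -
    obtain L where L: "L \<ge> 0" "\<And>s. \<bar>s\<bar> \<le> \<bar>t0\<bar> + \<bar>t - t0\<bar> \<Longrightarrow> norm (y' s) \<le> L * norm (y s)"
      using bound by blast
    have D: "((\<lambda>s. y (t0 + c * s)) has_vector_derivative c *\<^sub>R y' (t0 + c * s)) (at s)" for s
    proof -
      have "((\<lambda>s. t0 + c * s) has_vector_derivative c) (at s)"
        by (auto intro!: derivative_eq_intros simp: has_real_derivative_iff_has_vector_derivative[symmetric])
      then show ?thesis
        using vector_diff_chain_at[of "\<lambda>s. t0 + c * s" c s y] deriv by (auto simp: o_def)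
    qed
    show ?thesis
    proof (rule delay_gronwall_zero[of 0 L "\<bar>t - t0\<bar>" "\<lambda>s. y (t0 + c * s)" "\<lambda>s. c *\<^sub>R y' (t0 + c * s)"])
      show "continuous_on {-0..\<bar>t - t0\<bar>} (\<lambda>s. y (t0 + c * s))"
        using D by (meson continuous_at_imp_continuous_on has_vector_derivative_continuous)
      fix s assume s: "s \<in> {0..\<bar>t - t0\<bar>}"
      show "((\<lambda>s. y (t0 + c * s)) has_vector_derivative c *\<^sub>R y' (t0 + c * s)) (at s within {0..\<bar>t - t0\<bar>})"
        by (rule has_vector_derivative_at_within[OF D])
      have "norm (c *\<^sub>R y' (t0 + c * s)) \<le> L * norm (y (t0 + c * s))"
        using c s by (auto intro!: L(2))
      then show "norm (c *\<^sub>R y' (t0 + c * s)) \<le> L * (norm (y (t0 + c * s)) + norm (y (t0 + c * (s - 0))))"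
        using mult_nonneg_nonneg[OF L(1) norm_ge_zero[of "y (t0 + c * s)"]] by simp
    qed (use L zero in auto)
  qed
  show ?thesis
  proof (cases "t0 \<le> t")
    case True
    then show ?thesis
      using *[of 1] by simp
  next
    case False
    then show ?thesis
      using *[of "- 1"] by simp
  qed
qed

section \<open>Local Lipschitz and remainder estimates for a C^2 vector field\<close>

locale C2_field =
  fixes f :: "'a::euclidean_space \<Rightarrow> 'a"
    and f' :: "'a \<Rightarrow> ('a \<Rightarrow>\<^sub>L 'a)"
    and f'' :: "'a \<Rightarrow> ('a \<Rightarrow>\<^sub>L ('a \<Rightarrow>\<^sub>L 'a))"
  assumes f_deriv: "\<And>x. (f has_derivative blinfun_apply (f' x)) (at x)"
    and f'_deriv: "\<And>x. (f' has_derivative blinfun_apply (f'' x)) (at x)"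
    and f''_cont: "continuous_on UNIV f''"
begin

lemma f'_cont: "continuous_on S f'"
  using f'_deriv has_derivative_continuous by (blast intro: continuous_at_imp_continuous_on)

lemma f_cont: "continuous_on S f"
  using f_deriv has_derivative_continuous by (blast intro: continuous_at_imp_continuous_on)

lemma f'_bounded_on_ball: obtains C where "C \<ge> 0" "\<And>x. norm x \<le> R \<Longrightarrow> norm (f' x) \<le> C"
proof -
  have "bounded (f' ` cball 0 R)"
    by (intro compact_imp_bounded compact_continuous_image f'_cont compact_cball)
  then obtain C where "C > 0" "\<And>x. x \<in> cball 0 R \<Longrightarrow> norm (f' x) \<le> C"
    unfolding bounded_pos by (metis imageI)
  then show thesis
    by (intro that[of C]) auto
qed

lemma f_lipschitz_on_ball:
  obtains C where "C \<ge> 0" "\<And>x y. norm x \<le> R \<Longrightarrow> norm y \<le> R \<Longrightarrow> norm (f x - f y) \<le> C * norm (x - y)"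
proof -
  obtain C where C: "C \<ge> 0" "\<And>x. norm x \<le> R \<Longrightarrow> norm (f' x) \<le> C"
    using f'_bounded_on_ball by blast
  have "norm (f x - f y) \<le> C * norm (x - y)" if "norm x \<le> R" "norm y \<le> R" for x y
    using that C(2)
    by (intro differentiable_bound[of "cball 0 R" f "\<lambda>x. blinfun_apply (f' x)"])
       (auto intro: has_derivative_at_withinI[OF f_deriv] simp: norm_blinfun.rep_eq[symmetric])
  then show thesis
    using C(1) that by blast
qed

lemma f'_lipschitz_on_ball:
  obtains C where "C \<ge> 0" "\<And>x y. norm x \<le> R \<Longrightarrow> norm y \<le> R \<Longrightarrow> norm (f' x - f' y) \<le> C * norm (x - y)"
proof -
  have "bounded (f'' ` cball 0 R)"
    using f''_cont by (intro compact_imp_bounded compact_continuous_image compact_cball) (auto intro: continuous_on_subset)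
  then obtain C where C: "C > 0" "\<And>x. x \<in> cball 0 R \<Longrightarrow> norm (f'' x) \<le> C"
    unfolding bounded_pos by (metis imageI)
  have "norm (f' x - f' y) \<le> C * norm (x - y)" if "norm x \<le> R" "norm y \<le> R" for x y
    using that C(2)
    by (intro differentiable_bound[of "cball 0 R" f' "\<lambda>x. blinfun_apply (f'' x)"])
       (auto intro: has_derivative_at_withinI[OF f'_deriv] simp: norm_blinfun.rep_eq[symmetric])
  then show thesis
    using C(1) that by (meson less_imp_le)
qed

text \<open>The derivative in \<open>v\<close> of the remainder is \<open>f' (x + v) - f' x\<close>,
  which the Lipschitz estimate for \<open>f'\<close> bounds by a multiple of \<open>r\<close>. The
  Lipschitz constant thus shrinks with the ball: this gives a contraction for small radii and, with
  \<open>w = 0\<close>, a quadratic error.\<close>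

lemma remainder_bound:
  obtains C where "C \<ge> 0"
    "\<And>x v w r. norm x \<le> R \<Longrightarrow> norm v \<le> r \<Longrightarrow> norm w \<le> r \<Longrightarrow> r \<le> 1 \<Longrightarrow>
      norm ((f (x + v) - f' x v) - (f (x + w) - f' x w)) \<le> C * r * norm (v - w)"
proof -
  obtain C where C: "C \<ge> 0" "\<And>x y. norm x \<le> R + 1 \<Longrightarrow> norm y \<le> R + 1 \<Longrightarrow> norm (f' x - f' y) \<le> C * norm (x - y)"
    using f'_lipschitz_on_ball by blast
  have "norm ((f (x + v) - f' x v) - (f (x + w) - f' x w)) \<le> C * r * norm (v - w)"
    if x: "norm x \<le> R" and vw: "norm v \<le> r" "norm w \<le> r" and r: "r \<le> 1" for x v w r
  proof (rule differentiable_bound[of "cball 0 r" "\<lambda>v. f (x + v) - f' x v" "\<lambda>v. blinfun_apply (f' (x + v) - f' x)"])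
    fix u assume u: "u \<in> cball (0::'a) r"
    have "((\<lambda>v. x + v) has_derivative (\<lambda>v. v)) (at u within cball 0 r)"
      by (auto intro!: derivative_eq_intros)
    from has_derivative_compose[OF this f_deriv]
    have "((\<lambda>v. f (x + v)) has_derivative blinfun_apply (f' (x + u))) (at u within cball 0 r)" .
    then show "((\<lambda>v. f (x + v) - f' x v) has_derivative blinfun_apply (f' (x + u) - f' x)) (at u within cball 0 r)"
      by (auto intro!: derivative_eq_intros simp: blinfun.diff_left)
    have "norm (f' (x + u) - f' x) \<le> C * norm (x + u - x)"
      using x u r norm_triangle_ineq[of x u] by (intro C) auto
    also have "\<dots> \<le> C * r"
      using u C(1) by (auto intro: mult_left_mono)
    finally show "onorm (blinfun_apply (f' (x + u) - f' x)) \<le> C * r"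
      by (simp add: norm_blinfun.rep_eq)
  qed (use vw in auto)
  then show thesis
    using C(1) that by blast
qed

lemma ode_unique:
  assumes x: "\<And>t. (x has_vector_derivative f (x t)) (at t)"
    and y: "\<And>t. (y has_vector_derivative f (y t)) (at t)"
    and t0: "x t0 = y t0"
  shows "x t = y t"
proof -
  have "x t - y t = 0"
  proof (rule ode_zero_unique[of "\<lambda>t. x t - y t" "\<lambda>t. f (x t) - f (y t)" t0 t])
    show "((\<lambda>t. x t - y t) has_vector_derivative f (x t) - f (y t)) (at t)" for t
      by (intro has_vector_derivative_diff x y)
    fix R :: real
    have "continuous_on {-R..R} x" "continuous_on {-R..R} y"
      using x y by (meson continuous_at_imp_continuous_on has_vector_derivative_continuous)+
    then have "bounded (x ` {-R..R} \<union> y ` {-R..R})"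
      by (intro bounded_Un[THEN iffD2] conjI compact_imp_bounded compact_continuous_image) auto
    then obtain M where M: "\<And>z. z \<in> x ` {-R..R} \<union> y ` {-R..R} \<Longrightarrow> norm z \<le> M"
      unfolding bounded_pos by blast
    obtain C where C: "C \<ge> 0" "\<And>x y. norm x \<le> M \<Longrightarrow> norm y \<le> M \<Longrightarrow> norm (f x - f y) \<le> C * norm (x - y)"
      using f_lipschitz_on_ball by blast
    show "\<exists>L\<ge>0. \<forall>t. \<bar>t\<bar> \<le> R \<longrightarrow> norm (f (x t) - f (y t)) \<le> L * norm (x t - y t)"
      using C M by (intro exI[of _ C]) (auto simp: abs_le_iff minus_le_iff)
  qed (use t0 in simp)
  then show ?thesis
    by simp
qed

end


subsection \<open>The frame along the orbit\<close>

lemma matrix_curve_bound: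
  fixes M :: "real \<Rightarrow> real^'n^'m"
  assumes "continuous_on {a..b} M"
  obtains K where "K \<ge> 0" "\<And>t v. t \<in> {a..b} \<Longrightarrow> norm (M t *v v) \<le> K * norm v"
proof -
  have "bounded (M ` {a..b})"
    using assms by (intro compact_imp_bounded compact_continuous_image) auto
  then obtain C where C: "C > 0" "\<And>t. t \<in> {a..b} \<Longrightarrow> norm (M t) \<le> C"
    unfolding bounded_pos by blast
  obtain D where D: "D > 0" "\<And>(A :: real^'n^'m) v. norm (A *v v) \<le> norm A * norm v * D"
    using bounded_bilinear.pos_bounded[OF bounded_bilinear_matrix_vector_mult] by blast
  have "norm (M t *v v) \<le> (C * D) * norm v" if "t \<in> {a..b}" for t v
  proof -
    have "norm (M t) * (norm v * D) \<le> C * (norm v * D)"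
      using C(2)[OF that] D(1) by (intro mult_right_mono) auto
    with D(2)[of "M t" v] show ?thesis
      by (simp add: mult_ac)
  qed
  then show thesis
    using C(1) D(1) by (intro that[of "C * D"]) auto
qed

text \<open>The orbit is seen as one that closes up after time \<theta> modulo the isometry
  \<open>h\<close>; this relative period, and not the period itself, is the length of a
  block.\<close>

locale relative_periodic_orbit = C2_field f f' f''
  for f :: "real^'n \<Rightarrow> real^'n" and f' f'' +
  fixes xs :: "real \<Rightarrow> real^'n" and Y :: "real \<Rightarrow> real^'n^'n" and h :: "real^'n^'n" and \<theta> :: real
  assumes h_orth: "orthogonal_matrix h"
    and h_equiv: "\<And>x. f (h *v x) = h *v f x"
    and xs_ode: "\<And>t. (xs has_vector_derivative f (xs t)) (at t)"
    and Y_0: "Y 0 = mat 1"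
    and Y_ode: "\<And>t. (Y has_vector_derivative (matrix (blinfun_apply (f' (xs t))) ** Y t)) (at t)"
    and theta_shift: "h *v xs 0 = xs \<theta>"
begin

definition B :: "real^'n^'n" where "B = matrix_inv h ** Y \<theta>"

lemma h_inv [simp]: "h *v (matrix_inv h *v v) = v" "matrix_inv h *v (h *v v) = v"
proof -
  have "det h \<noteq> 0"
    using det_orthogonal_matrix[OF h_orth] by auto
  from matrix_inv_mult[OF this] show "h *v (matrix_inv h *v v) = v" "matrix_inv h *v (h *v v) = v"
    by (simp_all add: matrix_vector_mul_assoc)
qed

lemma norm_h [simp]: "norm (h *v v) = norm v"
  using h_orth orthogonal_transformation_matrix[of "(*v) h"] orthogonal_transformation_norm[of "(*v) h"] by simp

lemma norm_h_inv [simp]: "norm (matrix_inv h *v v) = norm v"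
  using norm_h[of "matrix_inv h *v v"] by simp

lemma xs_cont: "continuous_on S xs"
  using xs_ode by (meson continuous_at_imp_continuous_on has_vector_derivative_continuous)

lemma Y_cont: "continuous_on S Y"
  using Y_ode by (meson continuous_at_imp_continuous_on has_vector_derivative_continuous)

lemma linearization_bound: "\<exists>L\<ge>0. \<forall>t. \<bar>t\<bar> \<le> R \<longrightarrow> norm (f' (xs t)) \<le> L"
proof -
  have "continuous_on {-R..R} (\<lambda>t. f' (xs t))"
    by (rule continuous_on_compose2[OF f'_cont[of UNIV] xs_cont]) auto
  then have "bounded ((\<lambda>t. f' (xs t)) ` {-R..R})"
    by (intro compact_imp_bounded compact_continuous_image) auto
  then obtain L where "L > 0" "\<And>t. t \<in> {-R..R} \<Longrightarrow> norm (f' (xs t)) \<le> L"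
    unfolding bounded_pos by blast
  then show ?thesis
    by (intro exI[of _ L]) (auto simp: abs_le_iff minus_le_iff)
qed

lemma linearization_unique:
  assumes y: "\<And>t. (y has_vector_derivative f' (xs t) (y t)) (at t)" and "y t0 = 0"
  shows "y t = 0"
proof (rule ode_zero_unique[OF y _ assms(2)])
  fix R :: real
  obtain L where "L \<ge> 0" "\<forall>t. \<bar>t\<bar> \<le> R \<longrightarrow> norm (f' (xs t)) \<le> L"
    using linearization_bound by blast
  then show "\<exists>L\<ge>0. \<forall>t. \<bar>t\<bar> \<le> R \<longrightarrow> norm (f' (xs t) (y t)) \<le> L * norm (y t)"
    by (meson mult_right_mono norm_blinfun norm_ge_zero order.trans)
qed

lemma Y_apply_ode: "((\<lambda>t. Y t *v v) has_vector_derivative f' (xs t) (Y t *v v)) (at t)"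
proof -
  have "((\<lambda>t. Y t *v v) has_vector_derivative (matrix (blinfun_apply (f' (xs t))) ** Y t) *v v) (at t)"
    by (rule bounded_linear.has_vector_derivative[OF bounded_bilinear.bounded_linear_left[OF bounded_bilinear_matrix_vector_mult] Y_ode])
  then show ?thesis
    by (simp add: matrix_works bounded_linear.linear[OF blinfun.bounded_linear_right] flip: matrix_vector_mul_assoc)
qed

lemma matrix_vector_derivative:
  "(y has_vector_derivative y') F \<Longrightarrow> ((\<lambda>t. A *v y t) has_vector_derivative A *v y') F" for A :: "real^'n^'n"
  by (rule bounded_linear.has_vector_derivative[OF matrix_vector_mul_bounded_linear])

lemma shift_derivative:
  "(\<And>t. (y has_vector_derivative y' t) (at t)) \<Longrightarrow> ((\<lambda>t. y (t + c)) has_vector_derivative y' (t + c)) (at t)"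
  for y :: "real \<Rightarrow> 'b::real_normed_vector"
proof -
  assume y: "\<And>t. (y has_vector_derivative y' t) (at t)"
  have "((\<lambda>t. t + c) has_vector_derivative 1) (at t)"
    by (auto intro!: derivative_eq_intros simp: has_real_derivative_iff_has_vector_derivative[symmetric])
  from vector_diff_chain_at[OF this y] show ?thesis
    by (simp add: o_def)
qed

lemma xs_shift: "h *v xs t = xs (t + \<theta>)"
proof (rule ode_unique[where x = "\<lambda>t. h *v xs t" and y = "\<lambda>t. xs (t + \<theta>)" and ?t0.0 = 0])
  show "((\<lambda>t. h *v xs t) has_vector_derivative f (h *v xs t)) (at t)" for t
    unfolding h_equiv by (rule matrix_vector_derivative[OF xs_ode])
  show "((\<lambda>t. xs (t + \<theta>)) has_vector_derivative f (xs (t + \<theta>))) (at t)" for t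
    by (rule shift_derivative[OF xs_ode])
  show "h *v xs 0 = xs (0 + \<theta>)"
    by (simp add: theta_shift)
qed

lemma f'_equiv: "f' (h *v x) (h *v v) = h *v f' x v"
proof -
  have "((\<lambda>x. f (h *v x)) has_derivative (\<lambda>v. f' (h *v x) (h *v v))) (at x)"
    by (rule has_derivative_compose[OF bounded_linear_imp_has_derivative[OF matrix_vector_mul_bounded_linear] f_deriv])
  moreover have "((\<lambda>x. h *v f x) has_derivative (\<lambda>v. h *v f' x v)) (at x)"
    by (rule bounded_linear.has_derivative[OF matrix_vector_mul_bounded_linear f_deriv])
  ultimately have "(\<lambda>v. f' (h *v x) (h *v v)) = (\<lambda>v. h *v f' x v)"
    unfolding h_equiv by (rule has_derivative_unique)
  then show ?thesis
    by metis
qed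

text \<open>After an application of the inverse of \<open>h\<close>, both sides solve the linearized
  equation along the same orbit and agree at \<open>t = 0\<close>. This Floquet-type identity puts
  one and the same matrix \<open>B\<close> into the endpoint rule for every phase.\<close>

lemma Y_shift: "Y (t + \<theta>) *v v = h *v (Y t *v (B *v v))"
proof -
  have "matrix_inv h *v (Y (t + \<theta>) *v v) - Y t *v (B *v v) = 0"
  proof (rule linearization_unique[where y = "\<lambda>t. matrix_inv h *v (Y (t + \<theta>) *v v) - Y t *v (B *v v)" and ?t0.0 = 0])
    fix t
    have inv: "matrix_inv h *v f' (xs (t + \<theta>)) w = f' (xs t) (matrix_inv h *v w)" for w
      using f'_equiv[of "xs t" "matrix_inv h *v w"] by (simp add: xs_shift)
    have "((\<lambda>t. matrix_inv h *v (Y (t + \<theta>) *v v)) has_vector_derivative matrix_inv h *v f' (xs (t + \<theta>)) (Y (t + \<theta>) *v v)) (at t)"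
      by (intro matrix_vector_derivative shift_derivative Y_apply_ode)
    then have "((\<lambda>t. matrix_inv h *v (Y (t + \<theta>) *v v) - Y t *v (B *v v)) has_vector_derivative
        f' (xs t) (matrix_inv h *v (Y (t + \<theta>) *v v)) - f' (xs t) (Y t *v (B *v v))) (at t)"
      unfolding inv by (rule has_vector_derivative_diff[OF _ Y_apply_ode])
    then show "((\<lambda>t. matrix_inv h *v (Y (t + \<theta>) *v v) - Y t *v (B *v v)) has_vector_derivative
        f' (xs t) (matrix_inv h *v (Y (t + \<theta>) *v v) - Y t *v (B *v v))) (at t)"
      by (simp only: blinfun.diff_right)
  qed (simp add: Y_0 B_def flip: matrix_vector_mul_assoc)
  then have "h *v (matrix_inv h *v (Y (t + \<theta>) *v v)) = h *v (Y t *v (B *v v))"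
    by simp
  then show ?thesis
    by simp
qed

lemma det_Y_nonzero: "det (Y t) \<noteq> 0"
proof -
  have "v = 0" if "Y t *v v = 0" for v
    using linearization_unique[OF Y_apply_ode that, of 0] by (simp add: Y_0)
  then show ?thesis
    using det_zero_iff_kernel by blast
qed

definition Yi :: "real \<Rightarrow> real^'n^'n" where "Yi t = matrix_inv (Y t)"

lemma Y_inv [simp]: "Y t *v (Yi t *v v) = v" "Yi t *v (Y t *v v) = v"
  using matrix_inv_mult[OF det_Y_nonzero, of t] by (simp_all add: matrix_vector_mul_assoc Yi_def)

lemma Yi_cont: "continuous_on S Yi"
proof -
  have nth: "continuous_on S (\<lambda>t. Y t $ i $ j)" for i j
    by (intro continuous_intros Y_cont)
  have "continuous_on S (\<lambda>t. Yi t $ i $ j)" for i j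
  proof -
    have "continuous_on S (\<lambda>t. det (\<chi> r s. if s = i then (if r = j then 1 else 0) else Y t $ r $ s) / det (Y t))"
    proof (rule continuous_on_divide[OF continuous_on_det continuous_on_det])
      fix r s
      show "continuous_on S (\<lambda>t. (\<chi> r s. if s = i then (if r = j then 1 else 0) else Y t $ r $ s) $ r $ s)"
        by (cases "s = i") (auto intro: nth)
    qed (auto intro: nth simp: det_Y_nonzero)
    then show ?thesis
      by (simp add: Yi_def matrix_inv_nth det_Y_nonzero)
  qed
  then have "continuous_on S (\<lambda>t. \<chi> i j. Yi t $ i $ j)"
    by (intro continuous_on_vec_lambda)
  then show ?thesis
    by simp
qed

lemma f_xs_ode: "((\<lambda>t. f (xs t)) has_vector_derivative f' (xs t) (f (xs t))) (at t)"
  using vector_derivative_diff_chain_within[OF xs_ode[of t] has_derivative_at_withinI[OF f_deriv]]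
  by (simp add: o_def)

lemma Y_velocity: "Y t *v f (xs 0) = f (xs t)"
proof -
  have "Y t *v f (xs 0) - f (xs t) = 0"
  proof (rule linearization_unique[where y = "\<lambda>t. Y t *v f (xs 0) - f (xs t)" and ?t0.0 = 0])
    show "((\<lambda>t. Y t *v f (xs 0) - f (xs t)) has_vector_derivative f' (xs t) (Y t *v f (xs 0) - f (xs t))) (at t)" for t
      unfolding blinfun.diff_right by (intro has_vector_derivative_diff Y_apply_ode f_xs_ode)
  qed (simp add: Y_0)
  then show ?thesis
    by simp
qed

lemma B_velocity: "B *v f (xs 0) = f (xs 0)"
proof -
  have "h *v (B *v f (xs 0)) = h *v f (xs 0)"
    using Y_shift[of 0 "f (xs 0)"] Y_velocity[of \<theta>] by (simp add: Y_0 h_equiv flip: theta_shift)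
  then show ?thesis
    using h_inv(2) by metis
qed

text \<open>The window contains every \<open>t + \<phi>\<close> with \<open>t\<close> in a block and
  \<open>\<bar>\<phi>\<bar> \<le> 1\<close>; compactness provides one constant for all estimates in
  it. The last three bounds control what a change of phase does to the orbit and to the
  frame.\<close>

lemma frame_bounds:
  obtains K where "K \<ge> 1"
    "\<And>t v. t \<in> {-1..\<theta> + 1} \<Longrightarrow> norm (Y t *v v) \<le> K * norm v"
    "\<And>t v. t \<in> {-1..\<theta> + 1} \<Longrightarrow> norm (Yi t *v v) \<le> K * norm v"
    "\<And>t. t \<in> {-1..\<theta> + 1} \<Longrightarrow> norm (xs t) \<le> K"
    "\<And>s t. s \<in> {-1..\<theta> + 1} \<Longrightarrow> t \<in> {-1..\<theta> + 1} \<Longrightarrow> norm (xs t - xs s) \<le> K * \<bar>t - s\<bar>"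
    "\<And>s t. s \<in> {-1..\<theta> + 1} \<Longrightarrow> t \<in> {-1..\<theta> + 1} \<Longrightarrow> norm (xs t - xs s - (t - s) *\<^sub>R f (xs s)) \<le> K * \<bar>t - s\<bar>\<^sup>2"
    "\<And>s t v. s \<in> {-1..\<theta> + 1} \<Longrightarrow> t \<in> {-1..\<theta> + 1} \<Longrightarrow> norm (Y t *v v - Y s *v v) \<le> K * \<bar>t - s\<bar> * norm v"
proof -
  let ?I = "{-1..\<theta> + 1}"
  obtain K1 where K1: "K1 \<ge> 0" "\<And>t v. t \<in> ?I \<Longrightarrow> norm (Y t *v v) \<le> K1 * norm v"
    using matrix_curve_bound[OF Y_cont] by metis
  obtain K2 where K2: "K2 \<ge> 0" "\<And>t v. t \<in> ?I \<Longrightarrow> norm (Yi t *v v) \<le> K2 * norm v"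
    using matrix_curve_bound[OF Yi_cont] by metis
  have "bounded (xs ` ?I)"
    by (intro compact_imp_bounded compact_continuous_image xs_cont) auto
  then obtain K3 where K3: "K3 > 0" "\<And>t. t \<in> ?I \<Longrightarrow> norm (xs t) \<le> K3"
    unfolding bounded_pos by blast
  have "bounded ((\<lambda>t. f (xs t)) ` ?I)"
    using continuous_on_compose2[OF f_cont[of UNIV] xs_cont[of ?I]]
    by (intro compact_imp_bounded compact_continuous_image) auto
  then obtain K4 where K4: "K4 > 0" "\<And>t. t \<in> ?I \<Longrightarrow> norm (f (xs t)) \<le> K4"
    unfolding bounded_pos by blast
  obtain K5 where K5: "K5 \<ge> 0" "\<And>x y. norm x \<le> K3 \<Longrightarrow> norm y \<le> K3 \<Longrightarrow> norm (f x - f y) \<le> K5 * norm (x - y)"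
    using f_lipschitz_on_ball by metis
  obtain L where L: "L \<ge> 0" "\<forall>t. \<bar>t\<bar> \<le> \<bar>\<theta>\<bar> + 1 \<longrightarrow> norm (f' (xs t)) \<le> L"
    using linearization_bound by blast
  have lip: "norm (xs t - xs s) \<le> K4 * \<bar>t - s\<bar>" if "s \<in> ?I" "t \<in> ?I" for s t
    by (rule vector_derivative_bound[OF has_vector_derivative_at_within[OF xs_ode] K4(2) that(2,1)])
  have quad: "norm (xs t - xs s - (t - s) *\<^sub>R f (xs s)) \<le> K5 * K4 * \<bar>t - s\<bar>\<^sup>2" if st: "s \<in> ?I" "t \<in> ?I" for s t
  proof -
    have "norm ((xs t - t *\<^sub>R f (xs s)) - (xs s - s *\<^sub>R f (xs s))) \<le> K5 * (K4 * \<bar>t - s\<bar>) * \<bar>t - s\<bar>"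
    proof (rule vector_derivative_bound[where a = "min s t" and b = "max s t" and d = "\<lambda>u. xs u - u *\<^sub>R f (xs s)" and d' = "\<lambda>u. f (xs u) - f (xs s)"])
      fix u assume u: "u \<in> {min s t..max s t}"
      have uI: "u \<in> ?I"
        using u st by (auto simp: min_def max_def split: if_splits)
      have "((\<lambda>u. u *\<^sub>R f (xs s)) has_vector_derivative f (xs s)) (at u within {min s t..max s t})"
        by (auto intro!: derivative_eq_intros)
      then show "((\<lambda>u. xs u - u *\<^sub>R f (xs s)) has_vector_derivative f (xs u) - f (xs s)) (at u within {min s t..max s t})"
        by (intro has_vector_derivative_diff has_vector_derivative_at_within[OF xs_ode])
      have "norm (f (xs u) - f (xs s)) \<le> K5 * norm (xs u - xs s)"
        by (intro K5(2) K3(2) uI st)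
      also have "\<dots> \<le> K5 * (K4 * \<bar>t - s\<bar>)"
      proof (rule mult_left_mono[OF _ K5(1)])
        have "norm (xs u - xs s) \<le> K4 * \<bar>u - s\<bar>"
          by (rule lip[OF st(1) uI])
        also have "\<dots> \<le> K4 * \<bar>t - s\<bar>"
          using u K4(1) by (intro mult_left_mono) (auto simp: min_def max_def split: if_splits)
        finally show "norm (xs u - xs s) \<le> K4 * \<bar>t - s\<bar>" .
      qed
      finally show "norm (f (xs u) - f (xs s)) \<le> K5 * (K4 * \<bar>t - s\<bar>)" .
    qed auto
    then show ?thesis
      by (simp add: algebra_simps power2_eq_square)
  qed
  have Ylip: "norm (Y t *v v - Y s *v v) \<le> L * K1 * \<bar>t - s\<bar> * norm v" if st: "s \<in> ?I" "t \<in> ?I" for s t v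
  proof -
    have "norm (Y t *v v - Y s *v v) \<le> L * (K1 * norm v) * \<bar>t - s\<bar>"
    proof (rule vector_derivative_bound[OF has_vector_derivative_at_within[OF Y_apply_ode] _ st(2,1)])
      fix u assume u: "u \<in> ?I"
      have "norm (f' (xs u) (Y u *v v)) \<le> norm (f' (xs u)) * norm (Y u *v v)"
        by (rule norm_blinfun)
      also have "\<dots> \<le> L * (K1 * norm v)"
      proof (rule mult_mono)
        have "\<bar>u\<bar> \<le> \<bar>\<theta>\<bar> + 1"
          using u by auto
        then show "norm (f' (xs u)) \<le> L"
          using L(2) by blast
      qed (use L(1) K1(2)[OF u, of v] in auto)
      finally show "norm (f' (xs u) (Y u *v v)) \<le> L * (K1 * norm v)" .
    qed
    then show ?thesis
      by (simp add: mult_ac)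
  qed
  define K where "K = 1 + K1 + K2 + K3 + K4 + K5 * K4 + L * K1"
  have nn: "0 \<le> K5 * K4" "0 \<le> L * K1"
    using K5(1) K4(1) L(1) K1(1) by auto
  have K: "1 \<le> K" "K1 \<le> K" "K2 \<le> K" "K3 \<le> K" "K4 \<le> K" "K5 * K4 \<le> K" "L * K1 \<le> K"
    using nn K1(1) K2(1) K3(1) K4(1) by (auto simp: K_def)
  show thesis
  proof
    show "1 \<le> K" by fact
    show "norm (Y t *v v) \<le> K * norm v" if "t \<in> ?I" for t v
      using K1(2)[OF that, of v] mult_right_mono[OF K(2), of "norm v"] by simp
    show "norm (Yi t *v v) \<le> K * norm v" if "t \<in> ?I" for t v
      using K2(2)[OF that, of v] mult_right_mono[OF K(3), of "norm v"] by simp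
    show "norm (xs t) \<le> K" if "t \<in> ?I" for t
      using K3(2)[OF that] K(4) by simp
    show "norm (xs t - xs s) \<le> K * \<bar>t - s\<bar>" if "s \<in> ?I" "t \<in> ?I" for s t
      using lip[OF that] mult_right_mono[OF K(5), of "\<bar>t - s\<bar>"] by simp
    show "norm (xs t - xs s - (t - s) *\<^sub>R f (xs s)) \<le> K * \<bar>t - s\<bar>\<^sup>2" if "s \<in> ?I" "t \<in> ?I" for s t
      using quad[OF that] mult_right_mono[OF K(6), of "\<bar>t - s\<bar>\<^sup>2"] by simp
    show "norm (Y t *v v - Y s *v v) \<le> K * \<bar>t - s\<bar> * norm v" if "s \<in> ?I" "t \<in> ?I" for s t v
      using Ylip[OF that, of v] mult_right_mono[OF K(7), of "\<bar>t - s\<bar> * norm v"] by (simp add: mult.assoc)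
  qed
qed

text \<open>A block \<open>z\<close> in frame coordinates around the orbit of phase \<open>\<phi>\<close>, and the nonlinear remainder of the vector
  field in these coordinates: the block equation reads \<open>z' = k (y - z) + rest \<phi> t z\<close>.\<close>

definition lift :: "real \<Rightarrow> (real \<Rightarrow> real^'n) \<Rightarrow> real \<Rightarrow> real^'n" where
  "lift \<phi> z t = xs (t + \<phi>) + Y (t + \<phi>) *v z t"

definition rest :: "real \<Rightarrow> real \<Rightarrow> real^'n \<Rightarrow> real^'n" where
  "rest \<phi> t z = Yi (t + \<phi>) *v ((f (xs (t + \<phi>) + Y (t + \<phi>) *v z) - f' (xs (t + \<phi>)) (Y (t + \<phi>) *v z)) - f (xs (t + \<phi>)))"

lemma rest_zero [simp]: "rest \<phi> t 0 = 0"
  by (simp add: rest_def blinfun.zero_right)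

lemma continuous_on_lift:
  assumes "continuous_on S z"
  shows "continuous_on S (lift \<phi> z)"
  unfolding lift_def[abs_def]
  by (intro continuous_intros bounded_bilinear.continuous_on[OF bounded_bilinear_matrix_vector_mult] assms
      continuous_on_compose2[OF xs_cont[of UNIV]] continuous_on_compose2[OF Y_cont[of UNIV]]) auto

lemma continuous_on_rest:
  assumes "continuous_on S z"
  shows "continuous_on S (\<lambda>t. rest \<phi> t (z t))"
proof -
  have shift: "continuous_on S (\<lambda>t. t + \<phi>)"
    by (intro continuous_intros)
  have x: "continuous_on S (\<lambda>t. xs (t + \<phi>))"
    by (rule continuous_on_compose2[OF xs_cont[of UNIV] shift]) auto
  have Yz: "continuous_on S (\<lambda>t. Y (t + \<phi>) *v z t)"
    by (intro bounded_bilinear.continuous_on[OF bounded_bilinear_matrix_vector_mult] assms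
        continuous_on_compose2[OF Y_cont[of UNIV] shift]) auto
  show ?thesis
    unfolding rest_def
    by (intro bounded_bilinear.continuous_on[OF bounded_bilinear_matrix_vector_mult]
        continuous_on_compose2[OF Yi_cont[of UNIV] shift] continuous_on_diff bounded_bilinear.continuous_on[OF bounded_bilinear_blinfun_apply _ Yz]
        continuous_on_compose2[OF f_cont[of UNIV]] continuous_on_compose2[OF f'_cont[of UNIV] x] x continuous_on_add Yz) auto
qed

text \<open>The remainder estimate conjugated by the frame. The three factors \<open>K\<close> come
  from the inverse frame, from the enlarged radius \<open>K * r\<close>, and from \<open>Y\<close>
  acting on \<open>z - w\<close>; the radius \<open>1 / K\<close> keeps
  \<open>K * r \<le> 1\<close>.\<close>

lemma rest_lipschitz:
  obtains C r0 where "C \<ge> 0" "r0 > 0"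
    "\<And>\<phi> t r z w. \<bar>\<phi>\<bar> \<le> 1 \<Longrightarrow> t \<in> {0..\<theta>} \<Longrightarrow> r \<le> r0 \<Longrightarrow> norm z \<le> r \<Longrightarrow> norm w \<le> r \<Longrightarrow>
      norm (rest \<phi> t z - rest \<phi> t w) \<le> C * r * norm (z - w)"
proof -
  obtain K where K: "K \<ge> 1"
    "\<And>t v. t \<in> {-1..\<theta> + 1} \<Longrightarrow> norm (Y t *v v) \<le> K * norm v"
    "\<And>t v. t \<in> {-1..\<theta> + 1} \<Longrightarrow> norm (Yi t *v v) \<le> K * norm v"
    "\<And>t. t \<in> {-1..\<theta> + 1} \<Longrightarrow> norm (xs t) \<le> K"
    using frame_bounds by metis
  obtain C where C: "C \<ge> 0" "\<And>x v w r. norm x \<le> K \<Longrightarrow> norm v \<le> r \<Longrightarrow> norm w \<le> r \<Longrightarrow> r \<le> 1 \<Longrightarrow>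
      norm ((f (x + v) - f' x v) - (f (x + w) - f' x w)) \<le> C * r * norm (v - w)"
    using remainder_bound by metis
  show thesis
  proof
    show "0 \<le> K ^ 3 * C" "0 < 1 / K"
      using K(1) C(1) by auto
    fix \<phi> t r :: real and z w :: "real^'n"
    assume \<phi>: "\<bar>\<phi>\<bar> \<le> 1" and t: "t \<in> {0..\<theta>}" and r: "r \<le> 1 / K" and zw: "norm z \<le> r" "norm w \<le> r"
    define s where "s = t + \<phi>"
    have s: "s \<in> {-1..\<theta> + 1}"
      using \<phi> t by (auto simp: s_def abs_le_iff)
    have r0: "0 \<le> r"
      using zw(1) norm_ge_zero order_trans by blast
    have Kr: "K * r \<le> 1"
      using r K(1) by (simp add: field_simps)
    have Yb: "norm (Y s *v z) \<le> K * r" "norm (Y s *v w) \<le> K * r"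
      using K(2)[OF s, of z] K(2)[OF s, of w] zw K(1) by (meson mult_left_mono order.trans zero_le_one)+
    let ?R = "\<lambda>v. f (xs s + v) - f' (xs s) v"
    have "rest \<phi> t z - rest \<phi> t w = Yi s *v (?R (Y s *v z) - ?R (Y s *v w))"
      by (simp add: rest_def s_def matrix_vector_mult_diff_distrib)
    also have "norm \<dots> \<le> K * norm (?R (Y s *v z) - ?R (Y s *v w))"
      by (rule K(3)[OF s])
    also have "\<dots> \<le> K * (C * (K * r) * norm (Y s *v z - Y s *v w))"
      using K(1) by (intro mult_left_mono C(2) K(4) s Yb Kr) auto
    also have "\<dots> \<le> K * (C * (K * r) * (K * norm (z - w)))"
      using K(1) C(1) r0 K(2)[OF s, of "z - w"]
      by (intro mult_left_mono) (auto simp: matrix_vector_mult_diff_distrib)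
    also have "\<dots> = K ^ 3 * C * r * norm (z - w)"
      by (simp add: power3_eq_cube)
    finally show "norm (rest \<phi> t z - rest \<phi> t w) \<le> K ^ 3 * C * r * norm (z - w)" .
  qed
qed

end


subsection \<open>Nonlinear block dynamics\<close>

lemma smoothing_has_vector_derivative:
  fixes q :: "real \<Rightarrow> 'a::banach"
  assumes q: "continuous_on {0..\<theta>} q" and t: "t \<in> {0..\<theta>}"
  shows "(smoothing k q has_vector_derivative k *\<^sub>R (q t - smoothing k q t)) (at t within {0..\<theta>})"
proof -
  have "continuous_on {0..\<theta>} (\<lambda>u. (k * exp (k * u)) *\<^sub>R q u)"
    by (intro continuous_intros q)
  then have I: "((\<lambda>t. integral {0..t} (\<lambda>u. (k * exp (k * u)) *\<^sub>R q u)) has_vector_derivative (k * exp (k * t)) *\<^sub>R q t) (at t within {0..\<theta>})"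
    by (rule integral_has_vector_derivative[OF _ t])
  have E: "((\<lambda>t. exp (- (k * t))) has_real_derivative - k * exp (- (k * t))) (at t within {0..\<theta>})"
    by (auto intro!: derivative_eq_intros)
  have "exp (- (k * t)) *\<^sub>R ((k * exp (k * t)) *\<^sub>R q t) = k *\<^sub>R q t"
    by (simp add: exp_minus)
  then have "exp (- (k * t)) *\<^sub>R ((k * exp (k * t)) *\<^sub>R q t) + (- k * exp (- (k * t))) *\<^sub>R integral {0..t} (\<lambda>u. (k * exp (k * u)) *\<^sub>R q u)
      = k *\<^sub>R (q t - smoothing k q t)"
    by (simp add: smoothing_def scaleR_diff_right)
  then show ?thesis
    using has_vector_derivative_scaleR[OF E I] by (simp add: smoothing_def[abs_def])
qed

lemma smoothing_0 [simp]: "smoothing k q 0 = 0"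
  by (simp add: smoothing_def)

text \<open>Smoothing does not increase the sup norm, so the factor \<open>1 / k\<close> and the
  Lipschitz constant \<open>k / 2\<close> of \<open>g\<close> give a contraction by one half. The
  ball of radius \<open>r\<close> is preserved: \<open>w\<close> takes one half of it and the
  integral term the other.\<close>

lemma block_fixed_point:
  fixes w :: "real \<Rightarrow> 'a::banach" and g :: "real \<Rightarrow> 'a \<Rightarrow> 'a"
  assumes \<theta>: "0 \<le> \<theta>" and k: "0 < k" and w: "continuous_on {0..\<theta>} w"
    and g: "\<And>z. continuous_on {0..\<theta>} z \<Longrightarrow> continuous_on {0..\<theta>} (\<lambda>u. g u (z u))"
    and lip: "\<And>u a b. u \<in> {0..\<theta>} \<Longrightarrow> norm a \<le> r \<Longrightarrow> norm b \<le> r \<Longrightarrow> norm (g u a - g u b) \<le> k / 2 * norm (a - b)"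
    and g0: "\<And>u. u \<in> {0..\<theta>} \<Longrightarrow> g u 0 = 0"
    and wr: "\<And>u. u \<in> {0..\<theta>} \<Longrightarrow> norm (w u) \<le> r / 2"
  obtains z where "continuous_on {0..\<theta>} z" "\<And>t. t \<in> {0..\<theta>} \<Longrightarrow> norm (z t) \<le> r"
    "\<And>t. t \<in> {0..\<theta>} \<Longrightarrow> z t = w t + smoothing k (\<lambda>u. (1 / k) *\<^sub>R g u (z u)) t"
proof -
  have r: "0 \<le> r"
    using wr[of 0] \<theta> norm_ge_zero[of "w 0"] by (simp del: norm_ge_zero)
  \<comment> \<open>Clamping to the block extends functions constantly to the whole line, so that
    Banach's theorem can be used in the complete space of bounded continuous functions on the
    reals.\<close>
  define c where "c t = max 0 (min \<theta> t)" for t :: real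
  have c: "c t \<in> {0..\<theta>}" for t
    using \<theta> by (auto simp: c_def)
  have c_id: "c t = t" if "t \<in> {0..\<theta>}" for t
    using that by (auto simp: c_def)
  have c_cont: "continuous_on UNIV c"
    unfolding c_def[abs_def] by (intro continuous_intros)
  define T where "T z t = w t + smoothing k (\<lambda>u. (1 / k) *\<^sub>R g u (z u)) t" for z t
  have gk: "continuous_on {0..\<theta>} (\<lambda>u. (1 / k) *\<^sub>R g u (z u))" if "continuous_on {0..\<theta>} z" for z
    by (intro continuous_intros g that)
  have T_cont: "continuous_on {0..\<theta>} (T z)" if "continuous_on {0..\<theta>} z" for z
    unfolding T_def[abs_def] by (intro continuous_intros w continuous_on_smoothing gk that)
  have T_lip: "norm (smoothing k (\<lambda>u. (1 / k) *\<^sub>R g u (x u)) t - smoothing k (\<lambda>u. (1 / k) *\<^sub>R g u (y u)) t) \<le> 1 / 2 * d"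
    if x: "continuous_on {0..\<theta>} x" "\<And>u. u \<in> {0..\<theta>} \<Longrightarrow> norm (x u) \<le> r"
      and y: "continuous_on {0..\<theta>} y" "\<And>u. u \<in> {0..\<theta>} \<Longrightarrow> norm (y u) \<le> r"
      and d: "\<And>u. u \<in> {0..\<theta>} \<Longrightarrow> norm (x u - y u) \<le> d" and t: "t \<in> {0..\<theta>}" for x y d t
  proof -
    have d0: "0 \<le> d"
      using d[OF t] norm_ge_zero order_trans by blast
    have "norm (smoothing k (\<lambda>u. (1 / k) *\<^sub>R g u (x u) - (1 / k) *\<^sub>R g u (y u)) t) \<le> (1 / 2 * d) * (1 - exp (- (k * t)))"
    proof (rule smoothing_bound[OF _ t])
      fix u assume u: "u \<in> {0..\<theta>}"
      have "norm ((1 / k) *\<^sub>R g u (x u) - (1 / k) *\<^sub>R g u (y u)) = (1 / k) * norm (g u (x u) - g u (y u))"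
        using k by (simp flip: scaleR_diff_right)
      also have "\<dots> \<le> (1 / k) * (k / 2 * d)"
      proof (rule mult_left_mono)
        have "norm (g u (x u) - g u (y u)) \<le> k / 2 * norm (x u - y u)"
          by (intro lip u x y)
        also have "\<dots> \<le> k / 2 * d"
          using d[OF u] k by (intro mult_left_mono) auto
        finally show "norm (g u (x u) - g u (y u)) \<le> k / 2 * d" .
      qed (use k in auto)
      finally show "norm ((1 / k) *\<^sub>R g u (x u) - (1 / k) *\<^sub>R g u (y u)) \<le> 1 / 2 * d"
        using k by simp
    qed (use k in \<open>auto intro!: continuous_on_diff gk x y\<close>)
    also have "\<dots> \<le> (1 / 2 * d) * 1"
      using d0 by (intro mult_left_mono) auto
    finally show ?thesis
      using smoothing_diff[OF gk[OF x(1)] gk[OF y(1)] t] by simp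
  qed
  have T_bound: "norm (T z t) \<le> r" if z: "continuous_on {0..\<theta>} z" "\<And>u. u \<in> {0..\<theta>} \<Longrightarrow> norm (z u) \<le> r" and t: "t \<in> {0..\<theta>}" for z t
  proof -
    have "norm (smoothing k (\<lambda>u. (1 / k) *\<^sub>R g u (z u)) t - smoothing k (\<lambda>u. (1 / k) *\<^sub>R g u ((\<lambda>_. 0) u)) t) \<le> 1 / 2 * r"
      using r z by (intro T_lip[OF z _ _ _ t]) auto
    moreover have "smoothing k (\<lambda>u. (1 / k) *\<^sub>R g u ((\<lambda>_. 0) u)) t = smoothing k (\<lambda>_. 0) t"
      by (rule smoothing_cong[OF _ t]) (simp add: g0)
    moreover have "smoothing k (\<lambda>_. 0 :: 'a) t = 0"
      by (simp add: smoothing_def)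
    ultimately show ?thesis
      using wr[OF t] norm_triangle_ineq[of "w t" "smoothing k (\<lambda>u. (1 / k) *\<^sub>R g u (z u)) t"]
      by (simp add: T_def)
  qed
  define S where "S = PiC UNIV (\<lambda>_::real. cball (0::'a) r)"
  have S: "z \<in> S \<longleftrightarrow> (\<forall>t. norm (apply_bcontfun z t) \<le> r)" for z
    by (auto simp: S_def mem_PiC_iff)
  define F where "F z = Bcontfun (\<lambda>t. T (apply_bcontfun z) (c t))" for z
  have F: "apply_bcontfun (F z) t = T (apply_bcontfun z) (c t)" if "z \<in> S" for z t
  proof -
    have "(\<lambda>t. T (apply_bcontfun z) (c t)) \<in> bcontfun"
    proof (rule bcontfun_normI)
      show "continuous_on UNIV (\<lambda>t. T (apply_bcontfun z) (c t))"
        by (rule continuous_on_compose2[OF T_cont c_cont]) (use c in auto)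
      show "norm (T (apply_bcontfun z) (c t)) \<le> r" for t
        using that by (intro T_bound c) (auto simp: S)
    qed
    then show ?thesis
      by (simp add: F_def Bcontfun_inverse)
  qed
  have "\<exists>!z\<in>S. F z = z"
  proof (rule Banach_fix[where c = "1 / 2"])
    show "complete S"
      unfolding complete_eq_closed S_def by (intro closed_PiC) auto
    show "S \<noteq> {}"
    proof -
      have "const_bcontfun 0 \<in> S"
        using r by (simp add: S const_bcontfun.rep_eq)
      then show ?thesis
        by blast
    qed
    show "F ` S \<subseteq> S"
    proof
      fix x assume "x \<in> F ` S"
      then obtain z where z: "z \<in> S" "x = F z"
        by blast
      have "norm (T (apply_bcontfun z) (c t)) \<le> r" for t
        using z(1) by (intro T_bound c) (auto simp: S)
      then show "x \<in> S"
        unfolding z(2) S by (simp add: F[OF z(1)])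
    qed
    show "dist (F x) (F y) \<le> 1 / 2 * dist x y" if "x \<in> S" "y \<in> S" for x y
    proof (rule dist_bound)
      fix t
      have "norm (smoothing k (\<lambda>u. (1 / k) *\<^sub>R g u (apply_bcontfun x u)) (c t) - smoothing k (\<lambda>u. (1 / k) *\<^sub>R g u (apply_bcontfun y u)) (c t)) \<le> 1 / 2 * dist x y"
        using that by (intro T_lip c) (auto simp: S dist_norm[symmetric] dist_bounded)
      then show "dist (apply_bcontfun (F x) t) (apply_bcontfun (F y) t) \<le> 1 / 2 * dist x y"
        by (simp add: F[OF that(1)] F[OF that(2)] T_def dist_norm)
    qed
  qed auto
  then obtain z where z: "z \<in> S" "F z = z"
    by blast
  show thesis
  proof (rule that[of "apply_bcontfun z"])
    show "norm (apply_bcontfun z t) \<le> r" for t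
      using z(1) S by blast
    show "apply_bcontfun z t = w t + smoothing k (\<lambda>u. (1 / k) *\<^sub>R g u (apply_bcontfun z u)) t" if "t \<in> {0..\<theta>}" for t
      using F[OF z(1), of t] z(2) c_id[OF that] by (simp add: T_def)
  qed simp
qed

section \<open>Block steps in frame coordinates and their linear approximation\<close>

context relative_periodic_orbit
begin

definition block_step :: "real \<Rightarrow> (real \<Rightarrow> real^'n) \<Rightarrow> (real \<Rightarrow> real^'n) \<Rightarrow> bool" where
  "block_step b v w \<longleftrightarrow> continuous_on {0..\<theta>} w \<and> w 0 = matrix_inv h *v v \<theta> \<and>
     (\<forall>t\<in>{0..\<theta>}. (w has_vector_derivative f (w t) + b *\<^sub>R (w t - v t)) (at t within {0..\<theta>}))"

definition bounded_block :: "real \<Rightarrow> (real \<Rightarrow> real^'n) \<Rightarrow> bool" where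
  "bounded_block \<eta> z \<longleftrightarrow> continuous_on {0..\<theta>} z \<and> (\<forall>t\<in>{0..\<theta>}. norm (z t) \<le> \<eta>)"

lemma block_step_cong:
  assumes "block_step b v w" "0 \<le> \<theta>" "\<And>t. t \<in> {0..\<theta>} \<Longrightarrow> v t = v' t" "\<And>t. t \<in> {0..\<theta>} \<Longrightarrow> w t = w' t"
  shows "block_step b v' w'"
  unfolding block_step_def
proof (intro conjI ballI)
  show "continuous_on {0..\<theta>} w'"
    using assms by (metis block_step_def continuous_on_cong)
  show "w' 0 = matrix_inv h *v v' \<theta>"
    using assms(1,2) assms(3)[of \<theta>] assms(4)[of 0] by (simp add: block_step_def)
  fix t assume t: "t \<in> {0..\<theta>}"
  then have "(w has_vector_derivative f (w t) + b *\<^sub>R (w t - v t)) (at t within {0..\<theta>})"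
    using assms(1) by (simp add: block_step_def)
  then show "(w' has_vector_derivative f (w' t) + b *\<^sub>R (w' t - v' t)) (at t within {0..\<theta>})"
    unfolding assms(3)[OF t] assms(4)[OF t]
    by (rule has_vector_derivative_transform[OF t, rotated]) (simp add: assms(4))
qed

text \<open>Differentiating \<open>Y z\<close> produces the linear term
  \<open>f' (xs) (Y z)\<close>, which cancels the one subtracted in \<open>rest\<close>; the
  coupling keeps its form because \<open>Y (t + \<phi>)\<close> multiplies \<open>y\<close> and
  \<open>z\<close> alike. The initial condition is the shift identity for the orbit and for
  \<open>Y\<close>.\<close>

lemma lift_block_step:
  assumes \<theta>: "0 \<le> \<theta>" and k: "0 < k" and y: "continuous_on {0..\<theta>} y" and z: "continuous_on {0..\<theta>} z"
    and eq: "\<And>t. t \<in> {0..\<theta>} \<Longrightarrow> z t = block_map k \<theta> ((*v) B) y t + smoothing k (\<lambda>u. (1 / k) *\<^sub>R rest \<phi> u (z u)) t"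
  shows "block_step (- k) (lift \<phi> y) (lift \<phi> z)"
  unfolding block_step_def
proof (intro conjI ballI)
  show "continuous_on {0..\<theta>} (lift \<phi> z)"
    by (rule continuous_on_lift[OF z])
  have z0: "z 0 = B *v y \<theta>"
    using eq[of 0] \<theta> by (simp add: block_map_def)
  show "lift \<phi> z 0 = matrix_inv h *v lift \<phi> y \<theta>"
    using xs_shift[of \<phi>] Y_shift[of \<phi> "y \<theta>"]
    by (simp add: lift_def z0 matrix_vector_right_distrib add.commute[of \<theta>] flip: xs_shift)
  fix t assume t: "t \<in> {0..\<theta>}"
  have r: "continuous_on {0..\<theta>} (\<lambda>u. (1 / k) *\<^sub>R rest \<phi> u (z u))"
    by (intro continuous_intros continuous_on_rest z)
  have E: "((\<lambda>t. exp (- (k * t)) *\<^sub>R (B *v y \<theta>)) has_vector_derivative (- k * exp (- (k * t))) *\<^sub>R (B *v y \<theta>)) (at t within {0..\<theta>})"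
    by (auto intro!: derivative_eq_intros simp: has_real_derivative_iff_has_vector_derivative[symmetric])
  have "((\<lambda>t. block_map k \<theta> ((*v) B) y t + smoothing k (\<lambda>u. (1 / k) *\<^sub>R rest \<phi> u (z u)) t) has_vector_derivative
      ((- k * exp (- (k * t))) *\<^sub>R (B *v y \<theta>) + k *\<^sub>R (y t - smoothing k y t)) +
      k *\<^sub>R ((1 / k) *\<^sub>R rest \<phi> t (z t) - smoothing k (\<lambda>u. (1 / k) *\<^sub>R rest \<phi> u (z u)) t)) (at t within {0..\<theta>})"
    unfolding block_map_def
    by (intro has_vector_derivative_add E smoothing_has_vector_derivative y r t)
  then have "(z has_vector_derivative
      ((- k * exp (- (k * t))) *\<^sub>R (B *v y \<theta>) + k *\<^sub>R (y t - smoothing k y t)) +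
      k *\<^sub>R ((1 / k) *\<^sub>R rest \<phi> t (z t) - smoothing k (\<lambda>u. (1 / k) *\<^sub>R rest \<phi> u (z u)) t)) (at t within {0..\<theta>})"
    by (rule has_vector_derivative_transform[OF t, rotated]) (rule eq)
  also have "((- k * exp (- (k * t))) *\<^sub>R (B *v y \<theta>) + k *\<^sub>R (y t - smoothing k y t)) +
      k *\<^sub>R ((1 / k) *\<^sub>R rest \<phi> t (z t) - smoothing k (\<lambda>u. (1 / k) *\<^sub>R rest \<phi> u (z u)) t) = k *\<^sub>R (y t - z t) + rest \<phi> t (z t)"
    using k by (subst (2) eq[OF t]) (simp add: block_map_def algebra_simps)
  finally have z': "(z has_vector_derivative k *\<^sub>R (y t - z t) + rest \<phi> t (z t)) (at t within {0..\<theta>})" .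
  have Y': "((\<lambda>t. Y (t + \<phi>)) has_vector_derivative matrix (blinfun_apply (f' (xs (t + \<phi>)))) ** Y (t + \<phi>)) (at t within {0..\<theta>})"
    by (rule has_vector_derivative_at_within[OF shift_derivative[OF Y_ode]])
  have "(lift \<phi> z has_vector_derivative f (xs (t + \<phi>)) +
      (Y (t + \<phi>) *v (k *\<^sub>R (y t - z t) + rest \<phi> t (z t)) + (matrix (blinfun_apply (f' (xs (t + \<phi>)))) ** Y (t + \<phi>)) *v z t)) (at t within {0..\<theta>})"
    unfolding lift_def[abs_def]
    by (intro has_vector_derivative_add has_vector_derivative_at_within[OF shift_derivative[OF xs_ode]]
        bounded_bilinear.has_vector_derivative[OF bounded_bilinear_matrix_vector_mult Y' z'])
  also have "(matrix (blinfun_apply (f' (xs (t + \<phi>)))) ** Y (t + \<phi>)) *v z t = f' (xs (t + \<phi>)) (Y (t + \<phi>) *v z t)"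
    by (simp add: matrix_works bounded_linear.linear[OF blinfun.bounded_linear_right] flip: matrix_vector_mul_assoc)
  also have "f (xs (t + \<phi>)) + (Y (t + \<phi>) *v (k *\<^sub>R (y t - z t) + rest \<phi> t (z t)) + f' (xs (t + \<phi>)) (Y (t + \<phi>) *v z t))
      = f (lift \<phi> z t) + (- k) *\<^sub>R (lift \<phi> z t - lift \<phi> y t)"
  proof -
    have "Y (t + \<phi>) *v rest \<phi> t (z t) = f (lift \<phi> z t) - f' (xs (t + \<phi>)) (Y (t + \<phi>) *v z t) - f (xs (t + \<phi>))"
      by (simp add: rest_def lift_def)
    moreover have "Y (t + \<phi>) *v (k *\<^sub>R (y t - z t)) = (- k) *\<^sub>R (lift \<phi> z t - lift \<phi> y t)"
      by (simp add: lift_def matrix_vector_mult_scaleR matrix_vector_mult_diff_distrib algebra_simps)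
    ultimately show ?thesis
      by (simp add: matrix_vector_right_distrib)
  qed
  finally show "(lift \<phi> z has_vector_derivative f (lift \<phi> z t) + (- k) *\<^sub>R (lift \<phi> z t - lift \<phi> y t)) (at t within {0..\<theta>})" .
qed

lemma B_bound: obtains K where "K \<ge> 0" "\<And>x. norm (B *v x) \<le> K * norm x"
  using bounded_linear.nonneg_bounded[OF matrix_vector_mul_bounded_linear[of B]] by (metis mult.commute)

lemma one_step:
  assumes \<theta>: "0 \<le> \<theta>" and k: "0 < k"
  shows "\<exists>K\<ge>1. \<exists>C\<ge>0. \<exists>\<eta>0>0. \<forall>\<phi> y \<eta>. \<bar>\<phi>\<bar> \<le> 1 \<longrightarrow> \<eta> \<le> \<eta>0 \<longrightarrow> bounded_block \<eta> y \<longrightarrow>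
    (\<exists>z. bounded_block (K * \<eta>) z \<and> block_step (- k) (lift \<phi> y) (lift \<phi> z) \<and>
      (\<forall>t\<in>{0..\<theta>}. norm (z t - block_map k \<theta> ((*v) B) y t) \<le> C * \<eta>\<^sup>2))"
proof -
  obtain KB where KB: "KB \<ge> 0" "\<And>x. norm (B *v x) \<le> KB * norm x"
    using B_bound by blast
  obtain C r0 where C: "C \<ge> 0" "r0 > 0"
    "\<And>\<phi> t r z w. \<bar>\<phi>\<bar> \<le> 1 \<Longrightarrow> t \<in> {0..\<theta>} \<Longrightarrow> r \<le> r0 \<Longrightarrow> norm z \<le> r \<Longrightarrow> norm w \<le> r \<Longrightarrow>
      norm (rest \<phi> t z - rest \<phi> t w) \<le> C * r * norm (z - w)"
    using rest_lipschitz by metis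
  \<comment> \<open>Twice the bound of the linear block map, so that its output fills at most half
    of the ball of radius \<open>K * \<eta>\<close>, as the fixed point argument requires.\<close>
  define K where "K = 2 * (KB + 1)"
  \<comment> \<open>The first bound keeps the radius within the range of the remainder estimate, the
    second makes its Lipschitz constant at most \<open>k / 2\<close>.\<close>
  define \<eta>0 where "\<eta>0 = min (r0 / K) (k / (2 * K * (C + 1)))"
  have K: "K \<ge> 1" "K > 0"
    using KB by (auto simp: K_def)
  have pos: "1 \<le> K" "0 \<le> C * K\<^sup>2 / k" "0 < \<eta>0"
    using K C k by (auto simp: \<eta>0_def)
  show ?thesis
  proof (rule exI[of _ K], rule conjI, rule pos(1), rule exI[of _ "C * K\<^sup>2 / k"], rule conjI, rule pos(2),
      rule exI[of _ \<eta>0], rule conjI, rule pos(3), intro allI impI)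
    fix \<phi> \<eta> :: real and y :: "real \<Rightarrow> real^'n"
    assume \<phi>: "\<bar>\<phi>\<bar> \<le> 1" and \<eta>: "\<eta> \<le> \<eta>0" and "bounded_block \<eta> y"
    then have y: "continuous_on {0..\<theta>} y" "\<And>t. t \<in> {0..\<theta>} \<Longrightarrow> norm (y t) \<le> \<eta>"
      by (auto simp: bounded_block_def)
    have \<eta>nn: "0 \<le> \<eta>"
      using y(2)[of 0] \<theta> norm_ge_zero[of "y 0"] by (auto simp del: norm_ge_zero)
    define r where "r = K * \<eta>"
    have r: "r \<le> r0" "0 \<le> r"
      using \<eta> K \<eta>nn by (auto simp: \<eta>0_def r_def field_simps)
    have Cr: "C * r \<le> k / 2"
    proof -
      have "\<eta> \<le> k / (2 * K * (C + 1))"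
        using \<eta> by (simp add: \<eta>0_def)
      then have "\<eta> * (2 * K * (C + 1)) \<le> k"
        using K C(1) by (subst (asm) pos_le_divide_eq) auto
      then have "(C + 1) * r \<le> k / 2"
        by (simp add: r_def algebra_simps)
      then show ?thesis
        using r(2) by (simp add: algebra_simps)
    qed
    let ?w = "block_map k \<theta> ((*v) B) y"
    have w: "norm (?w t) \<le> r / 2" if "t \<in> {0..\<theta>}" for t
    proof -
      have "norm (?w t) \<le> (KB + 1) * \<eta>"
        using k by (intro block_map_bound[OF y(1) that _ y(2) KB(2) KB(1)]) auto
      then show ?thesis
        by (simp add: r_def K_def algebra_simps)
    qed
    obtain z where z: "continuous_on {0..\<theta>} z" "\<And>t. t \<in> {0..\<theta>} \<Longrightarrow> norm (z t) \<le> r"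
      "\<And>t. t \<in> {0..\<theta>} \<Longrightarrow> z t = ?w t + smoothing k (\<lambda>u. (1 / k) *\<^sub>R rest \<phi> u (z u)) t"
    proof (rule block_fixed_point[OF \<theta> k continuous_on_block_map[OF y(1)] continuous_on_rest _ _ w])
      fix u :: real and a b :: "real^'n"
      assume "u \<in> {0..\<theta>}" "norm a \<le> r" "norm b \<le> r"
      then have "norm (rest \<phi> u a - rest \<phi> u b) \<le> C * r * norm (a - b)"
        by (intro C(3) \<phi> r)
      also have "\<dots> \<le> k / 2 * norm (a - b)"
        by (intro mult_right_mono Cr) auto
      finally show "norm (rest \<phi> u a - rest \<phi> u b) \<le> k / 2 * norm (a - b)" .
    qed auto
    have "norm (z t - ?w t) \<le> C * K\<^sup>2 / k * \<eta>\<^sup>2" if t: "t \<in> {0..\<theta>}" for t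
    proof -
      have "norm (smoothing k (\<lambda>u. (1 / k) *\<^sub>R rest \<phi> u (z u)) t) \<le> (C * r\<^sup>2 / k) * (1 - exp (- (k * t)))"
      proof (rule smoothing_bound[OF _ t])
        fix u assume u: "u \<in> {0..\<theta>}"
        have "norm (rest \<phi> u (z u) - rest \<phi> u 0) \<le> C * r * norm (z u - 0)"
          using r(2) by (intro C(3) \<phi> r u z(2)) auto
        also have "\<dots> \<le> C * r * r"
          using z(2)[OF u] C(1) r(2) by (intro mult_left_mono) auto
        finally show "norm ((1 / k) *\<^sub>R rest \<phi> u (z u)) \<le> C * r\<^sup>2 / k"
          using k by (simp add: power2_eq_square divide_right_mono)
      qed (use k in \<open>auto intro!: continuous_intros continuous_on_rest z\<close>)
      also have "\<dots> \<le> (C * r\<^sup>2 / k) * 1"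
        using C(1) k by (intro mult_left_mono) auto
      finally show ?thesis
        using z(3)[OF t] by (simp add: r_def power_mult_distrib mult_ac)
    qed
    then show "\<exists>z. bounded_block (K * \<eta>) z \<and> block_step (- k) (lift \<phi> y) (lift \<phi> z) \<and>
      (\<forall>t\<in>{0..\<theta>}. norm (z t - ?w t) \<le> C * K\<^sup>2 / k * \<eta>\<^sup>2)"
      using z(2) by (intro exI[of _ z] conjI ballI lift_block_step[OF \<theta> k y(1) z(1,3)])
        (auto simp: bounded_block_def z(1) r_def)
  qed
qed

text \<open>For a fixed number \<open>m\<close> of blocks the error stays quadratic: the old error
  is carried on by the bounded linear block map, and the new one is quadratic in a block of size
  \<open>K * \<eta>\<close>. The constants may grow with \<open>m\<close>, which is harmless since
  \<open>m\<close> is fixed before \<open>\<eta>0\<close>.\<close>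

lemma many_steps:
  assumes \<theta>: "0 \<le> \<theta>" and k: "0 < k"
  shows "\<exists>K\<ge>1. \<exists>C\<ge>0. \<exists>\<eta>0>0. \<forall>\<phi> y \<eta>. \<bar>\<phi>\<bar> \<le> 1 \<longrightarrow> \<eta> \<le> \<eta>0 \<longrightarrow> bounded_block \<eta> y \<longrightarrow>
    (\<exists>zs. zs 0 = y \<and> (\<forall>i\<le>m. bounded_block (K * \<eta>) (zs i)) \<and>
      (\<forall>i<m. block_step (- k) (lift \<phi> (zs i)) (lift \<phi> (zs (Suc i)))) \<and>
      (\<forall>t\<in>{0..\<theta>}. norm (zs m t - (block_map k \<theta> ((*v) B) ^^ m) y t) \<le> C * \<eta>\<^sup>2))"
proof (induction m)
  case 0
  show ?case
    by (rule exI[of _ 1], simp, rule exI[of _ 0], simp, rule exI[of _ 1], auto intro: exI[of _ "\<lambda>_. _"])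
next
  case (Suc m)
  obtain K C \<eta>0 where IH: "K \<ge> 1" "C \<ge> 0" "\<eta>0 > 0"
    "\<And>\<phi> y \<eta>. \<bar>\<phi>\<bar> \<le> 1 \<Longrightarrow> \<eta> \<le> \<eta>0 \<Longrightarrow> bounded_block \<eta> y \<Longrightarrow>
    (\<exists>zs. zs 0 = y \<and> (\<forall>i\<le>m. bounded_block (K * \<eta>) (zs i)) \<and>
      (\<forall>i<m. block_step (- k) (lift \<phi> (zs i)) (lift \<phi> (zs (Suc i)))) \<and>
      (\<forall>t\<in>{0..\<theta>}. norm (zs m t - (block_map k \<theta> ((*v) B) ^^ m) y t) \<le> C * \<eta>\<^sup>2))"
    using Suc by blast
  obtain K1 C1 \<eta>1 where S: "K1 \<ge> 1" "C1 \<ge> 0" "\<eta>1 > 0"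
    "\<And>\<phi> y \<eta>. \<bar>\<phi>\<bar> \<le> 1 \<Longrightarrow> \<eta> \<le> \<eta>1 \<Longrightarrow> bounded_block \<eta> y \<Longrightarrow>
    (\<exists>z. bounded_block (K1 * \<eta>) z \<and> block_step (- k) (lift \<phi> y) (lift \<phi> z) \<and>
      (\<forall>t\<in>{0..\<theta>}. norm (z t - block_map k \<theta> ((*v) B) y t) \<le> C1 * \<eta>\<^sup>2))"
    using one_step[OF \<theta> k] by blast
  obtain KB where KB: "KB \<ge> 0" "\<And>x. norm (B *v x) \<le> KB * norm x"
    using B_bound by blast
  let ?C = "C1 * K\<^sup>2 + (KB + 1) * C"
  have pos: "1 \<le> K1 * K" "0 \<le> ?C" "0 < min \<eta>0 (\<eta>1 / K)"
    using mult_mono[of 1 K1 1 K] IH(1-3) S(1-3) KB by auto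
  show ?case
  proof (rule exI[of _ "K1 * K"], rule conjI, rule pos(1), rule exI[of _ ?C], rule conjI, rule pos(2),
      rule exI[of _ "min \<eta>0 (\<eta>1 / K)"], rule conjI, rule pos(3), intro allI impI)
    fix \<phi> \<eta> :: real and y :: "real \<Rightarrow> real^'n"
    assume \<phi>: "\<bar>\<phi>\<bar> \<le> 1" and \<eta>: "\<eta> \<le> min \<eta>0 (\<eta>1 / K)" and y: "bounded_block \<eta> y"
    have \<eta>nn: "0 \<le> \<eta>"
      using y \<theta> norm_ge_zero[of "y 0"] unfolding bounded_block_def by (metis atLeastAtMost_iff order.refl order.trans)
    obtain zs where zs: "zs 0 = y" "\<And>i. i \<le> m \<Longrightarrow> bounded_block (K * \<eta>) (zs i)"
      "\<And>i. i < m \<Longrightarrow> block_step (- k) (lift \<phi> (zs i)) (lift \<phi> (zs (Suc i)))"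
      "\<And>t. t \<in> {0..\<theta>} \<Longrightarrow> norm (zs m t - (block_map k \<theta> ((*v) B) ^^ m) y t) \<le> C * \<eta>\<^sup>2"
      using IH(4)[OF \<phi> _ y] \<eta> by (metis min.boundedE)
    have "K * \<eta> \<le> \<eta>1"
      using \<eta> IH(1) by (simp add: field_simps)
    then obtain z where z: "bounded_block (K1 * (K * \<eta>)) z" "block_step (- k) (lift \<phi> (zs m)) (lift \<phi> z)"
      "\<And>t. t \<in> {0..\<theta>} \<Longrightarrow> norm (z t - block_map k \<theta> ((*v) B) (zs m) t) \<le> C1 * (K * \<eta>)\<^sup>2"
      using S(4)[OF \<phi> _ zs(2)[OF order.refl]] by blast
    define zs' where "zs' i = (if i \<le> m then zs i else z)" for i
    have "norm (z t - (block_map k \<theta> ((*v) B) ^^ Suc m) y t) \<le> ?C * \<eta>\<^sup>2" if t: "t \<in> {0..\<theta>}" for t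
    proof -
      let ?Wy = "(block_map k \<theta> ((*v) B) ^^ m) y"
      have cy: "continuous_on {0..\<theta>} ?Wy" and cz: "continuous_on {0..\<theta>} (zs m)"
        using y zs(2)[of m] by (auto simp: bounded_block_def continuous_on_block_map_iter)
      have "norm (block_map k \<theta> ((*v) B) (\<lambda>u. zs m u - ?Wy u) t) \<le> (KB + 1) * (C * \<eta>\<^sup>2)"
        using k by (intro block_map_bound[OF continuous_on_diff[OF cz cy] t _ zs(4) KB(2) KB(1)]) auto
      then have "norm (block_map k \<theta> ((*v) B) (zs m) t - block_map k \<theta> ((*v) B) ?Wy t) \<le> (KB + 1) * (C * \<eta>\<^sup>2)"
        by (simp add: block_map_diff[OF cz cy t])
      moreover have "norm (z t - block_map k \<theta> ((*v) B) (zs m) t) \<le> C1 * (K * \<eta>)\<^sup>2"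
        by (rule z(3)[OF t])
      moreover have "norm (z t - block_map k \<theta> ((*v) B) ?Wy t) \<le> norm (z t - block_map k \<theta> ((*v) B) (zs m) t) +
          norm (block_map k \<theta> ((*v) B) (zs m) t - block_map k \<theta> ((*v) B) ?Wy t)"
        using norm_triangle_ineq[of "z t - block_map k \<theta> ((*v) B) (zs m) t"
            "block_map k \<theta> ((*v) B) (zs m) t - block_map k \<theta> ((*v) B) ?Wy t"] by simp
      moreover have "?C * \<eta>\<^sup>2 = C1 * (K * \<eta>)\<^sup>2 + (KB + 1) * (C * \<eta>\<^sup>2)"
        by (simp add: algebra_simps power_mult_distrib)
      ultimately show ?thesis
        by simp
    qed
    moreover have "bounded_block (K1 * K * \<eta>) (zs' i)" if "i \<le> Suc m" for i
    proof (cases "i \<le> m")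
      case True
      have "K * \<eta> \<le> K1 * K * \<eta>"
        using mult_right_mono[OF S(1), of "K * \<eta>"] \<eta>nn IH(1) by (simp add: mult.assoc)
      then show ?thesis
        using zs(2)[OF True] True by (auto simp: bounded_block_def zs'_def intro: order.trans)
    next
      case False
      then show ?thesis
        using z(1) by (simp add: zs'_def mult.assoc)
    qed
    moreover have "block_step (- k) (lift \<phi> (zs' i)) (lift \<phi> (zs' (Suc i)))" if "i < Suc m" for i
      using that zs(3)[of i] z(2) by (auto simp: zs'_def less_Suc_eq)
    moreover have "zs' 0 = y"
      by (simp add: zs'_def zs(1))
    ultimately show "\<exists>zs. zs 0 = y \<and> (\<forall>i\<le>Suc m. bounded_block (K1 * K * \<eta>) (zs i)) \<and>
      (\<forall>i<Suc m. block_step (- k) (lift \<phi> (zs i)) (lift \<phi> (zs (Suc i)))) \<and>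
      (\<forall>t\<in>{0..\<theta>}. norm (zs (Suc m) t - (block_map k \<theta> ((*v) B) ^^ Suc m) y t) \<le> ?C * \<eta>\<^sup>2)"
      by (intro exI[of _ zs'] conjI allI impI ballI) (auto simp: zs'_def)
  qed
qed

end


section \<open>Phase readjustment and the infinite sequence of blocks\<close>

context relative_periodic_orbit
begin

text \<open>After \<open>m\<close> blocks the deviation is a multiple \<open>c\<close> of the
  velocity plus a small error. Since \<open>Y\<close> maps the velocity at 0 to the velocity along
  the orbit, the multiple is, up to order \<open>\<eta>\<^sup>2\<close>, a shift of phase by
  \<open>c\<close>. Reading the same block around phase \<open>\<phi> + c\<close> leaves the small
  error and quadratic terms.\<close>

lemma rephased_contraction:
  assumes \<theta>: "0 < \<theta>" and k: "0 < k" and conv: "block_map_limit k \<theta> B l (f (xs 0)) v"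
  shows "\<exists>m\<ge>1. \<exists>K\<ge>1. \<exists>\<eta>0>0. \<forall>\<phi> y \<eta>. \<bar>\<phi>\<bar> \<le> 1 / 2 \<longrightarrow> \<eta> \<le> \<eta>0 \<longrightarrow> bounded_block \<eta> y \<longrightarrow>
    (\<exists>zs \<phi>' z'. zs 0 = y \<and> (\<forall>i\<le>m. bounded_block (K * \<eta>) (zs i)) \<and>
      (\<forall>i<m. block_step (- k) (lift \<phi> (zs i)) (lift \<phi> (zs (Suc i)))) \<and>
      \<bar>\<phi>' - \<phi>\<bar> \<le> K * \<eta> \<and> bounded_block (\<eta> / 2) z' \<and>
      (\<forall>t\<in>{0..\<theta>}. lift \<phi> (zs m) t = lift \<phi>' z' t))"
proof -
  have "\<forall>\<^sub>F n in sequentially. v n < 1 / 8"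
    using conv unfolding block_map_limit_def by (intro order_tendstoD) auto
  \<comment> \<open>The linear error takes 1/8 and the quadratic terms will take 1/4, which stays
    below 1/2. Positivity of \<open>m\<close> is used when blocks are indexed by quotient and
    remainder modulo \<open>m\<close>.\<close>
  then obtain m where m: "1 \<le> m" "v m \<le> 1 / 8"
    unfolding eventually_sequentially by (metis le_cases less_imp_le)
  let ?W = "block_map k \<theta> ((*v) B) ^^ m"
  obtain Km Cm \<eta>m where M: "Km \<ge> 1" "Cm \<ge> 0" "\<eta>m > 0"
    "\<And>\<phi> y \<eta>. \<bar>\<phi>\<bar> \<le> 1 \<Longrightarrow> \<eta> \<le> \<eta>m \<Longrightarrow> bounded_block \<eta> y \<Longrightarrow>
    (\<exists>zs. zs 0 = y \<and> (\<forall>i\<le>m. bounded_block (Km * \<eta>) (zs i)) \<and>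
      (\<forall>i<m. block_step (- k) (lift \<phi> (zs i)) (lift \<phi> (zs (Suc i)))) \<and>
      (\<forall>t\<in>{0..\<theta>}. norm (zs m t - ?W y t) \<le> Cm * \<eta>\<^sup>2))"
    using many_steps[OF less_imp_le[OF \<theta>] k, of m] by blast
  obtain K where K: "K \<ge> 1"
    "\<And>t v. t \<in> {-1..\<theta> + 1} \<Longrightarrow> norm (Yi t *v v) \<le> K * norm v"
    "\<And>s t. s \<in> {-1..\<theta> + 1} \<Longrightarrow> t \<in> {-1..\<theta> + 1} \<Longrightarrow> norm (xs t - xs s - (t - s) *\<^sub>R f (xs s)) \<le> K * \<bar>t - s\<bar>\<^sup>2"
    "\<And>s t v. s \<in> {-1..\<theta> + 1} \<Longrightarrow> t \<in> {-1..\<theta> + 1} \<Longrightarrow> norm (Y t *v v - Y s *v v) \<le> K * \<bar>t - s\<bar> * norm v"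
    using frame_bounds by metis
  define Kc where "Kc = norm l * (Km + Cm)"
  \<comment> \<open>All quadratic contributions: the Taylor error of the orbit, the deviation of the
    nonlinear iterate from the linear one, and the change of frame from the old to the new
    phase.\<close>
  define D where "D = K\<^sup>2 * Kc\<^sup>2 + Cm + K\<^sup>2 * Kc * (1 + Cm)"
  \<comment> \<open>Beyond \<open>\<eta>m\<close>, the bounds give in turn
    \<open>\<eta>\<^sup>2 \<le> \<eta>\<close>, a phase change of at most 1/2 (so the new phase
    stays in the window) and \<open>D * \<eta> \<le> 1 / 4\<close>.\<close>
  define \<eta>0 where "\<eta>0 = min \<eta>m (min 1 (min (1 / (2 * (Kc + 1))) (1 / (4 * (D + 1)))))"
  have Kc: "0 \<le> Kc"
    using M by (simp add: Kc_def)
  have D: "0 \<le> D"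
    using M Kc by (simp add: D_def)
  have pos: "1 \<le> Km + Kc" "0 < \<eta>0"
    using M Kc D by (auto simp: \<eta>0_def)
  show ?thesis
  proof (rule exI[of _ m], rule conjI, rule m(1), rule exI[of _ "Km + Kc"], rule conjI, rule pos(1),
      rule exI[of _ \<eta>0], rule conjI, rule pos(2), intro allI impI)
    fix \<phi> \<eta> :: real and y :: "real \<Rightarrow> real^'n"
    assume \<phi>: "\<bar>\<phi>\<bar> \<le> 1 / 2" and \<eta>: "\<eta> \<le> \<eta>0" and y: "bounded_block \<eta> y"
    have ycont: "continuous_on {0..\<theta>} y" and yb: "\<And>t. t \<in> {0..\<theta>} \<Longrightarrow> norm (y t) \<le> \<eta>"
      using y by (auto simp: bounded_block_def)
    have \<eta>nn: "0 \<le> \<eta>"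
      using yb[of 0] \<theta> norm_ge_zero[of "y 0"] by (auto simp del: norm_ge_zero)
    have \<eta>1: "\<eta> \<le> 1" "\<eta> \<le> \<eta>m"
      using \<eta> by (auto simp: \<eta>0_def)
    have \<eta>Kc: "Kc * \<eta> \<le> 1 / 2"
    proof -
      have "\<eta> \<le> 1 / (2 * (Kc + 1))"
        using \<eta> by (simp add: \<eta>0_def)
      then have "\<eta> * (2 * (Kc + 1)) \<le> 1"
        using Kc by (subst (asm) pos_le_divide_eq) auto
      then show ?thesis
        using \<eta>nn by (simp add: algebra_simps)
    qed
    have \<eta>D: "D * \<eta> \<le> 1 / 4"
    proof -
      have "\<eta> \<le> 1 / (4 * (D + 1))"
        using \<eta> by (simp add: \<eta>0_def)
      then have "\<eta> * (4 * (D + 1)) \<le> 1"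
        using D by (subst (asm) pos_le_divide_eq) auto
      then show ?thesis
        using \<eta>nn by (simp add: algebra_simps)
    qed
    have \<eta>sq: "\<eta>\<^sup>2 \<le> \<eta>"
      using \<eta>nn \<eta>1 by (simp add: power2_eq_square mult_left_le)
    obtain zs where zs: "zs 0 = y" "\<And>i. i \<le> m \<Longrightarrow> bounded_block (Km * \<eta>) (zs i)"
      "\<And>i. i < m \<Longrightarrow> block_step (- k) (lift \<phi> (zs i)) (lift \<phi> (zs (Suc i)))"
      "\<And>t. t \<in> {0..\<theta>} \<Longrightarrow> norm (zs m t - ?W y t) \<le> Cm * \<eta>\<^sup>2"
      using M(4)[of \<phi> \<eta> y] \<phi> \<eta>1(2) y by auto
    define c where "c = l \<bullet> ?W y \<theta>"
    define \<phi>' where "\<phi>' = \<phi> + c"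
    have c: "\<bar>c\<bar> \<le> Kc * \<eta>"
    proof -
      have "norm (?W y \<theta>) \<le> norm (zs m \<theta>) + norm (zs m \<theta> - ?W y \<theta>)"
        using norm_triangle_ineq4[of "zs m \<theta>" "zs m \<theta> - ?W y \<theta>"] by simp
      also have "\<dots> \<le> Km * \<eta> + Cm * \<eta>\<^sup>2"
        using zs(2)[of m] zs(4)[of \<theta>] \<theta> by (intro add_mono) (auto simp: bounded_block_def)
      also have "\<dots> \<le> (Km + Cm) * \<eta>"
        using mult_left_mono[OF \<eta>sq M(2)] by (simp add: distrib_right)
      finally have "norm l * norm (?W y \<theta>) \<le> norm l * ((Km + Cm) * \<eta>)"
        by (intro mult_left_mono) auto
      then show ?thesis
        using Cauchy_Schwarz_ineq2[of l "?W y \<theta>"] by (simp add: c_def Kc_def mult.assoc)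
    qed
    have \<phi>': "\<bar>\<phi>'\<bar> \<le> 1" "\<bar>\<phi>' - \<phi>\<bar> \<le> Kc * \<eta>"
      using \<phi> c \<eta>Kc by (auto simp: \<phi>'_def)
    \<comment> \<open>An exact change of coordinates: the lift of \<open>z'\<close> at the new phase
      is the same function as the lift of \<open>zs m\<close> at the old one, so no approximation
      enters the trajectory.\<close>
    define z' where "z' t = Yi (t + \<phi>') *v (lift \<phi> (zs m) t - xs (t + \<phi>'))" for t
    have cont_zs: "continuous_on {0..\<theta>} (zs m)"
      using zs(2)[of m] by (simp add: bounded_block_def)
    have "continuous_on {0..\<theta>} z'"
      unfolding z'_def[abs_def]
      by (intro bounded_bilinear.continuous_on[OF bounded_bilinear_matrix_vector_mult] continuous_intros
          continuous_on_lift[OF cont_zs] continuous_on_compose2[OF xs_cont[of UNIV]] continuous_on_compose2[OF Yi_cont[of UNIV]]) auto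
    moreover have "norm (z' t) \<le> \<eta> / 2" if t: "t \<in> {0..\<theta>}" for t
    proof -
      define s s' where "s = t + \<phi>" and "s' = t + \<phi>'"
      have s: "s \<in> {-1..\<theta> + 1}" "s' \<in> {-1..\<theta> + 1}"
        using t \<phi> \<phi>'(1) by (auto simp: s_def s'_def abs_le_iff)
      have ss: "s' - s = c"
        by (simp add: s_def s'_def \<phi>'_def)
      define \<rho> where "\<rho> = zs m t - c *\<^sub>R f (xs 0)"
      define q where "q = xs s' - xs s - (s' - s) *\<^sub>R f (xs s)"
      have \<rho>: "norm \<rho> \<le> \<eta> / 8 + Cm * \<eta>\<^sup>2"
      proof -
        have "norm (?W y t - c *\<^sub>R f (xs 0)) \<le> \<eta> * v m"
          using conv ycont yb t unfolding c_def block_map_limit_def by blast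
        also have "\<dots> \<le> \<eta> / 8"
          using mult_left_mono[OF m(2) \<eta>nn] by simp
        finally have "norm (?W y t - c *\<^sub>R f (xs 0)) \<le> \<eta> / 8" .
        moreover have "norm \<rho> \<le> norm (zs m t - ?W y t) + norm (?W y t - c *\<^sub>R f (xs 0))"
          using norm_triangle_ineq[of "zs m t - ?W y t" "?W y t - c *\<^sub>R f (xs 0)"] by (simp add: \<rho>_def)
        ultimately show ?thesis
          using zs(4)[OF t] by linarith
      qed
      \<comment> \<open>The term of first order in \<open>c\<close> in the expansion of the orbit
        cancels against the velocity component of \<open>zs m\<close>; what remains is
        \<open>\<rho>\<close>, the change of frame acting on \<open>\<rho>\<close>, and the Taylor
        error \<open>q\<close>.\<close>
      have "z' t = \<rho> - Yi s' *v (Y s' *v \<rho> - Y s *v \<rho>) - Yi s' *v q"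
      proof -
        have "Y s *v (c *\<^sub>R f (xs 0)) = c *\<^sub>R f (xs s)"
          by (simp add: matrix_vector_mult_scaleR Y_velocity)
        then have "lift \<phi> (zs m) t - xs s' = Y s *v \<rho> - q"
          by (simp add: lift_def \<rho>_def q_def ss s_def[symmetric] matrix_vector_mult_diff_distrib)
        then show ?thesis
          by (simp add: z'_def s'_def[symmetric] matrix_vector_mult_diff_distrib)
      qed
      then have "norm (z' t) \<le> norm \<rho> + norm (Yi s' *v (Y s' *v \<rho> - Y s *v \<rho>)) + norm (Yi s' *v q)"
        using norm_triangle_ineq4[of "\<rho> - Yi s' *v (Y s' *v \<rho> - Y s *v \<rho>)" "Yi s' *v q"]
          norm_triangle_ineq4[of \<rho> "Yi s' *v (Y s' *v \<rho> - Y s *v \<rho>)"] by simp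
      moreover have "norm (Yi s' *v (Y s' *v \<rho> - Y s *v \<rho>)) \<le> K\<^sup>2 * Kc * (1 + Cm) * \<eta>\<^sup>2"
      proof -
        have "norm (Yi s' *v (Y s' *v \<rho> - Y s *v \<rho>)) \<le> K * norm (Y s' *v \<rho> - Y s *v \<rho>)"
          by (rule K(2)[OF s(2)])
        also have "\<dots> \<le> K * (K * \<bar>c\<bar> * norm \<rho>)"
          using K(4)[OF s, of \<rho>] K(1) by (intro mult_left_mono) (auto simp: ss)
        also have "\<dots> \<le> K * (K * (Kc * \<eta>) * ((1 + Cm) * \<eta>))"
        proof -
          have "norm \<rho> \<le> (1 + Cm) * \<eta>"
            using \<rho> mult_left_mono[OF \<eta>sq M(2)] \<eta>nn by (simp add: distrib_right)
          then show ?thesis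
            using K(1) c Kc \<eta>nn by (intro mult_left_mono mult_mono) auto
        qed
        also have "\<dots> = K\<^sup>2 * Kc * (1 + Cm) * \<eta>\<^sup>2"
          by (simp add: power2_eq_square)
        finally show ?thesis .
      qed
      moreover have "norm (Yi s' *v q) \<le> K\<^sup>2 * Kc\<^sup>2 * \<eta>\<^sup>2"
      proof -
        have "norm (Yi s' *v q) \<le> K * norm q"
          by (rule K(2)[OF s(2)])
        also have "\<dots> \<le> K * (K * \<bar>c\<bar>\<^sup>2)"
          using K(3)[OF s] K(1) by (intro mult_left_mono) (auto simp: q_def ss)
        also have "\<dots> \<le> K * (K * (Kc * \<eta>)\<^sup>2)"
          using K(1) c by (intro mult_left_mono power_mono) auto
        also have "\<dots> = K\<^sup>2 * Kc\<^sup>2 * \<eta>\<^sup>2"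
          by (simp add: power2_eq_square)
        finally show ?thesis .
      qed
      ultimately have "norm (z' t) \<le> \<eta> / 8 + Cm * \<eta>\<^sup>2 + K\<^sup>2 * Kc * (1 + Cm) * \<eta>\<^sup>2 + K\<^sup>2 * Kc\<^sup>2 * \<eta>\<^sup>2"
        using \<rho> by linarith
      also have "\<dots> = \<eta> / 8 + (D * \<eta>) * \<eta>"
        by (simp add: D_def power2_eq_square algebra_simps)
      also have "\<dots> \<le> \<eta> / 8 + 1 / 4 * \<eta>"
        using mult_right_mono[OF \<eta>D \<eta>nn] by simp
      finally show ?thesis
        using \<eta>nn by simp
    qed
    ultimately have z': "bounded_block (\<eta> / 2) z'"
      by (simp add: bounded_block_def)
    have "bounded_block ((Km + Kc) * \<eta>) (zs i)" if "i \<le> m" for i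
    proof -
      have "Km * \<eta> \<le> (Km + Kc) * \<eta>"
        using Kc \<eta>nn by (simp add: mult_right_mono)
      then show ?thesis
        using zs(2)[OF that] by (auto simp: bounded_block_def intro: order.trans)
    qed
    moreover have "\<bar>\<phi>' - \<phi>\<bar> \<le> (Km + Kc) * \<eta>"
      using \<phi>'(2) M(1) \<eta>nn by (simp add: distrib_right add_increasing)
    moreover have "lift \<phi> (zs m) t = lift \<phi>' z' t" for t
      by (simp add: lift_def[of \<phi>'] z'_def)
    ultimately show "\<exists>zs \<phi>' z'. zs 0 = y \<and> (\<forall>i\<le>m. bounded_block ((Km + Kc) * \<eta>) (zs i)) \<and>
      (\<forall>i<m. block_step (- k) (lift \<phi> (zs i)) (lift \<phi> (zs (Suc i)))) \<and>
      \<bar>\<phi>' - \<phi>\<bar> \<le> (Km + Kc) * \<eta> \<and> bounded_block (\<eta> / 2) z' \<and>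
      (\<forall>t\<in>{0..\<theta>}. lift \<phi> (zs m) t = lift \<phi>' z' t)"
      using zs(1,3) z' by (intro exI[of _ zs] exI[of _ \<phi>'] exI[of _ z'] conjI) auto
  qed
qed

text \<open>The contraction is repeated with halved size each time. The phase steps are at most
  \<open>K * \<eta> / 2 ^ j\<close>, so the total drift is at most \<open>2 * K * \<eta>\<close> and
  the phase never leaves the range in which the contraction applies.\<close>

lemma block_orbit:
  assumes \<theta>: "0 < \<theta>" and k: "0 < k" and conv: "block_map_limit k \<theta> B l (f (xs 0)) v"
  obtains K \<eta>0 where "K \<ge> 0" "\<eta>0 > 0"
    "\<And>y \<eta>. \<eta> \<le> \<eta>0 \<Longrightarrow> bounded_block \<eta> y \<Longrightarrow>
      \<exists>ws. (\<forall>t\<in>{0..\<theta>}. ws 0 t = lift 0 y t) \<and> (\<forall>i. block_step (- k) (ws i) (ws (Suc i))) \<and>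
        (\<forall>i. \<forall>t\<in>{0..\<theta>}. norm (ws i t - xs t) \<le> K * \<eta>)"
proof -
  obtain m K \<eta>c where R: "1 \<le> m" "1 \<le> K" "0 < \<eta>c"
    "\<And>\<phi> y \<eta>. \<bar>\<phi>\<bar> \<le> 1 / 2 \<Longrightarrow> \<eta> \<le> \<eta>c \<Longrightarrow> bounded_block \<eta> y \<Longrightarrow>
    (\<exists>zs \<phi>' z'. zs 0 = y \<and> (\<forall>i\<le>m. bounded_block (K * \<eta>) (zs i)) \<and>
      (\<forall>i<m. block_step (- k) (lift \<phi> (zs i)) (lift \<phi> (zs (Suc i)))) \<and>
      \<bar>\<phi>' - \<phi>\<bar> \<le> K * \<eta> \<and> bounded_block (\<eta> / 2) z' \<and>
      (\<forall>t\<in>{0..\<theta>}. lift \<phi> (zs m) t = lift \<phi>' z' t))"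
    using rephased_contraction[OF \<theta> k conv] by blast
  obtain Kf where Kf: "Kf \<ge> 1"
    "\<And>t v. t \<in> {-1..\<theta> + 1} \<Longrightarrow> norm (Y t *v v) \<le> Kf * norm v"
    "\<And>s t. s \<in> {-1..\<theta> + 1} \<Longrightarrow> t \<in> {-1..\<theta> + 1} \<Longrightarrow> norm (xs t - xs s) \<le> Kf * \<bar>t - s\<bar>"
    using frame_bounds by metis
  show thesis
  proof (rule that)
    \<comment> \<open>Two of the three parts pay for the phase drift, one for the block coordinates.
      The bound \<open>1 / (4 * K)\<close> on the size keeps the drift at most 1/2.\<close>
    show "0 \<le> 3 * Kf * K" "0 < min \<eta>c (1 / (4 * K))"
      using R Kf by auto
    fix y :: "real \<Rightarrow> real^'n" and \<eta> :: real
    assume \<eta>: "\<eta> \<le> min \<eta>c (1 / (4 * K))" and y: "bounded_block \<eta> y"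
    have \<eta>nn: "0 \<le> \<eta>"
      using y \<theta> norm_ge_zero[of "y 0"] unfolding bounded_block_def by (meson atLeastAtMost_iff less_imp_le order.refl order.trans)
    have \<eta>K: "2 * K * \<eta> \<le> 1 / 2"
    proof -
      have "\<eta> \<le> 1 / (4 * K)"
        using \<eta> by simp
      then have "\<eta> * (4 * K) \<le> 1"
        using R(2) by (subst (asm) pos_le_divide_eq) auto
      then show ?thesis
        by (simp add: algebra_simps)
    qed
    define e where "e j = \<eta> / 2 ^ j" for j :: nat
    have e: "0 \<le> e j" "e j \<le> \<eta>" "e (Suc j) = e j / 2" for j
      using \<eta>nn by (auto simp: e_def divide_le_eq mult_le_cancel_left1)
    \<comment> \<open>The phase bound is the partial geometric sum of the steps so far,
      \<open>2 * K * (\<eta> - e j)\<close>; it is exact enough to be preserved by one more step of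
      size \<open>K * e j\<close>.\<close>
    define P where "P j s \<longleftrightarrow> bounded_block (e j) (snd s) \<and> \<bar>fst s\<bar> \<le> 2 * K * (\<eta> - e j)" for j and s :: "real \<times> (real \<Rightarrow> real^'n)"
    define Q where "Q j s s' \<longleftrightarrow> (\<exists>zs. zs 0 = snd s \<and> (\<forall>i\<le>m. bounded_block (K * e j) (zs i)) \<and>
        (\<forall>i<m. block_step (- k) (lift (fst s) (zs i)) (lift (fst s) (zs (Suc i)))) \<and>
        (\<forall>t\<in>{0..\<theta>}. lift (fst s) (zs m) t = lift (fst s') (snd s') t))" for j and s s' :: "real \<times> (real \<Rightarrow> real^'n)"
    have P\<phi>: "\<bar>fst s\<bar> \<le> 2 * K * \<eta>" "\<bar>fst s\<bar> \<le> 1 / 2" if "P j s" for j s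
    proof -
      have "2 * K * (\<eta> - e j) \<le> 2 * K * \<eta>"
        using R(2) e(1)[of j] by (intro mult_left_mono) auto
      then show "\<bar>fst s\<bar> \<le> 2 * K * \<eta>" "\<bar>fst s\<bar> \<le> 1 / 2"
        using that \<eta>K by (auto simp: P_def)
    qed
    have "\<exists>S. (\<forall>j. P j (S j) \<and> Q j (S j) (S (Suc j))) \<and> S 0 = (0, y)"
    proof -
      have "\<exists>S. \<forall>j. (P j (S j) \<and> (j = 0 \<longrightarrow> S j = (0, y))) \<and> Q j (S j) (S (Suc j))"
      proof (rule dependent_nat_choice)
        show "\<exists>s. P 0 s \<and> (0 = (0::nat) \<longrightarrow> s = (0, y))"
          using y by (intro exI[of _ "(0, y)"]) (auto simp: P_def e_def)
        fix s j assume "P j s \<and> (j = 0 \<longrightarrow> s = (0, y))"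
        then have Ps: "P j s" by simp
        then have "bounded_block (e j) (snd s)"
          by (simp add: P_def)
        moreover have "e j \<le> \<eta>c"
          using e(2)[of j] \<eta> by simp
        ultimately obtain zs \<phi>' z' where zs: "zs 0 = snd s" "\<forall>i\<le>m. bounded_block (K * e j) (zs i)"
          "\<forall>i<m. block_step (- k) (lift (fst s) (zs i)) (lift (fst s) (zs (Suc i)))"
          "\<bar>\<phi>' - fst s\<bar> \<le> K * e j" "bounded_block (e j / 2) z'"
          "\<forall>t\<in>{0..\<theta>}. lift (fst s) (zs m) t = lift \<phi>' z' t"
          using R(4)[OF P\<phi>(2)[OF Ps]] by blast
        have "\<bar>\<phi>'\<bar> \<le> 2 * K * (\<eta> - e j) + K * e j"
          using zs(4) Ps by (auto simp: P_def)
        also have "\<dots> = 2 * K * (\<eta> - e (Suc j))"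
          by (simp add: e(3) algebra_simps)
        finally have "P (Suc j) (\<phi>', z')"
          using zs(5) by (simp add: P_def e(3))
        moreover have "Q j s (\<phi>', z')"
          using zs by (auto simp: Q_def intro!: exI[of _ zs])
        ultimately show "\<exists>s'. (P (Suc j) s' \<and> (Suc j = 0 \<longrightarrow> s' = (0, y))) \<and> Q j s s'"
          by blast
      qed
      then show ?thesis
        by blast
    qed
    then obtain S where S: "\<And>j. P j (S j)" "\<And>j. Q j (S j) (S (Suc j))" "S 0 = (0, y)"
      by blast
    have "\<forall>j. \<exists>zs. zs 0 = snd (S j) \<and> (\<forall>i\<le>m. bounded_block (K * e j) (zs i)) \<and>
        (\<forall>i<m. block_step (- k) (lift (fst (S j)) (zs i)) (lift (fst (S j)) (zs (Suc i)))) \<and>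
        (\<forall>t\<in>{0..\<theta>}. lift (fst (S j)) (zs m) t = lift (fst (S (Suc j))) (snd (S (Suc j))) t)"
      using S(2) unfolding Q_def by blast
    then obtain ZS where ZS: "\<And>j. ZS j 0 = snd (S j)" "\<And>j i. i \<le> m \<Longrightarrow> bounded_block (K * e j) (ZS j i)"
        "\<And>j i. i < m \<Longrightarrow> block_step (- k) (lift (fst (S j)) (ZS j i)) (lift (fst (S j)) (ZS j (Suc i)))"
        "\<And>j t. t \<in> {0..\<theta>} \<Longrightarrow> lift (fst (S j)) (ZS j m) t = lift (fst (S (Suc j))) (snd (S (Suc j))) t"
      unfolding choice_iff by blast
    \<comment> \<open>Block \<open>n\<close> belongs to round \<open>n div m\<close> and stands at
      place \<open>n mod m\<close> in it. At the end of a round the last block is re-read at the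
      next phase, where it is the same function on the block interval.\<close>
    define ws where "ws n = lift (fst (S (n div m))) (ZS (n div m) (n mod m))" for n
    have "ws 0 t = lift 0 y t" for t
      by (simp add: ws_def ZS(1) S(3))
    moreover have "block_step (- k) (ws n) (ws (Suc n))" for n
    proof (cases "Suc (n mod m) = m")
      case True
      have idx: "Suc n div m = Suc (n div m)" "Suc n mod m = 0"
        using True by (simp_all add: div_Suc mod_Suc)
      have step: "block_step (- k) (ws n) (lift (fst (S (n div m))) (ZS (n div m) m))"
        using ZS(3)[of "n mod m" "n div m"] True R(1) by (simp add: ws_def)
      have eq: "lift (fst (S (n div m))) (ZS (n div m) m) t = ws (Suc n) t" if "t \<in> {0..\<theta>}" for t
        using ZS(4)[OF that, of "n div m"] by (simp only: ws_def idx ZS(1))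
      show ?thesis
        by (rule block_step_cong[OF step less_imp_le[OF \<theta>] refl eq])
    next
      case False
      then have "Suc n div m = n div m" "Suc n mod m = Suc (n mod m)"
        by (simp_all add: div_Suc mod_Suc)
      then show ?thesis
        using ZS(3)[of "n mod m" "n div m"] R(1) by (simp add: ws_def)
    qed
    moreover have "norm (ws n t - xs t) \<le> 3 * Kf * K * \<eta>" if t: "t \<in> {0..\<theta>}" for n t
    proof -
      define \<phi> where "\<phi> = fst (S (n div m))"
      define z where "z = ZS (n div m) (n mod m)"
      have \<phi>: "\<bar>\<phi>\<bar> \<le> 2 * K * \<eta>" "\<bar>\<phi>\<bar> \<le> 1 / 2"
        using P\<phi>[OF S(1)] by (auto simp: \<phi>_def)
      have s: "t + \<phi> \<in> {-1..\<theta> + 1}" "t \<in> {-1..\<theta> + 1}"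
        using t \<phi>(2) by (auto simp: abs_le_iff)
      have "norm (z t) \<le> K * e (n div m)"
        using ZS(2)[of "n mod m" "n div m"] R(1) t by (simp add: bounded_block_def z_def)
      also have "\<dots> \<le> K * \<eta>"
        using R(2) e(2) by (intro mult_left_mono) auto
      finally have zt: "norm (z t) \<le> K * \<eta>" .
      have "norm (ws n t - xs t) \<le> norm (xs (t + \<phi>) - xs t) + norm (Y (t + \<phi>) *v z t)"
        using norm_triangle_ineq[of "xs (t + \<phi>) - xs t" "Y (t + \<phi>) *v z t"]
        by (simp add: ws_def lift_def \<phi>_def[symmetric] z_def[symmetric] algebra_simps)
      also have "\<dots> \<le> Kf * \<bar>\<phi>\<bar> + Kf * norm (z t)"
        using Kf(3)[OF s(2,1)] Kf(2)[OF s(1), of "z t"] by simp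
      also have "\<dots> \<le> Kf * (2 * K * \<eta>) + Kf * (K * \<eta>)"
        using Kf(1) \<phi>(1) zt by (intro add_mono mult_left_mono) auto
      finally show ?thesis
        by (simp add: algebra_simps)
    qed
    ultimately show "\<exists>ws. (\<forall>t\<in>{0..\<theta>}. ws 0 t = lift 0 y t) \<and> (\<forall>i. block_step (- k) (ws i) (ws (Suc i))) \<and>
        (\<forall>i. \<forall>t\<in>{0..\<theta>}. norm (ws i t - xs t) \<le> 3 * Kf * K * \<eta>)"
      by (intro exI[of _ ws]) auto
  qed
qed

end


subsection \<open>Back to the delay equation\<close>

text \<open>Joins the one-sided derivatives at the junction of two blocks.\<close>

lemma has_vector_derivative_within_Un:
  assumes "(x has_vector_derivative d) (at t within S)" "(x has_vector_derivative d) (at t within T)"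
  shows "(x has_vector_derivative d) (at t within (S \<union> T))"
  using assms unfolding has_vector_derivative_def has_derivative_at_within Lim_within_Un by blast

context relative_periodic_orbit
begin

text \<open>The power \<open>h\<^sup>n\<^sup>-\<^sup>1\<close>, starting from \<open>h\<inverse>\<close> because block 0 is the initial function on \<open>[-\<theta>, 0]\<close>.\<close>

definition turn :: "nat \<Rightarrow> real^'n \<Rightarrow> real^'n" where
  "turn n v = ((*v) h ^^ n) (matrix_inv h *v v)"

lemma turn_Suc: "turn (Suc n) v = h *v turn n v"
  by (simp add: turn_def)

lemma turn_Suc_inv: "turn (Suc n) (matrix_inv h *v v) = turn n v"
  by (simp add: turn_def funpow_swap1 del: funpow.simps(2)) (simp add: funpow_Suc_right del: funpow.simps(2))

lemma h_inv_equiv: "f (matrix_inv h *v v) = matrix_inv h *v f v"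
  using h_equiv[of "matrix_inv h *v v"] by (metis h_inv)

lemma turn_equiv: "f (turn n v) = turn n (f v)"
  by (induction n) (simp_all add: turn_def h_inv_equiv h_equiv)

lemma norm_turn [simp]: "norm (turn n v) = norm v"
  by (induction n) (simp_all add: turn_def)

lemma bounded_linear_turn: "bounded_linear (turn n)"
proof (induction n)
  case 0
  then show ?case
    by (simp add: turn_def[abs_def])
next
  case (Suc n)
  then show ?case
    unfolding turn_Suc[abs_def] by (rule bounded_linear_compose[OF matrix_vector_mul_bounded_linear])
qed

lemma xs_shift_inv: "matrix_inv h *v xs t = xs (t - \<theta>)"
  using xs_shift[of "t - \<theta>"] by (metis diff_add_cancel h_inv(2))

lemma turn_xs: "turn n (xs s) = xs (s + (real n - 1) * \<theta>)"
proof (induction n)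
  case 0
  then show ?case
    by (simp add: turn_def xs_shift_inv)
next
  case (Suc n)
  then show ?case
    by (simp add: turn_Suc xs_shift algebra_simps)
qed

text \<open>Turning block \<open>n\<close> forward undoes the normalization: the initial condition
  of a block step becomes continuity at the junction, and \<open>f\<close> commutes with the turns,
  so the coupling to the previous block becomes the delayed term.\<close>

lemma glue_blocks:
  assumes \<theta>: "0 < \<theta>" and steps: "\<And>n. block_step b (ws n) (ws (Suc n))" and w0: "continuous_on {0..\<theta>} (ws 0)"
  shows "\<exists>x. dde_global_solution (\<lambda>x y. f x + b *\<^sub>R (x - h *v y)) \<theta> x \<and>
    (\<forall>n t. (real n - 1) * \<theta> \<le> t \<longrightarrow> t \<le> real n * \<theta> \<longrightarrow> x t = turn n (ws n (t - (real n - 1) * \<theta>)))"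
proof -
  \<comment> \<open>Left end of block \<open>n\<close>. The shift by one makes block 0 occupy
    \<open>[-\<theta>, 0]\<close>, so the equation itself starts with block 1.\<close>
  define a where "a n = (real n - 1) * \<theta>" for n
  have a_Suc: "a (Suc n) = a n + \<theta>" for n
    by (simp add: a_def algebra_simps)
  have a_mono: "a n < a (Suc n)" for n
    using \<theta> by (simp add: a_Suc)
  define idx where "idx t = nat \<lfloor>t / \<theta> + 1\<rfloor>" for t
  have idx: "a (idx t) \<le> t" "t < a (Suc (idx t))" if "- \<theta> \<le> t" for t
  proof -
    have "0 \<le> t / \<theta> + 1"
      using that \<theta> by (simp add: field_simps)
    then have "0 \<le> \<lfloor>t / \<theta> + 1\<rfloor>"
      by (simp only: zero_le_floor)
    then have "real (idx t) = of_int \<lfloor>t / \<theta> + 1\<rfloor>"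
      by (simp only: idx_def of_nat_nat)
    then have "real (idx t) \<le> t / \<theta> + 1" "t / \<theta> + 1 < real (idx t) + 1"
      by linarith+
    then show "a (idx t) \<le> t" "t < a (Suc (idx t))"
      using \<theta> by (simp_all add: a_def field_simps)
  qed
  have idx_eq: "idx t = n" if "a n \<le> t" "t < a (Suc n)" for t n
  proof -
    have "\<lfloor>t / \<theta> + 1\<rfloor> = int n"
      using that \<theta> by (intro floor_unique) (simp_all add: a_def field_simps)
    then show ?thesis
      by (simp add: idx_def)
  qed
  define x where "x t = turn (idx t) (ws (idx t) (t - a (idx t)))" for t
  have piece: "x t = turn n (ws n (t - a n))" if "a n \<le> t" "t \<le> a (Suc n)" for n t
  proof (cases "t = a (Suc n)")
    case True
    then have "idx t = Suc n"
      using a_mono by (intro idx_eq) auto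
    then have "x t = turn (Suc n) (ws (Suc n) 0)"
      using True by (simp add: x_def)
    also have "ws (Suc n) 0 = matrix_inv h *v ws n \<theta>"
      using steps[of n] by (simp add: block_step_def)
    finally show ?thesis
      using True by (simp add: turn_Suc_inv a_Suc)
  next
    case False
    then have "idx t = n"
      using that by (intro idx_eq) auto
    then show ?thesis
      by (simp add: x_def)
  qed
  have ws_cont: "continuous_on {0..\<theta>} (ws n)" for n
    using w0 steps[of "n - 1"] by (cases n) (auto simp: block_step_def)
  have piece_cont: "continuous_on {a n..a (Suc n)} x" for n
  proof -
    have "continuous_on {a n..a (Suc n)} (\<lambda>t. turn n (ws n (t - a n)))"
      by (intro bounded_linear.continuous_on[OF bounded_linear_turn] continuous_on_compose2[OF ws_cont[of n]] continuous_intros)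
        (auto simp: a_Suc)
    then show ?thesis
      using piece by (subst continuous_on_cong[OF refl, where g = "\<lambda>t. turn n (ws n (t - a n))"]) auto
  qed
  have cont_upto: "continuous_on {-\<theta>..a (Suc n)} x" for n
  proof (induction n)
    case 0
    then show ?case
      using piece_cont[of 0] by (simp add: a_def)
  next
    case (Suc n)
    have "-\<theta> \<le> a (Suc n)"
    proof -
      have "0 \<le> real n * \<theta>" "a (Suc n) = real n * \<theta>"
        using \<theta> by (simp_all add: a_def)
      then show ?thesis
        using \<theta> by linarith
    qed
    then have "{-\<theta>..a (Suc (Suc n))} = {-\<theta>..a (Suc n)} \<union> {a (Suc n)..a (Suc (Suc n))}"
      using a_mono[of "Suc n"] by auto
    then show ?case
      using Suc piece_cont[of "Suc n"] by (simp add: continuous_on_closed_Un)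
  qed
  have cont: "continuous_on {-\<theta>..} x"
    unfolding continuous_on_eq_continuous_within
  proof
    fix t assume "t \<in> {-\<theta>..}"
    then have t: "-\<theta> \<le> t" by simp
    have "at t within {-\<theta>..} = at t within {-\<theta>..a (Suc (idx t))}"
      by (rule at_within_nhd[where S = "{..<a (Suc (idx t))}"]) (use idx(2)[OF t] in auto)
    moreover have "continuous (at t within {-\<theta>..a (Suc (idx t))}) x"
      using cont_upto[of "idx t"] idx(2)[OF t] t unfolding continuous_on_eq_continuous_within by auto
    ultimately show "continuous (at t within {-\<theta>..}) x"
      by simp
  qed
  let ?F = "\<lambda>t. f (x t) + b *\<^sub>R (x t - h *v x (t - \<theta>))"
  have deriv: "(x has_vector_derivative ?F t) (at t within {a (Suc n)..a (Suc (Suc n))})"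
    if t: "a (Suc n) \<le> t" "t \<le> a (Suc (Suc n))" for n t
  proof -
    let ?s = "t - a (Suc n)"
    have s: "?s \<in> {0..\<theta>}"
      using t a_Suc[of "Suc n"] by auto
    have img: "(\<lambda>t. t - a (Suc n)) ` {a (Suc n)..a (Suc (Suc n))} = {0..\<theta>}"
      by (simp add: a_Suc[of "Suc n"] image_diff_atLeastAtMost)
    have w: "(ws (Suc n) has_vector_derivative f (ws (Suc n) ?s) + b *\<^sub>R (ws (Suc n) ?s - ws n ?s))
        (at ?s within (\<lambda>t. t - a (Suc n)) ` {a (Suc n)..a (Suc (Suc n))})"
      unfolding img using steps[of n] s by (simp add: block_step_def)
    have "((\<lambda>t. t - a (Suc n)) has_vector_derivative 1) (at t within {a (Suc n)..a (Suc (Suc n))})"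
      by (auto intro!: derivative_eq_intros simp: has_real_derivative_iff_has_vector_derivative[symmetric])
    from vector_diff_chain_within[OF this w]
    have "((\<lambda>t. ws (Suc n) (t - a (Suc n))) has_vector_derivative f (ws (Suc n) ?s) + b *\<^sub>R (ws (Suc n) ?s - ws n ?s))
        (at t within {a (Suc n)..a (Suc (Suc n))})"
      by (simp only: o_def scaleR_one)
    then have "((\<lambda>t. turn (Suc n) (ws (Suc n) (t - a (Suc n)))) has_vector_derivative
        turn (Suc n) (f (ws (Suc n) ?s) + b *\<^sub>R (ws (Suc n) ?s - ws n ?s))) (at t within {a (Suc n)..a (Suc (Suc n))})"
      by (rule bounded_linear.has_vector_derivative[OF bounded_linear_turn])
    also have "turn (Suc n) (f (ws (Suc n) ?s) + b *\<^sub>R (ws (Suc n) ?s - ws n ?s)) = ?F t"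
    proof -
      have "x t = turn (Suc n) (ws (Suc n) ?s)"
        by (rule piece[OF t])
      moreover have "x (t - \<theta>) = turn n (ws n (t - \<theta> - a n))"
        using t by (intro piece) (auto simp: a_Suc)
      moreover have "t - \<theta> - a n = ?s"
        by (simp add: a_Suc)
      ultimately show ?thesis
        using bounded_linear.linear[OF bounded_linear_turn[of "Suc n"]]
        by (simp add: turn_equiv turn_Suc[of n "ws n ?s"] linear_add linear_diff linear_scale)
    qed
    finally show ?thesis
      by (rule has_vector_derivative_transform[of t "{a (Suc n)..a (Suc (Suc n))}", rotated 2])
        (use t piece in auto)
  qed
  have a1: "a (Suc 0) = 0" "a 0 = - \<theta>"
    by (simp_all add: a_def)
  have "(x has_vector_derivative ?F t) (at t within {0..})" if t: "0 \<le> t" for t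
  proof -
    have tn: "a (idx t) \<le> t" "t < a (Suc (idx t))"
      using idx[of t] t \<theta> by auto
    then obtain n where n: "idx t = Suc n"
      using t a1(1) by (cases "idx t") auto
    have an: "0 \<le> a (Suc n)" for n
      using \<theta> by (simp add: a_def)
    have d: "(x has_vector_derivative ?F t) (at t within {a (Suc n)..a (Suc (Suc n))})"
      using tn n by (intro deriv) auto
    have "a (Suc n) < t \<or> t = a (Suc n)"
      using tn(1) n by auto
    \<comment> \<open>Three situations: an interior point of a block; time 0, where only the
      right-hand derivative matters; and a later junction, where the derivatives of both
      neighbouring blocks are needed.\<close>
    then consider "a (Suc n) < t" | "t = a (Suc n)" "n = 0" | j where "t = a (Suc n)" "n = Suc j"
      by (cases n) auto
    then show ?thesis
    proof cases
      case 1
      have "at t within {0..} = at t within {a (Suc n)..a (Suc (Suc n))}"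
        by (rule at_within_nhd[where S = "{a (Suc n)<..<a (Suc (Suc n))}"]) (use 1 tn n an[of n] in auto)
      then show ?thesis
        using d by simp
    next
      case 2
      have "at t within {0..} = at t within {a (Suc n)..a (Suc (Suc n))}"
        by (rule at_within_nhd[where S = "{..<a (Suc (Suc n))}"]) (use 2 tn n a1 in auto)
      then show ?thesis
        using d by simp
    next
      case 3
      have "(x has_vector_derivative ?F t) (at t within {a (Suc j)..a (Suc (Suc j))})"
        using 3 a_mono[of "Suc j"] by (intro deriv) auto
      then have "(x has_vector_derivative ?F t) (at t within ({a (Suc j)..a (Suc (Suc j))} \<union> {a (Suc n)..a (Suc (Suc n))}))"
        using d by (rule has_vector_derivative_within_Un)
      moreover have "at t within {0..} = at t within ({a (Suc j)..a (Suc (Suc j))} \<union> {a (Suc n)..a (Suc (Suc n))})"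
        by (rule at_within_nhd[where S = "{a (Suc j)<..<a (Suc (Suc n))}"])
          (use 3 tn n an[of j] a_mono[of "Suc j"] in auto)
      ultimately show ?thesis
        by simp
    qed
  qed
  then have "dde_global_solution (\<lambda>x y. f x + b *\<^sub>R (x - h *v y)) \<theta> x"
    using cont by (simp add: dde_global_solution_def)
  then show ?thesis
    by (intro exI[of _ x]) (simp add: piece a_def)
qed

text \<open>Stability speaks of all solutions on \<open>[0, T]\<close>, whereas the construction
  yields one; uniqueness transfers the estimate. Both solutions are bounded on the compact interval,
  so a local Lipschitz constant of \<open>f\<close> is enough.\<close>

lemma dde_solution_unique:
  assumes \<tau>: "0 \<le> \<tau>"
    and x: "dde_solution_on (\<lambda>x y. f x + b *\<^sub>R (x - h *v y)) \<tau> T x"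
    and y: "dde_solution_on (\<lambda>x y. f x + b *\<^sub>R (x - h *v y)) \<tau> T y"
    and init: "\<And>s. s \<in> {-\<tau>..0} \<Longrightarrow> x s = y s" and t: "t \<in> {-\<tau>..T}"
  shows "x t = y t"
proof -
  have cont: "continuous_on {-\<tau>..T} x" "continuous_on {-\<tau>..T} y"
    using x y by (auto simp: dde_solution_on_def)
  then have "bounded (x ` {-\<tau>..T} \<union> y ` {-\<tau>..T})"
    by (intro bounded_Un[THEN iffD2] conjI compact_imp_bounded compact_continuous_image) auto
  then obtain M where M: "\<And>z. z \<in> x ` {-\<tau>..T} \<union> y ` {-\<tau>..T} \<Longrightarrow> norm z \<le> M"
    unfolding bounded_pos by blast
  obtain C where C: "C \<ge> 0" "\<And>x y. norm x \<le> M \<Longrightarrow> norm y \<le> M \<Longrightarrow> norm (f x - f y) \<le> C * norm (x - y)"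
    using f_lipschitz_on_ball by metis
  let ?G = "\<lambda>x t. f (x t) + b *\<^sub>R (x t - h *v x (t - \<tau>))"
  have "x t - y t = 0"
  proof (rule delay_gronwall_zero[OF \<tau>, where L = "C + \<bar>b\<bar>" and d = "\<lambda>t. x t - y t" and d' = "\<lambda>t. ?G x t - ?G y t" and T = T])
    show "continuous_on {-\<tau>..T} (\<lambda>t. x t - y t)"
      by (intro continuous_on_diff cont)
    fix s assume s: "s \<in> {0..T}"
    show "((\<lambda>t. x t - y t) has_vector_derivative ?G x s - ?G y s) (at s within {0..T})"
      using x y s by (intro has_vector_derivative_diff) (auto simp: dde_solution_on_def)
    have "?G x s - ?G y s = (f (x s) - f (y s)) + b *\<^sub>R ((x s - y s) - h *v (x (s - \<tau>) - y (s - \<tau>)))"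
      by (simp add: algebra_simps matrix_vector_mult_diff_distrib)
    also have "norm \<dots> \<le> norm (f (x s) - f (y s)) + \<bar>b\<bar> * norm ((x s - y s) - h *v (x (s - \<tau>) - y (s - \<tau>)))"
      using norm_triangle_ineq[of "f (x s) - f (y s)" "b *\<^sub>R ((x s - y s) - h *v (x (s - \<tau>) - y (s - \<tau>)))"] by simp
    also have "\<dots> \<le> C * norm (x s - y s) + \<bar>b\<bar> * (norm (x s - y s) + norm (x (s - \<tau>) - y (s - \<tau>)))"
    proof (intro add_mono mult_left_mono)
      show "norm (f (x s) - f (y s)) \<le> C * norm (x s - y s)"
        using s \<tau> by (intro C(2) M) auto
      show "norm ((x s - y s) - h *v (x (s - \<tau>) - y (s - \<tau>))) \<le> norm (x s - y s) + norm (x (s - \<tau>) - y (s - \<tau>))"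
        using norm_triangle_ineq4[of "x s - y s" "h *v (x (s - \<tau>) - y (s - \<tau>))"] by simp
    qed simp
    also have "\<dots> \<le> (C + \<bar>b\<bar>) * (norm (x s - y s) + norm (x (s - \<tau>) - y (s - \<tau>)))"
      using C(1) by (simp add: algebra_simps)
    finally show "norm (?G x s - ?G y s) \<le> (C + \<bar>b\<bar>) * (norm (x s - y s) + norm (x (s - \<tau>) - y (s - \<tau>)))" .
  qed (use C init t in auto)
  then show ?thesis
    by simp
qed

lemma dde_stable_if_linear_convergence:
  assumes \<theta>: "0 < \<theta>" and k: "0 < k" and conv: "block_map_limit k \<theta> B l (f (xs 0)) v"
  shows "dde_stable (\<lambda>x y. f x + (- k) *\<^sub>R (x - h *v y)) \<theta> xs"
  unfolding dde_stable_def
proof (intro allI impI)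
  fix \<epsilon> :: real
  assume \<epsilon>: "0 < \<epsilon>"
  let ?F = "\<lambda>x y. f x + (- k) *\<^sub>R (x - h *v y)"
  obtain K \<eta>0 where K: "K \<ge> 0" "\<eta>0 > 0"
    "\<And>y \<eta>. \<eta> \<le> \<eta>0 \<Longrightarrow> bounded_block \<eta> y \<Longrightarrow>
      \<exists>ws. (\<forall>t\<in>{0..\<theta>}. ws 0 t = lift 0 y t) \<and> (\<forall>i. block_step (- k) (ws i) (ws (Suc i))) \<and>
        (\<forall>i. \<forall>t\<in>{0..\<theta>}. norm (ws i t - xs t) \<le> K * \<eta>)"
    using block_orbit[OF \<theta> k conv] by blast
  obtain Kf where Kf: "Kf \<ge> 1" "\<And>t v. t \<in> {-1..\<theta> + 1} \<Longrightarrow> norm (Yi t *v v) \<le> Kf * norm v"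
    using frame_bounds by metis
  \<comment> \<open>The denominator puts \<open>K * \<eta>\<close> strictly below
    \<open>\<epsilon>\<close>, also when \<open>K = 0\<close>.\<close>
  define \<eta> where "\<eta> = min \<eta>0 (\<epsilon> / (2 * (K + 1)))"
  define \<delta> where "\<delta> = \<eta> / Kf"
  have \<eta>: "0 < \<eta>" "\<eta> \<le> \<eta>0"
    using K \<epsilon> by (auto simp: \<eta>_def)
  have \<eta>\<epsilon>: "K * \<eta> < \<epsilon>"
  proof -
    have "\<eta> \<le> \<epsilon> / (2 * (K + 1))"
      by (simp add: \<eta>_def)
    then have "\<eta> * (2 * (K + 1)) \<le> \<epsilon>"
      using K(1) by (subst (asm) pos_le_divide_eq) auto
    moreover have "0 \<le> K * \<eta>"
      using K(1) \<eta>(1) by simp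
    ultimately show ?thesis
      using \<eta>(1) by (simp add: algebra_simps)
  qed
  have \<delta>: "0 < \<delta>" "Kf * \<delta> = \<eta>"
    using \<eta>(1) Kf(1) by (auto simp: \<delta>_def)
  have sol: "\<exists>x. dde_global_solution ?F \<theta> x \<and> (\<forall>s\<in>{-\<theta>..0}. x s = \<phi> s) \<and> (\<forall>t\<ge>0. norm (x t - xs t) < \<epsilon>)"
    if cont: "continuous_on {-\<theta>..0} \<phi>" and close: "\<And>s. s \<in> {-\<theta>..0} \<Longrightarrow> norm (\<phi> s - xs s) < \<delta>" for \<phi>
  proof -
    \<comment> \<open>The initial function, turned by \<open>h\<close> onto
      \<open>[0, \<theta>]\<close>, in the frame of phase 0. Since \<open>turn 0\<close> is the
      inverse of \<open>h\<close>, gluing gives back the given function on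
      \<open>[-\<theta>, 0]\<close>.\<close>
    define y where "y t = Yi t *v (h *v \<phi> (t - \<theta>) - xs t)" for t
    have "continuous_on {0..\<theta>} y"
      unfolding y_def[abs_def]
      by (intro bounded_bilinear.continuous_on[OF bounded_bilinear_matrix_vector_mult] Yi_cont xs_cont continuous_on_diff
          bounded_linear.continuous_on[OF matrix_vector_mul_bounded_linear] continuous_on_compose2[OF cont] continuous_intros) auto
    moreover have "norm (y t) \<le> \<eta>" if t: "t \<in> {0..\<theta>}" for t
    proof -
      have "h *v \<phi> (t - \<theta>) - xs t = h *v (\<phi> (t - \<theta>) - xs (t - \<theta>))"
        by (simp add: matrix_vector_mult_diff_distrib xs_shift)
      then have "norm (h *v \<phi> (t - \<theta>) - xs t) < \<delta>"
        using close[of "t - \<theta>"] t by simp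
      then have "Kf * norm (h *v \<phi> (t - \<theta>) - xs t) \<le> Kf * \<delta>"
        using Kf(1) by (intro mult_left_mono) auto
      moreover have "norm (y t) \<le> Kf * norm (h *v \<phi> (t - \<theta>) - xs t)"
        unfolding y_def using t by (intro Kf(2)) auto
      ultimately show ?thesis
        unfolding \<delta>(2) by simp
    qed
    ultimately have "bounded_block \<eta> y"
      by (simp add: bounded_block_def)
    then obtain ws where ws: "\<And>t. t \<in> {0..\<theta>} \<Longrightarrow> ws 0 t = lift 0 y t" "\<And>i. block_step (- k) (ws i) (ws (Suc i))"
        "\<And>i t. t \<in> {0..\<theta>} \<Longrightarrow> norm (ws i t - xs t) \<le> K * \<eta>"
      using K(3)[OF \<eta>(2)] by blast
    have w0: "ws 0 t = h *v \<phi> (t - \<theta>)" if "t \<in> {0..\<theta>}" for t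
      using ws(1)[OF that] by (simp add: lift_def y_def)
    have "continuous_on {0..\<theta>} (\<lambda>t. h *v \<phi> (t - \<theta>))"
      by (intro bounded_linear.continuous_on[OF matrix_vector_mul_bounded_linear] continuous_on_compose2[OF cont] continuous_intros) auto
    then have "continuous_on {0..\<theta>} (ws 0)"
      by (subst continuous_on_cong[OF refl w0]) auto
    from glue_blocks[where ws = ws and b = "- k", OF \<theta> ws(2) this]
    obtain x where x: "dde_global_solution ?F \<theta> x"
      "\<And>n t. (real n - 1) * \<theta> \<le> t \<Longrightarrow> t \<le> real n * \<theta> \<Longrightarrow> x t = turn n (ws n (t - (real n - 1) * \<theta>))"
      by blast
    have "x s = \<phi> s" if "s \<in> {-\<theta>..0}" for s
      using x(2)[of 0 s] w0[of "s + \<theta>"] that by (simp add: turn_def)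
    moreover have "norm (x t - xs t) < \<epsilon>" if t: "0 \<le> t" for t
    proof -
      define n where "n = nat \<lceil>t / \<theta>\<rceil>"
      have "0 \<le> t / \<theta>"
        using t \<theta> by simp
      then have "real n = of_int \<lceil>t / \<theta>\<rceil>"
        by (simp add: n_def)
      then have "t / \<theta> \<le> real n" "real n < t / \<theta> + 1"
        by linarith+
      then have n: "(real n - 1) * \<theta> \<le> t" "t \<le> real n * \<theta>"
        using \<theta> by (simp_all add: field_simps)
      define s where "s = t - (real n - 1) * \<theta>"
      have s: "s \<in> {0..\<theta>}"
        using n by (auto simp: s_def algebra_simps)
      have "x t - xs t = turn n (ws n s) - turn n (xs s)"
        using x(2)[OF n] by (simp add: turn_xs s_def)
      also have "\<dots> = turn n (ws n s - xs s)"
        by (simp add: linear_diff[OF bounded_linear.linear[OF bounded_linear_turn]])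
      also have "norm \<dots> \<le> K * \<eta>"
        using ws(3)[OF s] by simp
      finally show ?thesis
        using \<eta>\<epsilon> by simp
    qed
    ultimately show ?thesis
      using x(1) by blast
  qed
  show "\<exists>\<delta>>0. (\<forall>\<phi>. continuous_on {-\<theta>..0} \<phi> \<longrightarrow> (\<forall>s\<in>{-\<theta>..0}. norm (\<phi> s - xs s) < \<delta>) \<longrightarrow>
            (\<exists>x. dde_global_solution ?F \<theta> x \<and> (\<forall>s\<in>{-\<theta>..0}. x s = \<phi> s))) \<and>
      (\<forall>T x. T \<ge> 0 \<longrightarrow> dde_solution_on ?F \<theta> T x \<longrightarrow> (\<forall>s\<in>{-\<theta>..0}. norm (x s - xs s) < \<delta>) \<longrightarrow>
            (\<forall>t\<in>{0..T}. norm (x t - xs t) < \<epsilon>))"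
  proof (rule exI[of _ \<delta>], rule conjI, rule \<delta>(1), intro conjI allI impI ballI)
    fix \<phi> assume "continuous_on {-\<theta>..0} \<phi>" "\<forall>s\<in>{-\<theta>..0}. norm (\<phi> s - xs s) < \<delta>"
    then show "\<exists>x. dde_global_solution ?F \<theta> x \<and> (\<forall>s\<in>{-\<theta>..0}. x s = \<phi> s)"
      using sol[of \<phi>] by blast
  next
    fix T :: real and x t
    assume T: "0 \<le> T" and x: "dde_solution_on ?F \<theta> T x" and close: "\<forall>s\<in>{-\<theta>..0}. norm (x s - xs s) < \<delta>"
      and t: "t \<in> {0..T}"
    have "continuous_on {-\<theta>..0} x"
      using x T by (auto simp: dde_solution_on_def intro: continuous_on_subset)
    then obtain y where y: "dde_global_solution ?F \<theta> y" "\<And>s. s \<in> {-\<theta>..0} \<Longrightarrow> y s = x s" "\<And>t. 0 \<le> t \<Longrightarrow> norm (y t - xs t) < \<epsilon>"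
      using sol[of x] close by blast
    have ysol: "dde_solution_on ?F \<theta> T y"
      unfolding dde_solution_on_def
    proof (intro conjI ballI)
      show "continuous_on {-\<theta>..T} y"
        using y(1) by (auto simp: dde_global_solution_def intro: continuous_on_subset)
      fix s assume "s \<in> {0..T}"
      then have "(y has_vector_derivative ?F (y s) (y (s - \<theta>))) (at s within {0..})"
        using y(1) by (simp add: dde_global_solution_def)
      then show "(y has_vector_derivative ?F (y s) (y (s - \<theta>))) (at s within {0..T})"
        by (rule has_vector_derivative_within_subset) auto
    qed
    have "x t = y t"
    proof (rule dde_solution_unique[OF less_imp_le[OF \<theta>] x ysol])
      show "x s = y s" if "s \<in> {-\<theta>..0}" for s
        using y(2)[OF that] by simp
      show "t \<in> {-\<theta>..T}"
        using t \<theta> by simp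
    qed
    with y(3)[of t] t show "norm (x t - xs t) < \<epsilon>"
      by simp
  qed
qed

end


subsection \<open>Excluding a vanishing delay\<close>

text \<open>If \<theta> = 0, then \<open>Y\<^sub>h\<close> is the inverse of \<open>h\<close> and
  preserves norms. An isometry keeps the sum of the squared norms of the real and imaginary parts of
  an eigenvector, while the eigenvalue multiplies it by
  \<open>\<bar>\<mu>\<bar>\<^sup>2\<close>.\<close>

lemma orthogonal_spectrum_unit:
  fixes B :: "real^'n^'n"
  assumes B: "\<And>v. norm (B *v v) = norm v" and \<mu>: "\<mu> \<in> spectrum_c B"
  shows "cmod \<mu> = 1"
proof -
  obtain v where v: "v \<noteq> 0" "cmat B *v v = \<mu> *s v"
    using \<mu> spectrum_c_iff by blast
  define x y where "x = (\<chi> i. Re (v $ i))" and "y = (\<chi> i. Im (v $ i))"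
  have "(B *v x) $ i = Re ((cmat B *v v) $ i)" "(B *v y) $ i = Im ((cmat B *v v) $ i)" for i
    by (simp_all add: x_def y_def matrix_vector_mult_def cmat_def)
  then have Bx: "B *v x = Re \<mu> *\<^sub>R x - Im \<mu> *\<^sub>R y" and By: "B *v y = Im \<mu> *\<^sub>R x + Re \<mu> *\<^sub>R y"
    unfolding v(2) by (simp_all add: vec_eq_iff x_def y_def algebra_simps)
  have "(norm x)\<^sup>2 + (norm y)\<^sup>2 = (norm (B *v x))\<^sup>2 + (norm (B *v y))\<^sup>2"
    by (simp add: B)
  also have "\<dots> = ((Re \<mu>)\<^sup>2 + (Im \<mu>)\<^sup>2) * ((norm x)\<^sup>2 + (norm y)\<^sup>2)"
    unfolding Bx By power2_norm_eq_inner by (simp add: inner_simps inner_commute power2_eq_square algebra_simps)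
  finally have "(norm x)\<^sup>2 + (norm y)\<^sup>2 = (cmod \<mu>)\<^sup>2 * ((norm x)\<^sup>2 + (norm y)\<^sup>2)"
    by (simp add: cmod_power2)
  moreover have "(norm x)\<^sup>2 + (norm y)\<^sup>2 \<noteq> 0"
  proof
    assume "(norm x)\<^sup>2 + (norm y)\<^sup>2 = 0"
    then have "x = 0" "y = 0"
      by (simp_all add: sum_power2_eq_zero_iff)
    then have "v = 0"
      by (simp add: x_def y_def vec_eq_iff complex_eq_iff)
    with v(1) show False ..
  qed
  ultimately have "(cmod \<mu>)\<^sup>2 = 1"
    by auto
  then show ?thesis
    using power2_eq_imp_eq[of "cmod \<mu>" 1] by simp
qed

lemma det_mat: "det (mat c :: 'a::comm_ring_1^'n^'n) = c ^ CARD('n)"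
proof -
  have "det (mat c :: 'a^'n^'n) = (\<Prod>i\<in>UNIV. (mat c :: 'a^'n^'n) $ i $ i)"
    by (rule det_diagonal) (simp add: mat_def)
  then show ?thesis
    by (simp add: mat_def)
qed

text \<open>The characteristic polynomial has 1 as its only root, and that root is simple, so it is linear;
  comparing growth at infinity gives dimension one.\<close>

lemma orthogonal_simple_spectrum_dimension:
  fixes B :: "real^'n^'n"
  assumes B: "\<And>v. norm (B *v v) = norm v" and mult: "alg_mult B 1 = 1" and nz: "char_poly_c B \<noteq> 0"
    and unit: "\<And>\<mu>. \<mu> \<in> spectrum_c B \<Longrightarrow> cmod \<mu> = 1 \<Longrightarrow> \<mu> = 1"
  shows "CARD('n) = 1"
proof (rule ccontr)
  assume "CARD('n) \<noteq> 1"
  then have N: "CARD('n) = Suc (Suc (CARD('n) - 2))"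
    using zero_less_card_finite[where 'a = 'n] by linarith
  obtain g where g: "char_poly_c B = [:- 1, 1:] * g" and g1: "poly g 1 \<noteq> 0"
    using simple_eigenvalue_factor[OF mult nz] by blast
  have "poly g \<mu> \<noteq> 0" for \<mu>
  proof
    assume "poly g \<mu> = 0"
    then have "\<mu> \<in> spectrum_c B"
      by (simp add: spectrum_c_def g)
    then have "\<mu> = 1"
      using unit orthogonal_spectrum_unit[OF B] by blast
    with \<open>poly g \<mu> = 0\<close> g1 show False
      by simp
  qed
  then obtain c where c: "g = [:c:]"
    using fundamental_theorem_of_algebra_alt[of g] by auto
  \<comment> \<open>The growth at infinity is read off at \<open>\<epsilon> = 1 / x\<close>, as
    \<epsilon> tends to 0: the determinant tends to 1, but in dimension at least 2 a linear
    characteristic polynomial leaves a positive power of \<epsilon> on the right.\<close>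
  have det: "complex_of_real (det (mat 1 - \<epsilon> *\<^sub>R B)) = c * of_real (\<epsilon> ^ Suc (CARD('n) - 2) * (1 - \<epsilon>))" if "\<epsilon> \<noteq> 0" for \<epsilon> :: real
  proof -
    have "mat 1 - \<epsilon> *\<^sub>R B = mat \<epsilon> ** (mat (1 / \<epsilon>) - B)"
    proof -
      have "(mat 1 - \<epsilon> *\<^sub>R B) *v v = (mat \<epsilon> ** (mat (1 / \<epsilon>) - B)) *v v" for v
        using that
        by (simp add: matrix_vector_mult_diff_rdistrib mat_mult_vector vec_eq_iff algebra_simps
            flip: matrix_vector_mul_assoc scaleR_matrix_vector_assoc)
      then show ?thesis
        by (simp add: matrix_eq)
    qed
    then have "complex_of_real (det (mat 1 - \<epsilon> *\<^sub>R B)) = of_real (\<epsilon> ^ CARD('n)) * poly (char_poly_c B) (of_real (1 / \<epsilon>))"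
      by (simp add: det_mul det_mat poly_char_poly_c_of_real del: of_real_divide)
    also have "\<dots> = c * of_real (\<epsilon> ^ CARD('n) * (1 / \<epsilon> - 1))"
      by (simp add: g c algebra_simps)
    also have "\<epsilon> ^ CARD('n) * (1 / \<epsilon> - 1) = \<epsilon> ^ Suc (CARD('n) - 2) * (1 - \<epsilon>)"
      by (subst N) (use that in \<open>simp add: field_simps\<close>)
    finally show ?thesis .
  qed
  have "((\<lambda>\<epsilon>. complex_of_real (det (mat 1 - \<epsilon> *\<^sub>R B))) \<longlongrightarrow> complex_of_real (det (mat 1 - 0 *\<^sub>R B))) (at 0)"
  proof -
    have "continuous_on UNIV (\<lambda>\<epsilon>. complex_of_real (det (mat 1 - \<epsilon> *\<^sub>R B)))"
      by (intro continuous_on_of_real continuous_on_det) (auto intro!: continuous_intros)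
    then show ?thesis
      unfolding continuous_on_def by blast
  qed
  moreover have "((\<lambda>\<epsilon>. complex_of_real (det (mat 1 - \<epsilon> *\<^sub>R B))) \<longlongrightarrow> 0) (at 0)"
  proof (rule Lim_transform_eventually)
    have "((\<lambda>\<epsilon>. c * of_real (\<epsilon> ^ Suc (CARD('n) - 2) * (1 - \<epsilon>))) \<longlongrightarrow> c * of_real (0 ^ Suc (CARD('n) - 2) * (1 - 0))) (at (0::real))"
      by (intro tendsto_intros)
    then show "((\<lambda>\<epsilon>. c * of_real (\<epsilon> ^ Suc (CARD('n) - 2) * (1 - \<epsilon>))) \<longlongrightarrow> 0) (at (0::real))"
      by simp
    show "\<forall>\<^sub>F \<epsilon> in at 0. c * complex_of_real (\<epsilon> ^ Suc (CARD('n) - 2) * (1 - \<epsilon>)) = complex_of_real (det (mat 1 - \<epsilon> *\<^sub>R B))"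
      by (auto simp: eventually_at_filter det)
  qed
  ultimately have "complex_of_real (det (mat 1 - 0 *\<^sub>R B)) = 0"
    by (rule tendsto_unique[rotated]) simp
  then show False
    by simp
qed

lemma (in C2_field) ode_equilibrium:
  assumes x: "\<And>t. (x has_vector_derivative f (x t)) (at t)" and "f (x s) = 0"
  shows "x t = x s"
  by (rule ode_unique[where x = x and y = "\<lambda>_. x s" and ?t0.0 = s]) (use assms in \<open>auto simp: has_vector_derivative_const\<close>)

text \<open>Rolle's theorem over one period, applied to the only coordinate.\<close>

lemma one_dimensional_periodic_equilibrium:
  fixes f :: "real^'n \<Rightarrow> real^'n"
  assumes N: "CARD('n) = 1" and x: "\<And>t. (x has_vector_derivative f (x t)) (at t)"
    and p: "0 < p" "x p = x 0"
  shows "\<exists>s. f (x s) = 0"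
proof -
  obtain i where i: "(UNIV :: 'n set) = {i}"
    using N card_1_singletonE by blast
  have d: "((\<lambda>t. x t $ i) has_real_derivative f (x t) $ i) (at t)" for t
    using bounded_linear.has_vector_derivative[OF bounded_linear_vec_nth x]
    by (simp add: has_real_derivative_iff_has_vector_derivative)
  then have "continuous_on {0..p} (\<lambda>t. x t $ i)"
    by (meson DERIV_isCont continuous_at_imp_continuous_on)
  then have "\<exists>s>0. s < p \<and> (*) (f (x s) $ i) = (\<lambda>v. 0)"
    using d p by (intro Rolle_deriv) (auto simp: has_field_derivative_def)
  then obtain s where "(*) (f (x s) $ i) = (\<lambda>v. 0)"
    by blast
  then have "f (x s) $ i = 0"
    by (metis mult.right_neutral)
  then have "f (x s) = 0"
    using i by (auto simp: vec_eq_iff)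
  then show ?thesis ..
qed

subsection \<open>Stability\<close>

theorem theorem2p2:
  fixes f :: "real^'n \<Rightarrow> real^'n"
    and f' :: "real^'n \<Rightarrow> ((real^'n) \<Rightarrow>\<^sub>L (real^'n))"
    and f'' :: "real^'n \<Rightarrow> ((real^'n) \<Rightarrow>\<^sub>L ((real^'n) \<Rightarrow>\<^sub>L (real^'n)))"
    and \<Gamma> :: "(real^'n^'n) set"
    and xs :: "real \<Rightarrow> real^'n"
    and p :: real
    and Y :: "real \<Rightarrow> real^'n^'n"
    and h :: "real^'n^'n"
    and \<theta> :: real
  assumes f_deriv: "\<And>x. (f has_derivative blinfun_apply (f' x)) (at x)"
    and f'_deriv: "\<And>x. (f' has_derivative blinfun_apply (f'' x)) (at x)"
    and f''_cont: "continuous_on UNIV f''"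
    and Gamma_orth: "\<And>\<gamma>. \<gamma> \<in> \<Gamma> \<Longrightarrow> orthogonal_matrix \<gamma>"
    and Gamma_one: "mat 1 \<in> \<Gamma>"
    and Gamma_mult: "\<And>\<gamma> \<delta>. \<gamma> \<in> \<Gamma> \<Longrightarrow> \<delta> \<in> \<Gamma> \<Longrightarrow> \<gamma> ** \<delta> \<in> \<Gamma>"
    and Gamma_inv: "\<And>\<gamma>. \<gamma> \<in> \<Gamma> \<Longrightarrow> matrix_inv \<gamma> \<in> \<Gamma>"
    and Gamma_compact: "compact \<Gamma>"
    and equivariant: "\<And>x \<gamma>. \<gamma> \<in> \<Gamma> \<Longrightarrow> f (\<gamma> *v x) = \<gamma> *v f x"
    and xs_ode: "\<And>t. (xs has_vector_derivative f (xs t)) (at t)"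
    and p_pos: "p > 0"
    and xs_periodic: "\<And>t. xs (t + p) = xs t"
    and p_minimal: "\<And>q. 0 < q \<Longrightarrow> q < p \<Longrightarrow> \<exists>t. xs (t + q) \<noteq> xs t"
    and wave: "discrete_wave \<Gamma> xs"
    and Y_0: "Y 0 = mat 1"
    and Y_ode: "\<And>t. (Y has_vector_derivative (matrix (blinfun_apply (f' (xs t))) ** Y t)) (at t)"
    and h_H: "h \<in> spatiotemporal_sym \<Gamma> xs"
    and theta_range: "0 \<le> \<theta>" "\<theta> < p"
    and theta_shift: "h *v xs 0 = xs \<theta>"
    and one_simple: "1 \<in> spectrum_c (matrix_inv h ** Y \<theta>)"
                    "alg_mult (matrix_inv h ** Y \<theta>) 1 = 1"
    and no_other_unit: "\<And>\<mu>. \<mu> \<in> spectrum_c (matrix_inv h ** Y \<theta>) \<Longrightarrow> cmod \<mu> = 1 \<Longrightarrow> \<mu> = 1"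
    and unstable_real: "\<And>\<mu>. \<mu> \<in> spectrum_c (matrix_inv h ** Y \<theta>) \<Longrightarrow> cmod \<mu> > 1 \<Longrightarrow>
                          \<mu> \<in> \<real> \<and> - exp 2 < Re \<mu> \<and> Re \<mu> < -1"
  shows "\<exists>a c. a < c \<and> c \<le> 0 \<and>
           (\<forall>b\<in>{a<..<c}. dde_stable (\<lambda>x y. f x + b *\<^sub>R (x - h *v y)) \<theta> xs)"
proof -
  let ?B = "matrix_inv h ** Y \<theta>"
  have hG: "h \<in> \<Gamma>"
    using h_H by (simp add: spatiotemporal_sym_def)
  interpret relative_periodic_orbit f f' f'' xs Y h \<theta>
    using f_deriv f'_deriv f''_cont Gamma_orth[OF hG] equivariant[OF hG] xs_ode Y_0 Y_ode theta_shift
    by unfold_locales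
  have char_nz: "char_poly_c ?B \<noteq> 0"
  proof
    \<comment> \<open>A vanishing polynomial would put every number into the spectrum, among them
      -1, a second point of the unit circle.\<close>
    assume "char_poly_c ?B = 0"
    then have "- 1 \<in> spectrum_c ?B"
      by (simp add: spectrum_c_def)
    then show False
      using no_other_unit[of "- 1"] by simp
  qed
  \<comment> \<open>An equilibrium would be constant and so have the period \<open>p / 2\<close> as
    well, against minimality of \<open>p\<close>.\<close>
  have moving: "f (xs s) \<noteq> 0" for s
  proof
    assume "f (xs s) = 0"
    then have "xs t = xs s" for t
      using ode_equilibrium[OF xs_ode] by blast
    then have "xs (t + p / 2) = xs t" for t
      by metis
    then show False
      using p_minimal[of "p / 2"] p_pos by auto
  qed
  have \<theta>: "0 < \<theta>"
  proof (rule ccontr)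
    assume "\<not> 0 < \<theta>"
    then have "\<theta> = 0"
      using theta_range by simp
    then have "norm (?B *v v) = norm v" for v
      by (simp add: Y_0)
    then have "CARD('n) = 1"
      using orthogonal_simple_spectrum_dimension[OF _ one_simple(2) char_nz no_other_unit] by blast
    then show False
      using one_dimensional_periodic_equilibrium[OF _ xs_ode p_pos] xs_periodic[of 0] moving by auto
  qed
  obtain l where l: "l \<bullet> f (xs 0) = 1" "\<And>x. l \<bullet> (?B *v x) = l \<bullet> x"
    "\<And>v. ?B *v v = v \<Longrightarrow> l \<bullet> v = 0 \<Longrightarrow> v = 0"
    using simple_eigenvalue_left_eigenvector[OF one_simple(2) char_nz B_velocity[unfolded B_def] moving] by blast
  define U where "U = {\<mu> \<in> spectrum_c ?B. cmod \<mu> > 1}"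
  have "finite U"
    unfolding U_def spectrum_c_def using poly_roots_finite[OF char_nz] by simp
  \<comment> \<open>The inserted 0 covers the case without unstable eigenvalues and makes the right
    end \<open>- \<beta>0 / \<theta>\<close> of the interval nonpositive.\<close>
  define \<beta>0 where "\<beta>0 = Max (insert 0 ((\<lambda>\<mu>. ln (- Re \<mu>) / 2) ` U))"
  have \<beta>0_ge: "0 \<le> \<beta>0" "\<And>\<mu>. \<mu> \<in> U \<Longrightarrow> ln (- Re \<mu>) / 2 \<le> \<beta>0"
    unfolding \<beta>0_def using \<open>finite U\<close> by (intro Max_ge; simp)+
  have \<beta>0_less: "\<beta>0 < 1"
  proof -
    have "ln (- Re \<mu>) / 2 < 1" if "\<mu> \<in> U" for \<mu>
    proof -
      have "- Re \<mu> < exp 2" "1 < - Re \<mu>"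
        using unstable_real[of \<mu>] that by (auto simp: U_def)
      then have "ln (- Re \<mu>) < ln (exp 2)"
        by (subst ln_less_cancel_iff) auto
      then show ?thesis
        by simp
    qed
    then show ?thesis
      using \<open>finite U\<close> by (auto simp: \<beta>0_def)
  qed
  show ?thesis
  proof (rule exI[of _ "- 1 / \<theta>"], rule exI[of _ "- \<beta>0 / \<theta>"], intro conjI ballI)
    show "- 1 / \<theta> < - \<beta>0 / \<theta>" "- \<beta>0 / \<theta> \<le> 0"
      using \<theta> \<beta>0_less \<beta>0_ge(1) by (simp_all add: divide_strict_right_mono)
    fix b assume b: "b \<in> {- 1 / \<theta><..<- \<beta>0 / \<theta>}"
    define k where "k = - b"
    have k\<theta>: "\<beta>0 < k * \<theta>" "k * \<theta> < 1"
      using b \<theta> by (auto simp: k_def field_simps)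
    have k: "0 < k"
      using k\<theta>(1) \<beta>0_ge(1) \<theta> zero_less_mult_pos2[of k \<theta>] by simp
    have outer: "\<mu> \<in> \<real> \<and> - exp (2 * (k * \<theta>)) < Re \<mu> \<and> Re \<mu> < 0" if "\<mu> \<in> spectrum_c ?B" "cmod \<mu> > 1" for \<mu>
    proof -
      have \<mu>: "\<mu> \<in> \<real>" "1 < - Re \<mu>"
        using unstable_real[OF that] by auto
      have "ln (- Re \<mu>) \<le> 2 * \<beta>0"
        using \<beta>0_ge(2)[of \<mu>] that by (simp add: U_def)
      then have "ln (- Re \<mu>) < 2 * (k * \<theta>)"
        using k\<theta>(1) by simp
      then have "exp (ln (- Re \<mu>)) < exp (2 * (k * \<theta>))"
        by simp
      then show ?thesis
        using \<mu> by simp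
    qed
    obtain v where v: "block_map_limit k \<theta> ?B l (f (xs 0)) v"
      using block_map_convergence[OF \<theta> k k\<theta>(2) l B_velocity[unfolded B_def] no_other_unit outer] by blast
    show "dde_stable (\<lambda>x y. f x + b *\<^sub>R (x - h *v y)) \<theta> xs"
      using dde_stable_if_linear_convergence[OF \<theta> k v[folded B_def]] by (simp add: k_def)
  qed
qed

end
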